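(* Let $\mathfrak g$ be a complex semisimple Lie algebra with Killing form $(\cdot,\cdot)$, $\sigma$ an involutive automorphism of $\mathfrak g$, and $\mathfrak g=\mathfrak k\oplus\mathfrak p$ the decomposition into the $+1$- and $-1$-eigenspaces of $\sigma$. Let $\mathfrak u^-=\bigoplus_{j\in\mathbb Z,\,j<0}(t^j\otimes\mathfrak k)\oplus\bigoplus_{j\in\frac12+\mathbb Z,\,j<0}(t^j\otimes\mathfrak p)$, regarded as a subalgebra of the affine Lie algebra $\widehat L(\mathfrak g,\sigma)$, and let $L_p:\bigwedge^p\mathfrak u^-\to\bigwedge^p\mathfrak u^-$ be the Laplacian. Then for every $p\ge 0$ and every $x\in\bigwedge^p\mathfrak u^-$, $$L_p(x)=-\tfrac12\,(d+\Omega_{\mathfrak k})(x).$$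
   Context: Affine algebra: $\widehat L(\mathfrak g,\sigma)=L(\mathfrak g,\sigma)\oplus\mathbb Cc\oplus\mathbb Cd$, where $L(\mathfrak g,\sigma)=\bigoplus_{j\in\mathbb Z}(t^j\otimes\mathfrak k)\oplus\bigoplus_{j\in\frac12+\mathbb Z}(t^j\otimes\mathfrak p)$. Writing $x_r=t^r\otimes x$, the bracket is: $c$ central, $[d,x_r]=r\,x_r$, $[x_r,y_s]=[x,y]_{r+s}+\delta_{r,-s}\,r\,(x,y)\,c$. The form $(\cdot,\cdot)$ is extended to $\widehat L(\mathfrak g,\sigma)$ by $(x_r,y_s)=\delta_{r,-s}(x,y)$, $(L(\mathfrak g,\sigma),d)=(L(\mathfrak g,\sigma),c)=(c,c)=(d,d)=0$, $(c,d)=1$. The elements $d$ and those of $\mathfrak k=t^0\otimes\mathfrak k$ act on $\mathfrak u^-$ by the adjoint action and on $\bigwedge\mathfrak u^-$ by derivations. $\Omega_{\mathfrak k}=\sum_i b_ib_i'$ is the Casimir operator of $\mathfrak k$, with $\{b_i\},\{b_i'\}$ bases of $\mathfrak k$ dual with respect to $(\cdot,\cdot)$. Chevalley generators: fix a Borel subalgebra $\mathfrak b_0$ of $\mathfrak k$ with Cartan component $\mathfrak h_0$ and positive roots $\Delta_0^+$. Put $\widehat{\mathfrak h}=\mathfrak h_0\oplus\mathbb Cc\oplus\mathbb Cd$, let $\widehat\Delta$ be the set of roots of $\widehat L(\mathfrak g,\sigma)$ with respect to $\widehat{\mathfrak h}$, $\widehat\Delta^+=\Delta_0^+\cup\{\alpha\in\widehat\Delta\mid\alpha(d)>0\}$,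 and let $\{\alpha_i\}$ be the corresponding finite set of simple roots. Let $\delta\in\widehat{\mathfrak h}^*$ be given by $\delta(\mathfrak h_0)=\delta(c)=0$, $\delta(d)=1$, and write $\alpha_i=s_i\delta+\overline\alpha_i$, with $\overline\alpha_i\ne0$ the restriction of $\alpha_i$ to $\mathfrak h_0$. For $\mu\in\mathfrak h_0^*$ let $h_\mu\in\mathfrak h_0$ satisfy $\mu(h)=(h_\mu,h)$ for all $h\in\mathfrak h_0$, and set $(\mu,\eta)=(h_\mu,h_\eta)$. Put $h_i=\frac{2}{(\overline\alpha_i,\overline\alpha_i)}h_{\overline\alpha_i}$ and $\alpha_i^\vee=\frac{2s_i}{(\overline\alpha_i,\overline\alpha_i)}c+h_i$. Fix $e_i=t^{s_i}\otimes X_i$ and $f_i=t^{-s_i}\otimes Y_i$ in the root spaces of $\alpha_i$ and $-\alpha_i$ with $(X_i,Y_j)=\delta_{i,j}\frac{2}{(\overline\alpha_i,\overline\alpha_i)}$, so that $[e_i,f_j]=\delta_{i,j}\alpha_i^\vee$. Hermitian form: let $\mathfrak h_{\mathbb R}$ be the real span of the $\alpha_i^\vee$, let $\widehat L(\mathfrak g,\sigma)_{\mathbb R}$ be the real Lie algebra generated by $\mathfrak h_{\mathbb R}\oplus\mathbb Rd$ and all the $e_i,f_i$ (a real form of $\widehat L(\mathfrak g,\sigma)$), and let $conj$ be the corresponding conjugation. Let $\sigma_o$ be the conjugate-linear antiautomorphism of $\widehat L(\mathfrak g,\sigma)$ with $\sigma_o(h)=conj(h)$ for $h\in\widehat{\mathfrak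 h}$, $\sigma_o(e_i)=f_i$, $\sigma_o(f_i)=e_i$. Define $\{x,y\}=(x,\sigma_o(y))$; this restricts to a positive definite Hermitian form on $\mathfrak u^-$. It is extended to $\bigwedge\mathfrak u^-$ by making different degrees orthogonal and setting $\{X_1\wedge\dots\wedge X_r,Y_1\wedge\dots\wedge Y_r\}=\det(\{X_i,Y_j\})$. Laplacian: $\partial_p:\bigwedge^p\mathfrak u^-\to\bigwedge^{p-1}\mathfrak u^-$ is the Chevalley–Eilenberg boundary operator $\partial_p(X_1\wedge\dots\wedge X_p)=\sum_{i<j}(-1)^{i+j}[X_i,X_j]\wedge X_1\wedge\dots\widehat{X_i}\dots\widehat{X_j}\dots\wedge X_p$ for $p>1$, and $\partial_1=\partial_0=0$. $\partial_p^*$ is the adjoint of $\partial_p$ with respect to $\{\cdot,\cdot\}$, and $L_p=\partial_{p+1}\partial_{p+1}^*+\partial_p^*\partial_p$. *)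

theory Defs
  imports
    "HOL-Library.Poly_Mapping"
    "HOL-Library.Product_Plus"
    "Jordan_Normal_Form.Determinant"
    Complex_Main
begin

section \<open>Complex vector spaces\<close>

class complex_vector = ab_group_add +
  fixes cscale :: "complex \<Rightarrow> 'a \<Rightarrow> 'a"  (infixr "*\<^sub>C" 75)
  assumes cscale_add_right: "c *\<^sub>C (x + y) = c *\<^sub>C x + c *\<^sub>C y"
    and cscale_add_left: "(b + c) *\<^sub>C x = b *\<^sub>C x + c *\<^sub>C x"
    and cscale_cscale: "b *\<^sub>C c *\<^sub>C x = (b * c) *\<^sub>C x"
    and cscale_one: "1 *\<^sub>C x = x"

global_interpretation cvec: vector_space "cscale :: complex \<Rightarrow> 'a \<Rightarrow> 'a :: complex_vector"
  by unfold_locales (simp_all add: cscale_add_right cscale_add_left cscale_cscale cscale_one)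

global_interpretation cvec: vector_space_pair
    "cscale :: complex \<Rightarrow> 'a \<Rightarrow> 'a :: complex_vector"
    "cscale :: complex \<Rightarrow> 'b \<Rightarrow> 'b :: complex_vector"
  by unfold_locales

instantiation complex :: complex_vector
begin
definition cscale_complex :: "complex \<Rightarrow> complex \<Rightarrow> complex" where
  "cscale_complex c x = c * x"
instance
  by standard (simp_all add: cscale_complex_def algebra_simps)
end

instantiation prod :: (complex_vector, complex_vector) complex_vector
begin
definition cscale_prod :: "complex \<Rightarrow> 'a \<times> 'b \<Rightarrow> 'a \<times> 'b" where
  "cscale_prod c x = (c *\<^sub>C fst x, c *\<^sub>C snd x)"
instance
  by standard
    (simp_all add: cscale_prod_def prod_eq_iff cscale_add_right cscale_add_left cscale_cscale cscale_one)
end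

instantiation poly_mapping :: (type, complex_vector) complex_vector
begin
lift_definition cscale_poly_mapping :: "complex \<Rightarrow> ('a \<Rightarrow>\<^sub>0 'b) \<Rightarrow> ('a \<Rightarrow>\<^sub>0 'b)"
  is "\<lambda>c f k. c *\<^sub>C f k"
  by (rule finite_subset[rotated]) auto
instance
  by standard
    (rule poly_mapping_eqI;
      simp add: cscale_poly_mapping.rep_eq lookup_add cscale_add_right cscale_add_left
        cscale_cscale cscale_one)+
end

definition clinear_on :: "'a::complex_vector set \<Rightarrow> ('a \<Rightarrow> 'b::complex_vector) \<Rightarrow> bool" where
  "clinear_on U f \<longleftrightarrow>
    (\<forall>x\<in>U. \<forall>y\<in>U. f (x + y) = f x + f y) \<and> (\<forall>c. \<forall>x\<in>U. f (c *\<^sub>C x) = c *\<^sub>C f x)"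

definition antilinear_on :: "'a::complex_vector set \<Rightarrow> ('a \<Rightarrow> 'b::complex_vector) \<Rightarrow> bool" where
  "antilinear_on U f \<longleftrightarrow>
    (\<forall>x\<in>U. \<forall>y\<in>U. f (x + y) = f x + f y) \<and> (\<forall>c. \<forall>x\<in>U. f (c *\<^sub>C x) = cnj c *\<^sub>C f x)"

text \<open>A linear functional on a subspace is represented by a function that vanishes off it, so
  that equal functionals are equal functions.\<close>

definition dual_space :: "'a::complex_vector set \<Rightarrow> ('a \<Rightarrow> complex) set" where
  "dual_space U = {\<phi>. clinear_on U \<phi> \<and> (\<forall>x. x \<notin> U \<longrightarrow> \<phi> x = 0)}"

text \<open>The trace is computed in an arbitrary basis; it is meant for finite-dimensional types only.\<close>

definition ctrace :: "('a::complex_vector \<Rightarrow> 'a) \<Rightarrow> complex" where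
  "ctrace f =
    (let B = (SOME B. cvec.independent B \<and> cvec.span B = UNIV)
     in \<Sum>b\<in>B. cvec.representation B (f b) b)"


section \<open>The exterior algebra\<close>

text \<open>The exterior algebra of the space of all \<open>'v\<close> is the free vector space on the lists of
  vectors, the list \<open>[X\<^sub>1, \<dots>, X\<^sub>p]\<close> standing for \<open>X\<^sub>1 \<and> \<dots> \<and> X\<^sub>p\<close>, modulo multilinearity and
  alternation.\<close>

definition wedge_relators :: "('v::complex_vector list \<Rightarrow>\<^sub>0 complex) set" where
  "wedge_relators =
     {Poly_Mapping.single (Xs[i := a + b]) 1
        - Poly_Mapping.single (Xs[i := a]) 1 - Poly_Mapping.single (Xs[i := b]) 1
       | Xs i a b. i < length Xs}
   \<union> {Poly_Mapping.single (Xs[i := c *\<^sub>C a]) 1 - Poly_Mapping.single (Xs[i := a]) c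
       | Xs i a c. i < length Xs}
   \<union> {Poly_Mapping.single Xs 1 | Xs i j. i < j \<and> j < length Xs \<and> Xs ! i = Xs ! j}"

definition wedge_rel :: "('v::complex_vector list \<Rightarrow>\<^sub>0 complex) \<Rightarrow> ('v list \<Rightarrow>\<^sub>0 complex) \<Rightarrow> bool" where
  "wedge_rel f g \<longleftrightarrow> f - g \<in> cvec.span wedge_relators"

lemma equivp_wedge_rel: "equivp wedge_rel"
proof (rule equivpI)
  show "reflp wedge_rel"
    by (simp add: reflp_def wedge_rel_def cvec.span_zero)
  show "symp wedge_rel"
    by (rule sympI) (use cvec.span_neg in \<open>fastforce simp: wedge_rel_def\<close>)
  show "transp wedge_rel"
    by (rule transpI) (use cvec.span_add in \<open>fastforce simp: wedge_rel_def\<close>)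
qed

quotient_type (overloaded) 'v ext = "'v::complex_vector list \<Rightarrow>\<^sub>0 complex" / wedge_rel
  by (rule equivp_wedge_rel)

lemma diff_diff_eq_diff: "(a - b) - (c - d) = (a - c) - (b - (d::'a::ab_group_add))"
  by (simp add: algebra_simps)

instantiation ext :: (complex_vector) complex_vector
begin
lift_definition zero_ext :: "'a ext" is 0 .
lift_definition plus_ext :: "'a ext \<Rightarrow> 'a ext \<Rightarrow> 'a ext" is "(+)"
  unfolding wedge_rel_def add_diff_add by (rule cvec.span_add)
lift_definition minus_ext :: "'a ext \<Rightarrow> 'a ext \<Rightarrow> 'a ext" is "(-)"
  unfolding wedge_rel_def diff_diff_eq_diff by (rule cvec.span_diff)
lift_definition uminus_ext :: "'a ext \<Rightarrow> 'a ext" is uminus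
  unfolding wedge_rel_def minus_diff_minus by (rule cvec.span_neg)
lift_definition cscale_ext :: "complex \<Rightarrow> 'a ext \<Rightarrow> 'a ext" is cscale
  unfolding wedge_rel_def cvec.scale_right_diff_distrib[symmetric] by (rule cvec.span_scale)
instance
  by standard
    (transfer, simp add: wedge_rel_def cvec.span_zero algebra_simps cscale_add_right
        cscale_add_left cscale_cscale cscale_one)+
end

lift_definition wedge :: "'v::complex_vector list \<Rightarrow> 'v ext" is "\<lambda>Xs. Poly_Mapping.single Xs 1" .

text \<open>The exterior power \<open>\<And>\<^sup>p U\<close> of a subspace \<open>U\<close>, embedded into the exterior algebra of the whole
  space by the map induced by the inclusion of \<open>U\<close>, which is injective.\<close>

definition ext_pow :: "nat \<Rightarrow> 'v::complex_vector set \<Rightarrow> 'v ext set" where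
  "ext_pow p U = cvec.span (wedge ` {Xs \<in> lists U. length Xs = p})"

definition ext_alg :: "'v::complex_vector set \<Rightarrow> 'v ext set" where
  "ext_alg U = cvec.span (wedge ` lists U)"

definition free_lift :: "('v list \<Rightarrow> 'w::complex_vector) \<Rightarrow> ('v list \<Rightarrow>\<^sub>0 complex) \<Rightarrow> 'w" where
  "free_lift F f = (\<Sum>Xs\<in>Poly_Mapping.keys f. Poly_Mapping.lookup f Xs *\<^sub>C F Xs)"

text \<open>For \<open>F\<close> multilinear and alternating on lists in \<open>U\<close>, \<open>ext_lift U F\<close> is the linear map on the
  exterior algebra of \<open>U\<close> sending \<open>X\<^sub>1 \<and> \<dots> \<and> X\<^sub>p\<close> to \<open>F [X\<^sub>1, \<dots>, X\<^sub>p]\<close>; the value does not depend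
  on the chosen representative, see \<open>ext_lift_wedge\<close> below.\<close>

definition ext_lift :: "'v::complex_vector set \<Rightarrow> ('v list \<Rightarrow> 'w::complex_vector) \<Rightarrow> 'v ext \<Rightarrow> 'w" where
  "ext_lift U F q =
     free_lift F (SOME f. Poly_Mapping.keys f \<subseteq> lists U \<and> abs_ext f = q)"

definition multilinear_alternating_on ::
    "'v::complex_vector set \<Rightarrow> ('v list \<Rightarrow> 'w::complex_vector) \<Rightarrow> bool" where
  "multilinear_alternating_on U F \<longleftrightarrow>
     (\<forall>Xs\<in>lists U. \<forall>i<length Xs. clinear_on U (\<lambda>a. F (Xs[i := a]))) \<and>
     (\<forall>Xs\<in>lists U. \<forall>i j. i < j \<longrightarrow> j < length Xs \<longrightarrow> Xs ! i = Xs ! j \<longrightarrow> F Xs = 0)"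

lemma free_lift_superset:
  assumes "finite S" "Poly_Mapping.keys f \<subseteq> S"
  shows "free_lift F f = (\<Sum>Xs\<in>S. Poly_Mapping.lookup f Xs *\<^sub>C F Xs)"
  unfolding free_lift_def
  by (rule sum.mono_neutral_left) (use assms in \<open>auto simp: in_keys_iff\<close>)

lemma free_lift_add: "free_lift F (f + g) = free_lift F f + free_lift F g"
proof -
  let ?S = "Poly_Mapping.keys f \<union> Poly_Mapping.keys g"
  have "free_lift F (f + g) = (\<Sum>Xs\<in>?S. Poly_Mapping.lookup (f + g) Xs *\<^sub>C F Xs)"
    by (rule free_lift_superset) (use Poly_Mapping.keys_add[of f g] in auto)
  also have "\<dots> = free_lift F f + free_lift F g"
    by (simp add: free_lift_superset[of ?S] lookup_add cscale_add_left sum.distrib)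
  finally show ?thesis .
qed

lemma free_lift_cscale: "free_lift F (c *\<^sub>C f) = c *\<^sub>C free_lift F f"
proof -
  have "free_lift F (c *\<^sub>C f) = (\<Sum>Xs\<in>Poly_Mapping.keys f. Poly_Mapping.lookup (c *\<^sub>C f) Xs *\<^sub>C F Xs)"
    by (rule free_lift_superset) (auto simp: in_keys_iff cscale_poly_mapping.rep_eq)
  then show ?thesis
    by (simp add: cscale_poly_mapping.rep_eq free_lift_def cvec.scale_sum_right cscale_complex_def
        cscale_cscale)
qed

lemma free_lift_single: "free_lift F (Poly_Mapping.single Xs c) = c *\<^sub>C F Xs"
  by (simp add: free_lift_superset[of "{Xs}"])

lemma free_lift_diff: "free_lift F (f - g) = free_lift F f - free_lift F g"
  using free_lift_add[of F "f - g" g] by simp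

lemma free_lift_null:
  assumes F: "multilinear_alternating_on UNIV F" and f: "f \<in> cvec.span wedge_relators"
  shows "free_lift F f = 0"
  using f
proof (induction rule: cvec.span_induct_alt)
  case base
  show ?case by (simp add: free_lift_def)
next
  case (step c x y)
  have "free_lift F x = 0"
    using step(1) F
    by (auto simp: wedge_relators_def multilinear_alternating_on_def clinear_on_def
        free_lift_diff free_lift_single cscale_one)
  then show ?case
    by (simp add: free_lift_add free_lift_cscale step(2))
qed

lemma ext_alg_rep:
  assumes "q \<in> ext_alg U"
  obtains f where "Poly_Mapping.keys f \<subseteq> lists U" "abs_ext f = q"
proof -
  have "\<exists>f. Poly_Mapping.keys f \<subseteq> lists U \<and> abs_ext f = q"
    using assms unfolding ext_alg_def
  proof (induction rule: cvec.span_induct_alt)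
    case base
    show ?case by (rule exI[of _ 0]) (simp add: zero_ext_def)
  next
    case (step c x y)
    then obtain Xs f where *: "Xs \<in> lists U" "x = wedge Xs" "Poly_Mapping.keys f \<subseteq> lists U" "abs_ext f = y"
      by auto
    show ?case
    proof (rule exI[of _ "c *\<^sub>C Poly_Mapping.single Xs 1 + f"], rule conjI)
      have "Poly_Mapping.keys (c *\<^sub>C Poly_Mapping.single Xs (1::complex)) \<subseteq> {Xs}"
        by (auto simp: in_keys_iff cscale_poly_mapping.rep_eq lookup_single when_def split: if_splits)
      then show "Poly_Mapping.keys (c *\<^sub>C Poly_Mapping.single Xs 1 + f) \<subseteq> lists U"
        using Poly_Mapping.keys_add[of "c *\<^sub>C Poly_Mapping.single Xs (1::complex)" f] * by blast
      show "abs_ext (c *\<^sub>C Poly_Mapping.single Xs 1 + f) = c *\<^sub>C x + y"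
        using * by (auto simp: wedge.abs_eq plus_ext.abs_eq cscale_ext.abs_eq)
    qed
  qed
  then show thesis using that by blast
qed

lemma ext_lift_abs:
  assumes U: "cvec.subspace U" and F: "multilinear_alternating_on U F"
    and f: "Poly_Mapping.keys f \<subseteq> lists U"
  shows "ext_lift U F (abs_ext f) = free_lift F f"
proof -
  define g where "g = (SOME g. Poly_Mapping.keys g \<subseteq> lists U \<and> abs_ext g = abs_ext f)"
  have g: "Poly_Mapping.keys g \<subseteq> lists U" "abs_ext g = abs_ext f"
    using someI[of "\<lambda>g. Poly_Mapping.keys g \<subseteq> lists U \<and> abs_ext g = abs_ext f" f] f
    unfolding g_def by auto
  obtain B where B: "B \<subseteq> U" "cvec.independent B" "U \<subseteq> cvec.span B"
    using cvec.maximal_independent_subset[of U] by auto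
  then have UB: "cvec.span B = U"
    using cvec.span_subspace[OF _ _ U] by blast
  obtain P where P: "Vector_Spaces.linear cscale cscale P" "\<forall>x\<in>B. P x = x" "range P = cvec.span B"
    using cvec.linear_independent_extend_subspace[OF B(2), of "\<lambda>x. x"] by auto
  have PU: "P x \<in> U" for x
    using P(3) UB by auto
  have Pid: "P x = x" if "x \<in> U" for x
  proof -
    have "x \<in> cvec.span B" using that UB by simp
    then show ?thesis
      by (induction rule: cvec.span_induct_alt)
        (use P(1,2) in \<open>simp_all add: cvec.linear_0 cvec.linear_add cvec.linear_scale\<close>)
  qed
  have "multilinear_alternating_on UNIV (\<lambda>Xs. F (map P Xs))"
  proof -
    have "clinear_on UNIV (\<lambda>a. F (map P (Xs[i := a])))" if "i < length Xs" for Xs i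
    proof -
      have "map P Xs \<in> lists U" using PU by auto
      then have "clinear_on U (\<lambda>a. F ((map P Xs)[i := a]))"
        using F that by (auto simp: multilinear_alternating_on_def)
      then show ?thesis
        by (simp add: clinear_on_def map_update PU cvec.linear_add[OF P(1)] cvec.linear_scale[OF P(1)])
    qed
    moreover have "F (map P Xs) = 0" if "i < j" "j < length Xs" "Xs ! i = Xs ! j" for Xs i j
    proof -
      have "map P Xs \<in> lists U" using PU by auto
      moreover have "map P Xs ! i = map P Xs ! j" using that by simp
      ultimately show ?thesis
        using F that by (auto simp: multilinear_alternating_on_def)
    qed
    ultimately show ?thesis
      by (auto simp: multilinear_alternating_on_def)
  qed
  moreover have "g - f \<in> cvec.span wedge_relators"
    using g(2) by (simp add: ext.abs_eq_iff wedge_rel_def)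
  ultimately have "free_lift (\<lambda>Xs. F (map P Xs)) (g - f) = 0"
    by (rule free_lift_null)
  moreover have "free_lift (\<lambda>Xs. F (map P Xs)) h = free_lift F h" if "Poly_Mapping.keys h \<subseteq> lists U" for h
  proof -
    have "map P Xs = Xs" if "Xs \<in> Poly_Mapping.keys h" for Xs
      using that \<open>Poly_Mapping.keys h \<subseteq> lists U\<close> by (intro map_idI Pid) auto
    then show ?thesis
      by (simp add: free_lift_def)
  qed
  ultimately show ?thesis
    using g(1) f by (simp add: ext_lift_def g_def[symmetric] free_lift_diff)
qed

lemma ext_lift_wedge:
  assumes "cvec.subspace U" "multilinear_alternating_on U F" "Xs \<in> lists U"
  shows "ext_lift U F (wedge Xs) = F Xs"
  using ext_lift_abs[OF assms(1,2), of "Poly_Mapping.single Xs 1"] assms(3)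
  by (simp add: wedge.abs_eq free_lift_single cscale_one)

lemma clinear_on_ext_lift:
  assumes "cvec.subspace U" "multilinear_alternating_on U F"
  shows "clinear_on (ext_alg U) (ext_lift U F)"
  unfolding clinear_on_def
proof (intro conjI ballI allI)
  fix x y assume "x \<in> ext_alg U" "y \<in> ext_alg U"
  then obtain f g where f: "Poly_Mapping.keys f \<subseteq> lists U" "abs_ext f = x"
    and g: "Poly_Mapping.keys g \<subseteq> lists U" "abs_ext g = y"
    by (meson ext_alg_rep)
  have "Poly_Mapping.keys (f + g) \<subseteq> lists U"
    using Poly_Mapping.keys_add[of f g] f(1) g(1) by blast
  then have "ext_lift U F (abs_ext (f + g)) = free_lift F (f + g)"
    by (rule ext_lift_abs[OF assms])
  then show "ext_lift U F (x + y) = ext_lift U F x + ext_lift U F y"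
    using ext_lift_abs[OF assms f(1)] ext_lift_abs[OF assms g(1)] f(2) g(2)
    by (simp add: free_lift_add plus_ext.abs_eq[symmetric])
next
  fix c x assume "x \<in> ext_alg U"
  then obtain f where f: "Poly_Mapping.keys f \<subseteq> lists U" "abs_ext f = x"
    by (meson ext_alg_rep)
  have "Poly_Mapping.keys (c *\<^sub>C f) \<subseteq> lists U"
    using f(1) by (auto simp: in_keys_iff cscale_poly_mapping.rep_eq subset_iff)
  then have "ext_lift U F (abs_ext (c *\<^sub>C f)) = free_lift F (c *\<^sub>C f)"
    by (rule ext_lift_abs[OF assms])
  then show "ext_lift U F (c *\<^sub>C x) = c *\<^sub>C ext_lift U F x"
    using ext_lift_abs[OF assms f(1)] f(2)
    by (simp add: free_lift_cscale cscale_ext.abs_eq[symmetric])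
qed


definition ext_derivation :: "'v::complex_vector set \<Rightarrow> ('v \<Rightarrow> 'v) \<Rightarrow> 'v ext \<Rightarrow> 'v ext" where
  "ext_derivation U D = ext_lift U (\<lambda>Xs. \<Sum>i<length Xs. wedge (Xs[i := D (Xs ! i)]))"

text \<open>List positions start at \<open>0\<close>, which does not change the parity of \<open>i + j\<close>. For \<open>p \<le> 1\<close> the
  sum is empty.\<close>

definition ce_boundary :: "'v::complex_vector set \<Rightarrow> ('v \<Rightarrow> 'v \<Rightarrow> 'v) \<Rightarrow> 'v ext \<Rightarrow> 'v ext" where
  "ce_boundary U br = ext_lift U (\<lambda>Xs. \<Sum>(i, j)\<in>{(i, j). i < j \<and> j < length Xs}.
     (-1) ^ (i + j) *\<^sub>C wedge (br (Xs ! i) (Xs ! j) # nths Xs (- {i, j})))"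

text \<open>\<open>h\<close> is linear in its first and conjugate-linear in its second argument; the conjugations
  below turn the dependence on the second argument into a linear one and back.\<close>

definition ext_hermitian ::
    "'v::complex_vector set \<Rightarrow> ('v \<Rightarrow> 'v \<Rightarrow> complex) \<Rightarrow> 'v ext \<Rightarrow> 'v ext \<Rightarrow> complex" where
  "ext_hermitian U h x y =
     ext_lift U (\<lambda>Xs. cnj (ext_lift U (\<lambda>Ys. cnj
       (if length Xs = length Ys
        then Determinant.det (Matrix.mat (length Xs) (length Xs) (\<lambda>(i, j). h (Xs ! i) (Ys ! j)))
        else 0)) y)) x"


section \<open>Finite-dimensional complex Lie algebras\<close>

class complex_lie_algebra = complex_vector +
  fixes lie :: "'a \<Rightarrow> 'a \<Rightarrow> 'a"
  assumes lie_add_left: "lie (x + y) z = lie x z + lie y z"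
    and lie_add_right: "lie x (y + z) = lie x y + lie x z"
    and lie_cscale_left: "lie (c *\<^sub>C x) y = c *\<^sub>C lie x y"
    and lie_cscale_right: "lie x (c *\<^sub>C y) = c *\<^sub>C lie x y"
    and lie_self: "lie x x = 0"
    and lie_jacobi: "lie x (lie y z) + lie y (lie z x) + lie z (lie x y) = 0"
    and finite_dimensional: "\<exists>B. finite B \<and> (\<forall>x. \<exists>a. x = (\<Sum>b\<in>B. a b *\<^sub>C b))"

definition lie_subalgebra :: "'g::complex_lie_algebra set \<Rightarrow> bool" where
  "lie_subalgebra S \<longleftrightarrow> cvec.subspace S \<and> (\<forall>x\<in>S. \<forall>y\<in>S. lie x y \<in> S)"

definition lie_ideal :: "'g::complex_lie_algebra set \<Rightarrow> bool" where
  "lie_ideal I \<longleftrightarrow> cvec.subspace I \<and> (\<forall>x. \<forall>y\<in>I. lie x y \<in> I)"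

definition lie_set :: "'g::complex_lie_algebra set \<Rightarrow> 'g set \<Rightarrow> 'g set" where
  "lie_set A B = cvec.span {lie x y | x y. x \<in> A \<and> y \<in> B}"

definition lie_solvable :: "'g::complex_lie_algebra set \<Rightarrow> bool" where
  "lie_solvable S \<longleftrightarrow> (\<exists>n. ((\<lambda>A. lie_set A A) ^^ n) S = {0})"

definition lie_nilpotent :: "'g::complex_lie_algebra set \<Rightarrow> bool" where
  "lie_nilpotent S \<longleftrightarrow> (\<exists>n. ((\<lambda>A. lie_set S A) ^^ n) S = {0})"

definition semisimple :: "'g::complex_lie_algebra itself \<Rightarrow> bool" where
  "semisimple _ \<longleftrightarrow> (\<forall>I :: 'g set. lie_ideal I \<and> lie_solvable I \<longrightarrow> I = {0})"

definition killing :: "'g::complex_lie_algebra \<Rightarrow> 'g \<Rightarrow> complex" where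
  "killing x y = ctrace (\<lambda>z. lie x (lie y z))"

definition borel_subalgebra :: "'g::complex_lie_algebra set \<Rightarrow> 'g set \<Rightarrow> bool" where
  "borel_subalgebra K B \<longleftrightarrow>
     lie_subalgebra B \<and> lie_solvable B \<and> B \<subseteq> K \<and>
     (\<forall>B'. lie_subalgebra B' \<and> lie_solvable B' \<and> B \<subseteq> B' \<and> B' \<subseteq> K \<longrightarrow> B' = B)"

definition cartan_subalgebra :: "'g::complex_lie_algebra set \<Rightarrow> 'g set \<Rightarrow> bool" where
  "cartan_subalgebra K H \<longleftrightarrow>
     lie_subalgebra H \<and> lie_nilpotent H \<and> H \<subseteq> K \<and> {x \<in> K. \<forall>h\<in>H. lie x h \<in> H} = H"

definition involutive_automorphism :: "('g::complex_lie_algebra \<Rightarrow> 'g) \<Rightarrow> bool" where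
  "involutive_automorphism \<sigma> \<longleftrightarrow>
     clinear_on UNIV \<sigma> \<and> (\<forall>x y. \<sigma> (lie x y) = lie (\<sigma> x) (\<sigma> y)) \<and> (\<forall>x. \<sigma> (\<sigma> x) = x)"

definition fix_part :: "('g::complex_lie_algebra \<Rightarrow> 'g) \<Rightarrow> 'g set" where
  "fix_part \<sigma> = {x. \<sigma> x = x}"

definition anti_part :: "('g::complex_lie_algebra \<Rightarrow> 'g) \<Rightarrow> 'g set" where
  "anti_part \<sigma> = {x. \<sigma> x = - x}"

definition dual_bases :: "'g::complex_lie_algebra set \<Rightarrow> 'i set \<Rightarrow> ('i \<Rightarrow> 'g) \<Rightarrow> ('i \<Rightarrow> 'g) \<Rightarrow> bool" where
  "dual_bases K I b b' \<longleftrightarrow>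
     finite I \<and>
     inj_on b I \<and> cvec.independent (b ` I) \<and> cvec.span (b ` I) = K \<and>
     inj_on b' I \<and> cvec.independent (b' ` I) \<and> cvec.span (b' ` I) = K \<and>
     (\<forall>i\<in>I. \<forall>j\<in>I. killing (b i) (b' j) = (if i = j then 1 else 0))"


section \<open>The affine algebra\<close>

text \<open>The element \<open>(x, a, b)\<close> stands for \<open>(\<Sum>\<^sub>r t\<^sup>r \<otimes> x\<^sub>r) + a c + b d\<close>. The type allows all real
  exponents \<open>r\<close>; the affine algebra proper is the set \<open>affine_alg \<sigma>\<close>.\<close>

type_synonym 'g affine = "(real \<Rightarrow>\<^sub>0 'g) \<times> complex \<times> complex"

definition t_pow :: "real \<Rightarrow> 'g::complex_lie_algebra \<Rightarrow> 'g affine" where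
  "t_pow r x = (Poly_Mapping.single r x, 0, 0)"

definition c_el :: "'g::complex_lie_algebra affine" where
  "c_el = (0, 1, 0)"

definition d_el :: "'g::complex_lie_algebra affine" where
  "d_el = (0, 0, 1)"

definition loop_bracket :: "(real \<Rightarrow>\<^sub>0 'g::complex_lie_algebra) \<Rightarrow> (real \<Rightarrow>\<^sub>0 'g) \<Rightarrow> (real \<Rightarrow>\<^sub>0 'g)" where
  "loop_bracket x y = (\<Sum>r\<in>Poly_Mapping.keys x. \<Sum>s\<in>Poly_Mapping.keys y.
     Poly_Mapping.single (r + s) (lie (Poly_Mapping.lookup x r) (Poly_Mapping.lookup y s)))"

definition loop_degree :: "(real \<Rightarrow>\<^sub>0 'g::complex_lie_algebra) \<Rightarrow> (real \<Rightarrow>\<^sub>0 'g)" where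
  "loop_degree x = (\<Sum>r\<in>Poly_Mapping.keys x.
     Poly_Mapping.single r (complex_of_real r *\<^sub>C Poly_Mapping.lookup x r))"

fun aff_bracket :: "'g::complex_lie_algebra affine \<Rightarrow> 'g affine \<Rightarrow> 'g affine" where
  "aff_bracket (x, a, b) (y, a', b') =
     (loop_bracket x y + b *\<^sub>C loop_degree y - b' *\<^sub>C loop_degree x,
      \<Sum>r\<in>Poly_Mapping.keys x.
        complex_of_real r * killing (Poly_Mapping.lookup x r) (Poly_Mapping.lookup y (- r)),
      0)"

fun aff_form :: "'g::complex_lie_algebra affine \<Rightarrow> 'g affine \<Rightarrow> complex" where
  "aff_form (x, a, b) (y, a', b') =
     (\<Sum>r\<in>Poly_Mapping.keys x. killing (Poly_Mapping.lookup x r) (Poly_Mapping.lookup y (- r)))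
     + a * b' + b * a'"

lemma lie_zero_left [simp]: "lie 0 y = (0::'g::complex_lie_algebra)"
  using lie_add_left[of 0 0 y] by simp

lemma lie_zero_right [simp]: "lie x 0 = (0::'g::complex_lie_algebra)"
  using lie_add_right[of x 0 0] by simp

lemma killing_zero_left [simp]: "killing 0 y = 0"
  by (simp add: killing_def ctrace_def cvec.representation_zero)

lemma killing_zero_right [simp]: "killing x 0 = 0"
  by (simp add: killing_def ctrace_def cvec.representation_zero)

lemma aff_bracket_t_pow:
  "aff_bracket (t_pow r x) (t_pow s y) =
     t_pow (r + s) (lie x y) + (if r = - s then complex_of_real r * killing x y else 0) *\<^sub>C c_el"
  by (auto simp: t_pow_def c_el_def loop_bracket_def cscale_prod_def cscale_complex_def lookup_single
      when_def cvec.scale_zero_left)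

lemma aff_bracket_d_t_pow: "aff_bracket d_el (t_pow r x) = complex_of_real r *\<^sub>C t_pow r x"
  by (auto simp: t_pow_def d_el_def loop_bracket_def loop_degree_def cscale_prod_def cscale_one
      cscale_complex_def cscale_poly_mapping.rep_eq lookup_single when_def intro!: poly_mapping_eqI)

lemma aff_bracket_c: "aff_bracket c_el y = 0"
  by (cases y rule: prod_cases3) (simp add: c_el_def loop_bracket_def loop_degree_def zero_prod_def)

lemma aff_form_t_pow:
  "aff_form (t_pow r x) (t_pow s y) = (if r = - s then killing x y else 0)"
  by (auto simp: t_pow_def lookup_single when_def)

definition loop_alg :: "('g::complex_lie_algebra \<Rightarrow> 'g) \<Rightarrow> (real \<Rightarrow>\<^sub>0 'g) set" where
  "loop_alg \<sigma> = {x. \<forall>r. if r \<in> \<int> then Poly_Mapping.lookup x r \<in> fix_part \<sigma>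
                        else if r - 1/2 \<in> \<int> then Poly_Mapping.lookup x r \<in> anti_part \<sigma>
                        else Poly_Mapping.lookup x r = 0}"

definition affine_alg :: "('g::complex_lie_algebra \<Rightarrow> 'g) \<Rightarrow> 'g affine set" where
  "affine_alg \<sigma> = {(x, a, b) | x a b. x \<in> loop_alg \<sigma>}"

definition u_minus :: "('g::complex_lie_algebra \<Rightarrow> 'g) \<Rightarrow> 'g affine set" where
  "u_minus \<sigma> = {(x, 0, 0) | x. x \<in> loop_alg \<sigma> \<and> (\<forall>r\<ge>0. Poly_Mapping.lookup x r = 0)}"


section \<open>Roots and Chevalley generators\<close>

definition h_hat :: "'g::complex_lie_algebra set \<Rightarrow> 'g affine set" where
  "h_hat h0 = {t_pow 0 h + a *\<^sub>C c_el + b *\<^sub>C d_el | h a b. h \<in> h0}"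

definition restrict_h0 :: "'g::complex_lie_algebra set \<Rightarrow> ('g affine \<Rightarrow> complex) \<Rightarrow> ('g \<Rightarrow> complex)" where
  "restrict_h0 h0 \<alpha> = (\<lambda>h. if h \<in> h0 then \<alpha> (t_pow 0 h) else 0)"

definition fin_root_space ::
    "('g::complex_lie_algebra \<Rightarrow> 'g) \<Rightarrow> 'g set \<Rightarrow> ('g \<Rightarrow> complex) \<Rightarrow> 'g set" where
  "fin_root_space \<sigma> h0 \<alpha> = {x \<in> fix_part \<sigma>. \<forall>h\<in>h0. lie h x = \<alpha> h *\<^sub>C x}"

definition fin_pos_roots ::
    "('g::complex_lie_algebra \<Rightarrow> 'g) \<Rightarrow> 'g set \<Rightarrow> 'g set \<Rightarrow> ('g \<Rightarrow> complex) set" where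
  "fin_pos_roots \<sigma> b0 h0 = {\<alpha> \<in> dual_space h0. \<alpha> \<noteq> (\<lambda>_. 0) \<and>
     fin_root_space \<sigma> h0 \<alpha> \<noteq> {0} \<and> fin_root_space \<sigma> h0 \<alpha> \<subseteq> b0}"

definition root_space ::
    "('g::complex_lie_algebra \<Rightarrow> 'g) \<Rightarrow> 'g set \<Rightarrow> ('g affine \<Rightarrow> complex) \<Rightarrow> 'g affine set" where
  "root_space \<sigma> h0 \<alpha> = {x \<in> affine_alg \<sigma>. \<forall>h\<in>h_hat h0. aff_bracket h x = \<alpha> h *\<^sub>C x}"

definition aff_roots ::
    "('g::complex_lie_algebra \<Rightarrow> 'g) \<Rightarrow> 'g set \<Rightarrow> ('g affine \<Rightarrow> complex) set" where
  "aff_roots \<sigma> h0 = {\<alpha> \<in> dual_space (h_hat h0). \<alpha> \<noteq> (\<lambda>_. 0) \<and> root_space \<sigma> h0 \<alpha> \<noteq> {0}}"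

text \<open>The roots of the finite-dimensional part are extended to \<open>h_hat h0\<close> by zero on \<open>c\<close> and \<open>d\<close>.\<close>

definition aff_pos_roots ::
    "('g::complex_lie_algebra \<Rightarrow> 'g) \<Rightarrow> 'g set \<Rightarrow> 'g set \<Rightarrow> ('g affine \<Rightarrow> complex) set" where
  "aff_pos_roots \<sigma> b0 h0 =
     {\<alpha> \<in> dual_space (h_hat h0). \<alpha> c_el = 0 \<and> \<alpha> d_el = 0 \<and> restrict_h0 h0 \<alpha> \<in> fin_pos_roots \<sigma> b0 h0}
     \<union> {\<alpha> \<in> aff_roots \<sigma> h0. \<exists>r>0. \<alpha> d_el = complex_of_real r}"

definition simple_roots ::
    "('g::complex_lie_algebra \<Rightarrow> 'g) \<Rightarrow> 'g set \<Rightarrow> 'g set \<Rightarrow> ('g affine \<Rightarrow> complex) set" where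
  "simple_roots \<sigma> b0 h0 = {\<alpha> \<in> aff_pos_roots \<sigma> b0 h0.
     \<not> (\<exists>\<beta>\<in>aff_pos_roots \<sigma> b0 h0. \<exists>\<gamma>\<in>aff_pos_roots \<sigma> b0 h0. \<alpha> = (\<lambda>h. \<beta> h + \<gamma> h))}"

text \<open>In \<open>\<alpha> = s \<delta> + restrict_h0 h0 \<alpha>\<close> one has \<open>s = \<alpha>(d)\<close>, a real number for every root \<open>\<alpha>\<close>.\<close>

definition delta_coeff :: "('g::complex_lie_algebra affine \<Rightarrow> complex) \<Rightarrow> real" where
  "delta_coeff \<alpha> = Re (\<alpha> d_el)"

definition h_dual :: "'g::complex_lie_algebra set \<Rightarrow> ('g \<Rightarrow> complex) \<Rightarrow> 'g" where
  "h_dual h0 \<mu> = (THE x. x \<in> h0 \<and> (\<forall>h\<in>h0. \<mu> h = killing x h))"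

definition dual_form ::
    "'g::complex_lie_algebra set \<Rightarrow> ('g \<Rightarrow> complex) \<Rightarrow> ('g \<Rightarrow> complex) \<Rightarrow> complex" where
  "dual_form h0 \<mu> \<eta> = killing (h_dual h0 \<mu>) (h_dual h0 \<eta>)"

definition two_over_norm :: "'g::complex_lie_algebra set \<Rightarrow> ('g affine \<Rightarrow> complex) \<Rightarrow> complex" where
  "two_over_norm h0 \<alpha> = 2 / dual_form h0 (restrict_h0 h0 \<alpha>) (restrict_h0 h0 \<alpha>)"

definition coroot :: "'g::complex_lie_algebra set \<Rightarrow> ('g affine \<Rightarrow> complex) \<Rightarrow> 'g affine" where
  "coroot h0 \<alpha> =
     (two_over_norm h0 \<alpha> * complex_of_real (delta_coeff \<alpha>)) *\<^sub>C c_el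
     + t_pow 0 (two_over_norm h0 \<alpha> *\<^sub>C h_dual h0 (restrict_h0 h0 \<alpha>))"

text \<open>The families \<open>X\<close> and \<open>Y\<close> are indexed by the simple roots themselves.\<close>

definition chev_e :: "(('g::complex_lie_algebra affine \<Rightarrow> complex) \<Rightarrow> 'g) \<Rightarrow> ('g affine \<Rightarrow> complex) \<Rightarrow> 'g affine" where
  "chev_e X \<alpha> = t_pow (delta_coeff \<alpha>) (X \<alpha>)"

definition chev_f :: "(('g::complex_lie_algebra affine \<Rightarrow> complex) \<Rightarrow> 'g) \<Rightarrow> ('g affine \<Rightarrow> complex) \<Rightarrow> 'g affine" where
  "chev_f Y \<alpha> = t_pow (- delta_coeff \<alpha>) (Y \<alpha>)"

definition chevalley_generators ::
    "('g::complex_lie_algebra \<Rightarrow> 'g) \<Rightarrow> 'g set \<Rightarrow> 'g set \<Rightarrow>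
     (('g affine \<Rightarrow> complex) \<Rightarrow> 'g) \<Rightarrow> (('g affine \<Rightarrow> complex) \<Rightarrow> 'g) \<Rightarrow> bool" where
  "chevalley_generators \<sigma> b0 h0 X Y \<longleftrightarrow>
     (\<forall>\<alpha>\<in>simple_roots \<sigma> b0 h0.
        chev_e X \<alpha> \<in> root_space \<sigma> h0 \<alpha> \<and>
        chev_f Y \<alpha> \<in> root_space \<sigma> h0 (\<lambda>h. - \<alpha> h) \<and>
        (\<forall>\<beta>\<in>simple_roots \<sigma> b0 h0.
           killing (X \<alpha>) (Y \<beta>) = (if \<alpha> = \<beta> then two_over_norm h0 \<alpha> else 0)))"


section \<open>The Hermitian form\<close>

inductive_set real_lie_gen :: "'g::complex_lie_algebra affine set \<Rightarrow> 'g affine set" for G where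
  base: "x \<in> G \<Longrightarrow> x \<in> real_lie_gen G"
| zero: "0 \<in> real_lie_gen G"
| add: "x \<in> real_lie_gen G \<Longrightarrow> y \<in> real_lie_gen G \<Longrightarrow> x + y \<in> real_lie_gen G"
| scale: "x \<in> real_lie_gen G \<Longrightarrow> complex_of_real r *\<^sub>C x \<in> real_lie_gen G"
| bracket: "x \<in> real_lie_gen G \<Longrightarrow> y \<in> real_lie_gen G \<Longrightarrow> aff_bracket x y \<in> real_lie_gen G"

definition h_real ::
    "('g::complex_lie_algebra \<Rightarrow> 'g) \<Rightarrow> 'g set \<Rightarrow> 'g set \<Rightarrow> 'g affine set" where
  "h_real \<sigma> b0 h0 =
     {\<Sum>\<alpha>\<in>S. complex_of_real (a \<alpha>) *\<^sub>C coroot h0 \<alpha> | S a. finite S \<and> S \<subseteq> simple_roots \<sigma> b0 h0}"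

definition affine_real ::
    "('g::complex_lie_algebra \<Rightarrow> 'g) \<Rightarrow> 'g set \<Rightarrow> 'g set \<Rightarrow>
     (('g affine \<Rightarrow> complex) \<Rightarrow> 'g) \<Rightarrow> (('g affine \<Rightarrow> complex) \<Rightarrow> 'g) \<Rightarrow> 'g affine set" where
  "affine_real \<sigma> b0 h0 X Y = real_lie_gen
     ({x + complex_of_real r *\<^sub>C d_el | x r. x \<in> h_real \<sigma> b0 h0}
      \<union> chev_e X ` simple_roots \<sigma> b0 h0 \<union> chev_f Y ` simple_roots \<sigma> b0 h0)"

definition is_conjugation ::
    "'v::complex_vector set \<Rightarrow> 'v set \<Rightarrow> ('v \<Rightarrow> 'v) \<Rightarrow> bool" where
  "is_conjugation V R \<kappa> \<longleftrightarrow>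
     antilinear_on V \<kappa> \<and> (\<forall>x\<in>V. \<kappa> x \<in> V \<and> \<kappa> (\<kappa> x) = x) \<and> {x \<in> V. \<kappa> x = x} = R"

definition antilinear_antiautomorphism ::
    "('g::complex_lie_algebra \<Rightarrow> 'g) \<Rightarrow> ('g affine \<Rightarrow> 'g affine) \<Rightarrow> bool" where
  "antilinear_antiautomorphism \<sigma> \<tau> \<longleftrightarrow>
     bij_betw \<tau> (affine_alg \<sigma>) (affine_alg \<sigma>) \<and> antilinear_on (affine_alg \<sigma>) \<tau> \<and>
     (\<forall>x\<in>affine_alg \<sigma>. \<forall>y\<in>affine_alg \<sigma>. \<tau> (aff_bracket x y) = aff_bracket (\<tau> y) (\<tau> x))"

definition herm ::
    "('g::complex_lie_algebra \<Rightarrow> 'g) \<Rightarrow> ('g affine \<Rightarrow> 'g affine) \<Rightarrow>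
     'g affine ext \<Rightarrow> 'g affine ext \<Rightarrow> complex" where
  "herm \<sigma> \<sigma>o = ext_hermitian (u_minus \<sigma>) (\<lambda>x y. aff_form x (\<sigma>o y))"


section \<open>The Laplacian\<close>

definition bdry :: "('g::complex_lie_algebra \<Rightarrow> 'g) \<Rightarrow> 'g affine ext \<Rightarrow> 'g affine ext" where
  "bdry \<sigma> = ce_boundary (u_minus \<sigma>) aff_bracket"

text \<open>\<open>bdry_adj \<sigma> \<sigma>o p\<close> is the adjoint of the boundary operator from degree \<open>p\<close> to degree \<open>p - 1\<close>.
  For \<open>p = 0\<close> that operator is zero, and so is its adjoint, which is only applied to \<open>0\<close>.\<close>

definition bdry_adj ::
    "('g::complex_lie_algebra \<Rightarrow> 'g) \<Rightarrow> ('g affine \<Rightarrow> 'g affine) \<Rightarrow> nat \<Rightarrow>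
     'g affine ext \<Rightarrow> 'g affine ext" where
  "bdry_adj \<sigma> \<sigma>o p y = (THE z. z \<in> ext_pow p (u_minus \<sigma>) \<and>
     (\<forall>x\<in>ext_pow p (u_minus \<sigma>). herm \<sigma> \<sigma>o (bdry \<sigma> x) y = herm \<sigma> \<sigma>o x z))"

definition laplacian ::
    "('g::complex_lie_algebra \<Rightarrow> 'g) \<Rightarrow> ('g affine \<Rightarrow> 'g affine) \<Rightarrow> nat \<Rightarrow>
     'g affine ext \<Rightarrow> 'g affine ext" where
  "laplacian \<sigma> \<sigma>o p x =
     bdry \<sigma> (bdry_adj \<sigma> \<sigma>o (p + 1) x) + bdry_adj \<sigma> \<sigma>o p (bdry \<sigma> x)"

definition act ::
    "('g::complex_lie_algebra \<Rightarrow> 'g) \<Rightarrow> 'g affine \<Rightarrow> 'g affine ext \<Rightarrow> 'g affine ext" where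
  "act \<sigma> y = ext_derivation (u_minus \<sigma>) (aff_bracket y)"

definition casimir ::
    "('g::complex_lie_algebra \<Rightarrow> 'g) \<Rightarrow> 'i set \<Rightarrow> ('i \<Rightarrow> 'g) \<Rightarrow> ('i \<Rightarrow> 'g) \<Rightarrow>
     'g affine ext \<Rightarrow> 'g affine ext" where
  "casimir \<sigma> I b b' x = (\<Sum>i\<in>I. act \<sigma> (t_pow 0 (b i)) (act \<sigma> (t_pow 0 (b' i)) x))"

end

theory Submission
  imports Defs
begin

text \<open>
  Write \<open>u\<close>, \<open>u'\<close> for bases of the negative and the positive part of the loop algebra that are dual with
  respect to the bilinear form, \<open>\<theta>\<close> for the extension of an endomorphism to a derivation of the exterior
  algebra, \<open>\<partial>\<close> for the boundary operator, and an index minus for the projection to negative degrees.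

  The boundary operator satisfies \<open>\<partial>(x \<and> q) = - x \<and> \<partial> q - \<theta>(ad x) q\<close>. Its adjoint is the antiderivation
  \<open>\<partial>\<^sup>*\<close> whose value on a vector \<open>y\<close> is \<open>- 1/2 * (\<Sum>i. u i \<and> [u' i, y]\<^sub>-)\<close> (\<open>dstar_adjoint\<close>). Indeed, the
  adjoint of multiplication by \<open>x = \<sigma>\<^sub>o(v)\<close> is contraction with \<open>v\<close>, the adjoint of \<open>\<theta>(ad x)\<close> is the
  derivation extending \<open>y \<mapsto> [v, y]\<^sub>-\<close>, and the anticommutator of \<open>\<partial>\<^sup>*\<close> with the contraction is the
  negative of that derivation (\<open>dstar_contraction\<close>). This uses that \<open>\<sigma>\<^sub>o\<close> carries the bilinear form to its
  complex conjugate (\<open>killing_rho\<close>), which holds because \<open>\<sigma>\<^sub>o\<close> is an antiautomorphism fixing \<open>d\<close> and the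
  Killing form is a trace of iterated brackets. The adjoint is unique because
  \<open>\<Sum>i. u i \<and> \<iota>(u' i)\<close> multiplies by the degree, so that an element all of whose contractions vanish is zero in
  positive degree (\<open>E_nondegenerate\<close>).

  The Laplacian \<open>L\<close> is then compared with the right-hand side by induction on the degree
  (\<open>laplacian_eq_casimir\<close>). One has

  \<open>L(x \<and> q) - x \<and> L q = [\<partial>, \<partial>\<^sup>*x] q - [\<partial>\<^sup>*, \<theta>(ad x)] q\<close>,

  where \<open>\<partial>\<^sup>*x\<close> stands for multiplication by that element. The second commutator is an antiderivation, so it
  is determined by its values on vectors, and these follow from the invariance of the canonical element
  \<open>\<Sum>i. u i \<otimes> u' i\<close> under brackets (\<open>quadratic_identity\<close>). The two commutators share their second-order
  terms over the negative part, and what is left is \<open>1/2 * (\<Sum>i. [u i, [u' i, x]\<^sub>-]) \<and> q\<close> together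
  with the cross terms of \<open>- 1/2 * \<Omega>\<close>, where \<open>\<Omega>\<close> is the Casimir operator of the fixed part \<open>k\<close> of \<open>\<sigma>\<close>.

  It remains to see that \<open>\<Sum>i. [u i, [u' i, x]\<^sub>-] = - (d + \<Omega>) x\<close> for a vector \<open>x\<close> (\<open>casimir_degree_one\<close>). In
  degree \<open>- m / 2\<close> this says that \<open>\<Omega>\<^sub>0 + \<dots> + \<Omega>\<^sub>m\<^sub>-\<^sub>1\<close> acts as \<open>m / 2\<close>, where \<open>\<Omega>\<^sub>l\<close> is \<open>\<Omega>\<close> for even \<open>l\<close> and the analogous
  sum over the anti-fixed part \<open>p\<close> for odd \<open>l\<close>. This is where the Killing form is special: the two operators add
  up to the identity (\<open>casimir_part_sum\<close>), and \<open>\<Omega>\<close> is \<open>1/2\<close> on \<open>p\<close> (\<open>casimir_part_on_p\<close>).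
\<close>

section \<open>Recursion on the exterior algebra\<close>

abbreviation clinear :: "('a::complex_vector \<Rightarrow> 'b::complex_vector) \<Rightarrow> bool" where
  "clinear f \<equiv> Vector_Spaces.linear cscale cscale f"

lemma clinearI:
  assumes "\<And>x y. f (x + y) = f x + f y" "\<And>c x. f (c *\<^sub>C x) = c *\<^sub>C f x"
  shows "clinear f"
  using assms by unfold_locales auto

lemma clinear_iff_clinear_on: "clinear f \<longleftrightarrow> clinear_on UNIV f"
  by (auto simp: clinear_on_def intro: clinearI cvec.linear_add cvec.linear_scale)

lemmas clinear_simps = cvec.linear_add cvec.linear_scale cvec.linear_sum cvec.linear_neg
  cvec.linear_diff cvec.linear_0

lemmas subspace_simps = cvec.subspace_add cvec.subspace_scale cvec.subspace_sum cvec.subspace_neg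
  cvec.subspace_diff cvec.subspace_0

lemma wedge_update_add:
  "i < length Xs \<Longrightarrow> wedge (Xs[i := a + b]) = wedge (Xs[i := a]) + wedge (Xs[i := b])"
proof -
  assume "i < length Xs"
  then have "Poly_Mapping.single (Xs[i := a + b]) (1::complex)
        - Poly_Mapping.single (Xs[i := a]) 1 - Poly_Mapping.single (Xs[i := b]) 1 \<in> wedge_relators"
    unfolding wedge_relators_def by blast
  then show ?thesis
    by (simp add: wedge.abs_eq plus_ext.abs_eq ext.abs_eq_iff wedge_rel_def diff_diff_eq[symmetric] cvec.span_base)
qed

lemma wedge_update_scale:
  "i < length Xs \<Longrightarrow> wedge (Xs[i := c *\<^sub>C a]) = c *\<^sub>C wedge (Xs[i := a])"
proof -
  assume "i < length Xs"
  then have "Poly_Mapping.single (Xs[i := c *\<^sub>C a]) (1::complex) - Poly_Mapping.single (Xs[i := a]) c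
    \<in> wedge_relators"
    unfolding wedge_relators_def by blast
  moreover have "Poly_Mapping.single (Xs[i := a]) c = c *\<^sub>C Poly_Mapping.single (Xs[i := a]) (1::complex)"
    by (rule poly_mapping_eqI) (simp add: cscale_poly_mapping.rep_eq cscale_complex_def lookup_single when_def)
  ultimately show ?thesis
    by (simp add: wedge.abs_eq cscale_ext.abs_eq ext.abs_eq_iff wedge_rel_def cvec.span_base)
qed

lemma wedge_repeated: "i < j \<Longrightarrow> j < length Xs \<Longrightarrow> Xs ! i = Xs ! j \<Longrightarrow> wedge Xs = 0"
proof -
  assume "i < j" "j < length Xs" "Xs ! i = Xs ! j"
  then have "Poly_Mapping.single Xs (1::complex) \<in> wedge_relators"
    unfolding wedge_relators_def by blast
  then show ?thesis
    by (simp add: wedge.abs_eq zero_ext_def ext.abs_eq_iff wedge_rel_def cvec.span_base)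
qed

text \<open>A map on lists of vectors given by a linear operator applied to \<open>wedge\<close> inherits multilinearity
  and alternation from \<open>wedge\<close>. This turns every explicit formula on decomposable elements that is
  known to come from some linear operator into a well-defined \<open>ext_lift\<close>.\<close>

lemma multilinear_alternating_on_linear_wedge:
  assumes T: "clinear T" and F: "\<And>Xs. Xs \<in> lists U \<Longrightarrow> F Xs = T (wedge Xs)" and U: "cvec.subspace U"
  shows "multilinear_alternating_on U F"
proof -
  have upd: "Xs[i := a] \<in> lists U" if "Xs \<in> lists U" "a \<in> U" for Xs i a
    using that set_update_subset_insert[of Xs i a] by auto
  show ?thesis
    unfolding multilinear_alternating_on_def clinear_on_def
    by (auto simp: F upd subspace_simps[OF U] wedge_update_add
        wedge_update_scale wedge_repeated clinear_simps[OF T] simp del: in_lists_conv_set)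
qed

lemma ext_alg_UNIV [simp]: "ext_alg UNIV = UNIV"
proof -
  have "abs_ext f \<in> ext_alg UNIV" for f :: "'a list \<Rightarrow>\<^sub>0 complex"
  proof (induction f rule: update_induct)
    case const
    then show ?case by (simp add: zero_ext.abs_eq[symmetric] ext_alg_def cvec.span_zero)
  next
    case (update f a b)
    have "Poly_Mapping.lookup f a = 0" using update(1) by (simp add: in_keys_iff)
    then have "Poly_Mapping.update a b f = f + b *\<^sub>C Poly_Mapping.single a 1"
      by (intro poly_mapping_eqI)
        (auto simp add: lookup_update lookup_add cscale_poly_mapping.rep_eq cscale_complex_def
          lookup_single when_def in_keys_iff)
    then show ?case
      using update(3) by (simp add: plus_ext.abs_eq[symmetric] cscale_ext.abs_eq[symmetric]
          wedge.abs_eq[symmetric] ext_alg_def cvec.span_add cvec.span_scale cvec.span_base)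
  qed
  then show ?thesis by (metis UNIV_eq_I Quotient3_ext Quotient3_abs_rep)
qed

lemma ext_lift_linear_wedge:
  assumes T: "clinear T" and F: "\<And>Xs. Xs \<in> lists U \<Longrightarrow> F Xs = T (wedge Xs)" and U: "cvec.subspace U"
    and q: "q \<in> ext_alg U"
  shows "ext_lift U F q = T q"
proof -
  have M: "multilinear_alternating_on U F"
    by (rule multilinear_alternating_on_linear_wedge[OF T F U])
  note L = clinear_on_ext_lift[OF U M]
  have z: "0 \<in> ext_alg U" by (simp add: ext_alg_def cvec.span_zero)
  have "q \<in> ext_alg U \<and> ext_lift U F q = T q"
    using q unfolding ext_alg_def
  proof (induction rule: cvec.span_induct_alt)
    case base
    have "ext_lift U F (0 *\<^sub>C 0) = 0 *\<^sub>C ext_lift U F 0"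
      using L z unfolding clinear_on_def by blast
    then show ?case by (simp add: cvec.linear_0[OF T] cvec.span_zero)
  next
    case (step c x y)
    then have x: "x \<in> ext_alg U" "y \<in> ext_alg U" "c *\<^sub>C x \<in> ext_alg U" by (auto simp: ext_alg_def intro!: cvec.span_base cvec.span_scale)
    have "ext_lift U F (c *\<^sub>C x + y) = c *\<^sub>C ext_lift U F x + ext_lift U F y"
      using L x unfolding clinear_on_def by metis
    moreover have "ext_lift U F x = T x"
      using step(1) ext_lift_wedge[OF U M] F by (auto simp del: in_lists_conv_set)
    ultimately show ?case using step(2) x
      by (auto simp: clinear_simps[OF T]
          ext_alg_def cvec.span_add simp del: in_lists_conv_set)
  qed
  then show ?thesis by simp
qed

text \<open>Left multiplication by a vector. The product of the exterior algebra enters only through these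
  operators, and every later computation is a computation with them.\<close>

definition ext_mult :: "'v::complex_vector \<Rightarrow> 'v ext \<Rightarrow> 'v ext" where
  "ext_mult x = ext_lift UNIV (\<lambda>Xs. wedge (x # Xs))"

lemma multilinear_alternating_on_wedge_Cons:
  "multilinear_alternating_on UNIV (\<lambda>Xs. wedge (x # Xs))"
  unfolding multilinear_alternating_on_def clinear_on_def
proof (intro conjI ballI allI impI)
  fix Xs :: "'a list" and i a b c
  assume i: "i < length Xs"
  show "wedge (x # Xs[i := a + b]) = wedge (x # Xs[i := a]) + wedge (x # Xs[i := b])"
    using wedge_update_add[of "Suc i" "x # Xs" a b] i by simp
  show "wedge (x # Xs[i := c *\<^sub>C a]) = c *\<^sub>C wedge (x # Xs[i := a])"
    using wedge_update_scale[of "Suc i" "x # Xs" c a] i by simp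
next
  fix Xs :: "'a list" and i j
  assume "i < j" "j < length Xs" "Xs ! i = Xs ! j"
  then show "wedge (x # Xs) = 0"
    by (intro wedge_repeated[of "Suc i" "Suc j"]) auto
qed

lemma ext_mult_wedge [simp]: "ext_mult x (wedge Xs) = wedge (x # Xs)"
  by (simp add: ext_mult_def ext_lift_wedge[OF cvec.subspace_UNIV multilinear_alternating_on_wedge_Cons])

lemma clinear_ext_mult: "clinear (ext_mult x)"
  using clinear_on_ext_lift[OF cvec.subspace_UNIV multilinear_alternating_on_wedge_Cons]
  by (simp add: clinear_iff_clinear_on ext_mult_def)

lemmas ext_mult_linear [simp] =
  clinear_simps[OF clinear_ext_mult]

lemma ext_alg_induct [consumes 1, case_names one mult add scale]:
  assumes q: "q \<in> ext_alg U"
    and one: "P (wedge [])"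
    and mult: "\<And>x q. x \<in> U \<Longrightarrow> q \<in> ext_alg U \<Longrightarrow> P q \<Longrightarrow> P (ext_mult x q)"
    and add: "\<And>a b. a \<in> ext_alg U \<Longrightarrow> b \<in> ext_alg U \<Longrightarrow> P a \<Longrightarrow> P b \<Longrightarrow> P (a + b)"
    and scale: "\<And>c a. a \<in> ext_alg U \<Longrightarrow> P a \<Longrightarrow> P (c *\<^sub>C a)"
  shows "P q"
proof -
  have w: "P (wedge Xs) \<and> wedge Xs \<in> ext_alg U" if "Xs \<in> lists U" for Xs
    using that
  proof (induction Xs)
    case Nil
    then show ?case using one by (auto simp: ext_alg_def intro: cvec.span_base)
  next
    case (Cons a Xs)
    then have "P (ext_mult a (wedge Xs))" by (intro mult) auto
    moreover have "wedge (a # Xs) \<in> ext_alg U"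
      unfolding ext_alg_def by (intro cvec.span_base imageI) (use Cons in auto)
    ultimately show ?case by simp
  qed
  have z: "P 0"
    using scale[of "wedge []" 0] w[of "[]"] by auto
  have "q \<in> ext_alg U \<and> P q"
    using q unfolding ext_alg_def
  proof (induction rule: cvec.span_induct_alt)
    case base
    then show ?case using z by (simp add: cvec.span_zero)
  next
    case (step c x y)
    then have "x \<in> ext_alg U" "c *\<^sub>C x \<in> ext_alg U"
      by (auto simp: ext_alg_def intro!: cvec.span_base cvec.span_scale)
    then show ?case
      using step w add[of "c *\<^sub>C x" y] scale[of x c] by (auto simp: ext_alg_def cvec.span_add)
  qed
  then show ?thesis by simp
qed

lemma ext_alg_operator_eq:
  assumes S: "clinear S" and T: "clinear T" and "S (wedge []) = T (wedge [])"
    and "\<And>x q. x \<in> U \<Longrightarrow> q \<in> ext_alg U \<Longrightarrow> S q = T q \<Longrightarrow> S (ext_mult x q) = T (ext_mult x q)"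
    and "q \<in> ext_alg U"
  shows "S q = T q"
  using assms(5)
  by (induction rule: ext_alg_induct) (simp_all add: assms(3,4) clinear_simps[OF S] clinear_simps[OF T])

lemma ext_induct [case_names one mult add scale]:
  assumes "P (wedge [])"
    and "\<And>x q. P q \<Longrightarrow> P (ext_mult x q)"
    and "\<And>a b. P a \<Longrightarrow> P b \<Longrightarrow> P (a + b)"
    and "\<And>c a. P a \<Longrightarrow> P (c *\<^sub>C a)"
  shows "P q"
  using ext_alg_induct[of q UNIV P] assms by simp

lemma ext_mult_add_left [simp]: "ext_mult (x + y) q = ext_mult x q + ext_mult y q"
proof -
  have "ext_mult (x + y) (wedge Xs) = ext_mult x (wedge Xs) + ext_mult y (wedge Xs)" for Xs
    using wedge_update_add[of 0 "0 # Xs" x y] by simp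
  then have "ext_lift UNIV (\<lambda>Xs. wedge ((x + y) # Xs)) q = ext_mult x q + ext_mult y q"
    by (intro ext_lift_linear_wedge) (auto intro: cvec.linear_compose_add clinear_ext_mult)
  then show ?thesis by (simp add: ext_mult_def)
qed

lemma ext_mult_scale_left [simp]: "ext_mult (c *\<^sub>C x) q = c *\<^sub>C ext_mult x q"
proof -
  have "ext_mult (c *\<^sub>C x) (wedge Xs) = c *\<^sub>C ext_mult x (wedge Xs)" for Xs
    using wedge_update_scale[of 0 "0 # Xs" c x] by simp
  then have "ext_lift UNIV (\<lambda>Xs. wedge ((c *\<^sub>C x) # Xs)) q = c *\<^sub>C ext_mult x q"
    by (intro ext_lift_linear_wedge) (auto intro: cvec.linear_compose_scale_right clinear_ext_mult)
  then show ?thesis by (simp add: ext_mult_def)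
qed

lemma clinear_ext_mult_left: "clinear (\<lambda>x. ext_mult x q)"
  by (rule clinearI) simp_all

lemmas ext_mult_linear_left [simp] =
  clinear_simps[OF clinear_ext_mult_left]

lemma ext_mult_self [simp]: "ext_mult x (ext_mult x q) = 0"
proof -
  have "ext_mult x (ext_mult x (wedge Xs)) = 0" for Xs by (simp add: wedge_repeated[of 0 1])
  then have "ext_lift UNIV (\<lambda>Xs. 0) q = ext_mult x (ext_mult x q)"
    by (intro ext_lift_linear_wedge Vector_Spaces.linear_compose[OF clinear_ext_mult clinear_ext_mult, unfolded o_def])
       auto
  moreover have "ext_lift UNIV (\<lambda>Xs. 0) q = (0::'a ext)"
    by (intro ext_lift_linear_wedge clinearI) auto
  ultimately show ?thesis by simp
qed

lemma ext_mult_anticommute: "ext_mult x (ext_mult y q) = - ext_mult y (ext_mult x q)"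
proof -
  have "ext_mult (x + y) (ext_mult (x + y) q) = 0" by (rule ext_mult_self)
  then show ?thesis by (simp add: eq_neg_iff_add_eq_0 add.commute)
qed

text \<open>The universal property of the exterior algebra in the form of a recursion principle: a left
  action of the vectors whose squares vanish on some space \<open>'w\<close> extends to the exterior algebra.
  Polarising \<open>B x (B x w) = 0\<close> shows that the operators \<open>B x\<close> anticommute, so a repeated factor can be
  moved next to its twin.\<close>

lemma ext_universal:
  fixes B :: "'v::complex_vector \<Rightarrow> 'w::complex_vector \<Rightarrow> 'w" and w0 :: 'w
  defines "T \<equiv> ext_lift UNIV (\<lambda>Xs. foldr B Xs w0)"
  assumes lin1: "\<And>w. clinear (\<lambda>x. B x w)" and lin2: "\<And>x. clinear (B x)"
    and sq: "\<And>x w. B x (B x w) = 0"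
  shows "clinear T" "T (wedge []) = w0" "T (ext_mult x q) = B x (T q)"
proof -
  note B = clinear_simps[OF lin1] clinear_simps[OF lin2]
  have ac: "B x (B y w) = - B y (B x w)" for x y w
  proof -
    have "B (x + y) (B (x + y) w) = 0" by (rule sq)
    then show ?thesis by (simp add: B sq eq_neg_iff_add_eq_0 add.commute)
  qed
  have rep: "B x (foldr B ys (B x w)) = 0" for x ys w
    \<comment> \<open>A word that begins and ends with the same factor acts as zero.\<close>
    by (induction ys) (simp_all add: sq ac[of x] B)
  have M: "multilinear_alternating_on UNIV (\<lambda>Xs. foldr B Xs w0)"
    unfolding multilinear_alternating_on_def clinear_on_def
  proof (intro conjI ballI allI impI)
    fix Xs :: "'v list" and i a b c
    assume i: "i < length Xs"
    show "foldr B (Xs[i := a + b]) w0 = foldr B (Xs[i := a]) w0 + foldr B (Xs[i := b]) w0"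
      using i
    proof (induction Xs arbitrary: i)
      case (Cons x Xs) then show ?case by (cases i) (auto simp: B)
    qed simp
    show "foldr B (Xs[i := c *\<^sub>C a]) w0 = c *\<^sub>C foldr B (Xs[i := a]) w0"
      using i
    proof (induction Xs arbitrary: i)
      case (Cons x Xs) then show ?case by (cases i) (auto simp: B)
    qed simp
  next
    fix Xs :: "'v list" and i j
    assume "i < j" "j < length Xs" "Xs ! i = Xs ! j"
    then show "foldr B Xs w0 = 0"
    proof (induction Xs arbitrary: i j)
      case (Cons x Xs)
      show ?case
      proof (cases i)
        case 0
        obtain k where k: "j = Suc k" using Cons(2) by (cases j) auto
        then have "Xs = take k Xs @ x # drop (Suc k) Xs"
          using Cons 0 by (metis Suc_less_eq id_take_nth_drop length_Cons nth_Cons_0 nth_Cons_Suc)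
        then have "foldr B Xs w0 = foldr B (take k Xs) (B x (foldr B (drop (Suc k) Xs) w0))"
          by (metis foldr_Cons foldr_append comp_apply)
        then show ?thesis by (simp add: rep)
      next
        case (Suc k)
        then obtain l where "j = Suc l" using Cons(2) by (cases j) auto
        then have "foldr B Xs w0 = 0" using Suc Cons by (intro Cons(1)[of k l]) auto
        then show ?thesis by (simp add: B)
      qed
    qed simp
  qed
  show T: "clinear T"
    using clinear_on_ext_lift[OF cvec.subspace_UNIV M] by (simp add: T_def clinear_iff_clinear_on)
  have w: "T (wedge Xs) = foldr B Xs w0" for Xs
    unfolding T_def by (rule ext_lift_wedge[OF cvec.subspace_UNIV M]) simp
  then show "T (wedge []) = w0" by simp
  have "ext_lift UNIV (\<lambda>Xs. B x (foldr B Xs w0)) q = T (ext_mult x q)"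
    by (rule ext_lift_linear_wedge[OF Vector_Spaces.linear_compose[OF clinear_ext_mult T, unfolded o_def]])
      (auto simp: w)
  moreover have "ext_lift UNIV (\<lambda>Xs. B x (foldr B Xs w0)) q = B x (T q)"
    by (rule ext_lift_linear_wedge[OF Vector_Spaces.linear_compose[OF T lin2, unfolded o_def]]) (auto simp: w)
  ultimately show "T (ext_mult x q) = B x (T q)" by simp
qed

text \<open>Primitive recursion along \<open>ext_mult\<close>: the recursion step \<open>A\<close> may use both \<open>q\<close> and the value at \<open>q\<close>. As
  in primitive recursion on the naturals, it is obtained from the iteration principle by carrying a
  copy of the argument along in a pair.\<close>

definition ext_rec :: "('v::complex_vector \<Rightarrow> 'v ext \<Rightarrow> 'w::complex_vector \<Rightarrow> 'w) \<Rightarrow> 'w \<Rightarrow> 'v ext \<Rightarrow> 'w" where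
  "ext_rec A t0 q =
     snd (ext_lift UNIV (\<lambda>Xs. foldr (\<lambda>x (q, t). (ext_mult x q, A x q t)) Xs (wedge [], t0)) q)"

text \<open>The last hypothesis is the relation \<open>x \<and> x \<and> q = 0\<close> expressed through the recursion step. Besides
  linearity it is what has to be verified when an operator is defined by recursion.\<close>

lemma ext_rec:
  fixes A :: "'v::complex_vector \<Rightarrow> 'v ext \<Rightarrow> 'w::complex_vector \<Rightarrow> 'w"
  assumes lin1: "\<And>q t. clinear (\<lambda>x. A x q t)"
    and add: "\<And>x q q' t t'. A x (q + q') (t + t') = A x q t + A x q' t'"
    and scale: "\<And>x c q t. A x (c *\<^sub>C q) (c *\<^sub>C t) = c *\<^sub>C A x q t"
    and sq: "\<And>x q t. A x (ext_mult x q) (A x q t) = 0"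
  shows "clinear (ext_rec A t0)" "ext_rec A t0 (wedge []) = t0"
    "ext_rec A t0 (ext_mult x q) = A x q (ext_rec A t0 q)"
proof -
  define B where "B = (\<lambda>x (q, t). (ext_mult x q, A x q t))"
  define T where "T = ext_lift UNIV (\<lambda>Xs. foldr B Xs (wedge [], t0))"
  have B: "B x w = (ext_mult x (fst w), A x (fst w) (snd w))" for x w
    by (simp add: B_def split: prod.splits)
  have 1: "clinear (\<lambda>x. B x w)" for w
    by (rule clinearI) (simp_all add: B clinear_simps[OF lin1] cscale_prod_def)
  have 2: "clinear (B x)" for x
    by (rule clinearI) (simp_all add: B add scale cscale_prod_def)
  have 3: "B x (B x w) = 0" for x w by (simp add: B sq zero_prod_def)
  note T = ext_universal[OF 1 2 3, of "(wedge [], t0)", folded T_def]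
  have r: "ext_rec A t0 q = snd (T q)" for q by (simp add: ext_rec_def T_def B_def)
  have fst: "fst (T q) = q" for q
    by (induction q rule: ext_induct)
      (simp_all add: T(2,3) B clinear_simps[OF T(1)] cscale_prod_def)
  show "clinear (ext_rec A t0)"
    by (rule clinearI)
      (simp_all add: r clinear_simps[OF T(1)] cscale_prod_def)
  show "ext_rec A t0 (wedge []) = t0" by (simp add: r T(2))
  show "ext_rec A t0 (ext_mult x q) = A x q (ext_rec A t0 q)"
    by (simp add: r T(3) B fst)
qed

lemma subspace_ext_pow: "cvec.subspace (ext_pow p U)"
  by (simp add: ext_pow_def)

lemma subspace_ext_alg: "cvec.subspace (ext_alg U)"
  by (simp add: ext_alg_def)

lemma ext_pow_subset_ext_alg: "q \<in> ext_pow p U \<Longrightarrow> q \<in> ext_alg U"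
  unfolding ext_pow_def ext_alg_def by (rule rev_subsetD[OF _ cvec.span_mono]) auto

lemma wedge_in_ext_pow: "Xs \<in> lists U \<Longrightarrow> wedge Xs \<in> ext_pow (length Xs) U"
  unfolding ext_pow_def by (rule cvec.span_base) auto

lemma wedge_in_ext_alg: "Xs \<in> lists U \<Longrightarrow> wedge Xs \<in> ext_alg U"
  by (rule ext_pow_subset_ext_alg[OF wedge_in_ext_pow])

lemma wedge_span_linear_image:
  assumes T: "clinear T" and S: "cvec.subspace S"
    and w: "\<And>Xs. Xs \<in> M \<Longrightarrow> T (wedge Xs) \<in> S" and q: "q \<in> cvec.span (wedge ` M)"
  shows "T q \<in> S"
  using q
proof (induction rule: cvec.span_induct_alt)
  case base
  show ?case by (simp add: cvec.linear_0[OF T] cvec.subspace_0[OF S])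
next
  case (step c x y)
  then have "T x \<in> S" using w by auto
  then show ?case
    by (simp add: clinear_simps[OF T] subspace_simps[OF S] step)
qed

lemma ext_pow_linear_image:
  assumes "clinear T" "cvec.subspace S"
    and "\<And>Xs. Xs \<in> lists U \<Longrightarrow> length Xs = p \<Longrightarrow> T (wedge Xs) \<in> S" and "q \<in> ext_pow p U"
  shows "T q \<in> S"
  using wedge_span_linear_image[OF assms(1,2) _ assms(4)[unfolded ext_pow_def]] assms(3) by blast

lemma ext_alg_linear_image:
  assumes "clinear T" "cvec.subspace S"
    and "\<And>Xs. Xs \<in> lists U \<Longrightarrow> T (wedge Xs) \<in> S" and "q \<in> ext_alg U"
  shows "T q \<in> S"
  using wedge_span_linear_image[OF assms(1,2) _ assms(4)[unfolded ext_alg_def]] assms(3) by blast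

lemma ext_alg_linear_eq:
  assumes "clinear S" "clinear T" "\<And>Xs. Xs \<in> lists U \<Longrightarrow> S (wedge Xs) = T (wedge Xs)" "q \<in> ext_alg U"
  shows "S q = T q"
proof -
  have "S q - T q \<in> {0}"
    by (rule ext_alg_linear_image[where T="\<lambda>q. S q - T q", OF _ cvec.subspace_single_0 _ assms(4)])
      (simp_all add: assms(3) cvec.linear_compose_sub assms(1,2) del: in_lists_conv_set)
  then show ?thesis by simp
qed

lemma ext_mult_in_ext_pow:
  assumes "x \<in> U" "q \<in> ext_pow p U"
  shows "ext_mult x q \<in> ext_pow (Suc p) U"
proof (rule ext_pow_linear_image[OF clinear_ext_mult subspace_ext_pow _ assms(2)])
  fix Xs assume "Xs \<in> lists U" "length Xs = p"
  then show "ext_mult x (wedge Xs) \<in> ext_pow (Suc p) U"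
    using wedge_in_ext_pow[of "x # Xs" U] assms(1) by auto
qed

lemma ext_mult_in_ext_alg:
  assumes "x \<in> U" "q \<in> ext_alg U"
  shows "ext_mult x q \<in> ext_alg U"
proof (rule ext_alg_linear_image[OF clinear_ext_mult subspace_ext_alg _ assms(2)])
  fix Xs assume "Xs \<in> lists U"
  then show "ext_mult x (wedge Xs) \<in> ext_alg U"
    using wedge_in_ext_alg[of "x # Xs" U] assms(1) by auto
qed

lemma ext_pow_0E:
  assumes "q \<in> ext_pow 0 U"
  obtains c where "q = c *\<^sub>C wedge []"
proof -
  have "{Xs \<in> lists U. length Xs = 0} = {[]}" by auto
  then have "q \<in> cvec.span {wedge []}" using assms by (simp add: ext_pow_def)
  then show thesis using that by (auto simp: cvec.span_singleton)
qed

text \<open>Induction on the degree: every element of degree \<open>p + 1\<close> is a sum of products of a vector with an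
  element of degree \<open>p\<close>.\<close>

lemma ext_pow_Suc_image:
  assumes T: "clinear T" and S: "cvec.subspace S"
    and w: "\<And>x q. x \<in> U \<Longrightarrow> q \<in> ext_pow p U \<Longrightarrow> T (ext_mult x q) \<in> S" and q: "q \<in> ext_pow (Suc p) U"
  shows "T q \<in> S"
proof (rule ext_pow_linear_image[OF T S _ q])
  fix Xs assume "Xs \<in> lists U" "length Xs = Suc p"
  then obtain x Ys where "Xs = x # Ys" "x \<in> U" "Ys \<in> lists U" "length Ys = p"
    by (cases Xs) auto
  then show "T (wedge Xs) \<in> S"
    using w[of x "wedge Ys"] wedge_in_ext_pow[of Ys U] by auto
qed

section \<open>Contractions, derivations and the boundary operator\<close>

text \<open>The operators of the Koszul calculus, each given by its value on \<open>x \<and> q\<close>, where \<open>t\<close> stands for its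
  value on \<open>q\<close>. The argument \<open>C\<close> of \<open>antiderivation\<close> sends \<open>x\<close> to the operator of multiplication by the
  even element that is the value of the antiderivation on \<open>x\<close>. The recursion for \<open>boundary\<close> splits the
  sum over pairs \<open>i < j\<close> into the terms with \<open>i\<close> the first position, which form the derivation extending
  \<open>ad x\<close>, and the remaining ones.\<close>

definition contraction :: "('v::complex_vector \<Rightarrow> complex) \<Rightarrow> 'v ext \<Rightarrow> 'v ext" where
  "contraction \<phi> = ext_rec (\<lambda>x q t. \<phi> x *\<^sub>C q - ext_mult x t) 0"

definition derivation :: "('v::complex_vector \<Rightarrow> 'v) \<Rightarrow> 'v ext \<Rightarrow> 'v ext" where
  "derivation D = ext_rec (\<lambda>x q t. ext_mult (D x) q + ext_mult x t) 0"

definition antiderivation :: "('v::complex_vector \<Rightarrow> 'v ext \<Rightarrow> 'v ext) \<Rightarrow> 'v ext \<Rightarrow> 'v ext" where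
  "antiderivation C = ext_rec (\<lambda>x q t. C x q - ext_mult x t) 0"

definition boundary :: "('v::complex_vector \<Rightarrow> 'v \<Rightarrow> 'v) \<Rightarrow> 'v ext \<Rightarrow> 'v ext" where
  "boundary br = ext_rec (\<lambda>x q t. - ext_mult x t - derivation (br x) q) 0"

definition scalar_part :: "'v::complex_vector ext \<Rightarrow> complex" where
  "scalar_part = ext_rec (\<lambda>x q t. 0) 1"

lemma clinear_complex_simps:
  fixes \<phi> :: "'v::complex_vector \<Rightarrow> complex"
  assumes "clinear \<phi>"
  shows "\<phi> (x + y) = \<phi> x + \<phi> y" "\<phi> (c *\<^sub>C x) = c * \<phi> x"
  using clinear_simps[OF assms] by (auto simp: cscale_complex_def)

lemma
  fixes \<phi> :: "'v::complex_vector \<Rightarrow> complex"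
  assumes "clinear \<phi>"
  shows clinear_contraction: "clinear (contraction \<phi>)"
    and contraction_one: "contraction \<phi> (wedge []) = 0"
    and contraction_mult: "contraction \<phi> (ext_mult x q) = \<phi> x *\<^sub>C q - ext_mult x (contraction \<phi> q)"
  unfolding contraction_def
  by (rule ext_rec[where A="\<lambda>x q t. \<phi> x *\<^sub>C q - ext_mult x t"];
      (intro clinearI)?; simp add: clinear_complex_simps[OF assms] cscale_add_left cscale_add_right
        algebra_simps cscale_cscale cvec.scale_right_diff_distrib)+

lemma
  fixes D :: "'v::complex_vector \<Rightarrow> 'v"
  assumes "clinear D"
  shows clinear_derivation: "clinear (derivation D)"
    and derivation_one: "derivation D (wedge []) = 0"
    and derivation_mult: "derivation D (ext_mult x q) = ext_mult (D x) q + ext_mult x (derivation D q)"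
  unfolding derivation_def
  by (rule ext_rec[where A="\<lambda>x q t. ext_mult (D x) q + ext_mult x t"];
      (intro clinearI)?; simp add: clinear_simps[OF assms]
        cscale_add_right ext_mult_anticommute[of "D _"])+

lemma
  fixes C :: "'v::complex_vector \<Rightarrow> 'v ext \<Rightarrow> 'v ext"
  assumes C: "\<And>q. clinear (\<lambda>x. C x q)" "\<And>x. clinear (C x)"
    and comm: "\<And>x q. C x (ext_mult x q) = ext_mult x (C x q)"
  shows clinear_antiderivation: "clinear (antiderivation C)"
    and antiderivation_one: "antiderivation C (wedge []) = 0"
    and antiderivation_mult: "antiderivation C (ext_mult x q) = C x q - ext_mult x (antiderivation C q)"
  unfolding antiderivation_def
  by (rule ext_rec[where A="\<lambda>x q t. C x q - ext_mult x t"];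
      (intro clinearI)?; simp add: clinear_simps[OF C(1)] clinear_simps[OF C(2)] comm
        cvec.scale_right_diff_distrib)+

lemma derivation_add_left:
  assumes "clinear D" "clinear E"
  shows "derivation (\<lambda>x. D x + E x) q = derivation D q + derivation E q"
  by (induction q rule: ext_induct)
    (simp_all add: assms derivation_one derivation_mult cvec.linear_compose_add
      clinear_simps[OF clinear_derivation] cscale_add_right)

lemma derivation_scale_left:
  assumes "clinear D"
  shows "derivation (\<lambda>x. c *\<^sub>C D x) q = c *\<^sub>C derivation D q"
  by (induction q rule: ext_induct)
    (simp_all add: assms derivation_one derivation_mult cvec.linear_compose_scale_right
      clinear_simps[OF clinear_derivation] cscale_add_right
      cscale_cscale mult.commute)

lemma
  fixes br :: "'v::complex_vector \<Rightarrow> 'v \<Rightarrow> 'v"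
  assumes br: "\<And>y. clinear (\<lambda>x. br x y)" "\<And>x. clinear (br x)" and self: "\<And>x. br x x = 0"
  shows clinear_boundary: "clinear (boundary br)"
    and boundary_one: "boundary br (wedge []) = 0"
    and boundary_mult: "boundary br (ext_mult x q) = - ext_mult x (boundary br q) - derivation (br x) q"
proof -
  have a: "derivation (br (x + y)) q = derivation (br x) q + derivation (br y) q" for x y q
  proof -
    have "br (x + y) = (\<lambda>z. br x z + br y z)" using cvec.linear_add[OF br(1)] by blast
    then show ?thesis using derivation_add_left[OF br(2) br(2), of x y q] by simp
  qed
  have s: "derivation (br (c *\<^sub>C x)) q = c *\<^sub>C derivation (br x) q" for c x q
  proof -
    have "br (c *\<^sub>C x) = (\<lambda>z. c *\<^sub>C br x z)" using cvec.linear_scale[OF br(1)] by blast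
    then show ?thesis using derivation_scale_left[OF br(2), of c x q] by simp
  qed
  note R = ext_rec[where A="\<lambda>x q t. - ext_mult x t - derivation (br x) q"]
  note S = a s derivation_mult[OF br(2)] self clinear_simps[OF clinear_derivation[OF br(2)]] cvec.scale_right_diff_distrib
  show "clinear (boundary br)" unfolding boundary_def
    by (rule R; (intro clinearI)?; simp add: S)
  show "boundary br (wedge []) = 0" unfolding boundary_def
    by (rule R; (intro clinearI)?; simp add: S)
  show "boundary br (ext_mult x q) = - ext_mult x (boundary br q) - derivation (br x) q"
    unfolding boundary_def by (rule R; (intro clinearI)?; simp add: S)
qed

lemma
  shows clinear_scalar_part: "clinear scalar_part"
    and scalar_part_one [simp]: "scalar_part (wedge []) = 1"
    and scalar_part_mult [simp]: "scalar_part (ext_mult x q) = 0"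
  unfolding scalar_part_def
  by (rule ext_rec[where A="\<lambda>x q t. 0"]; (intro clinearI)?; simp)+

lemma contraction_in_ext_pow:
  assumes "clinear \<phi>" "q \<in> ext_pow (Suc p) U"
  shows "contraction \<phi> q \<in> ext_pow p U"
  using assms(2)
proof (induction p arbitrary: q)
  case 0
  show ?case
  proof (rule ext_pow_Suc_image[OF clinear_contraction[OF assms(1)] subspace_ext_pow _ 0])
    fix x q assume "q \<in> ext_pow 0 U"
    then show "contraction \<phi> (ext_mult x q) \<in> ext_pow 0 U"
      by (auto elim!: ext_pow_0E intro!: cvec.subspace_scale[OF subspace_ext_pow]
        simp: contraction_mult[OF assms(1)] contraction_one[OF assms(1)]
          cvec.linear_scale[OF clinear_contraction[OF assms(1)]] wedge_in_ext_pow[of "[]", simplified])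
  qed
next
  case (Suc p)
  show ?case
  proof (rule ext_pow_Suc_image[OF clinear_contraction[OF assms(1)] subspace_ext_pow _ Suc(2)])
    fix x q assume "x \<in> U" "q \<in> ext_pow (Suc p) U"
    then show "contraction \<phi> (ext_mult x q) \<in> ext_pow (Suc p) U"
      by (auto simp: contraction_mult[OF assms(1)] intro!: Suc(1) ext_mult_in_ext_pow
        subspace_simps[OF subspace_ext_pow])
  qed
qed

lemma contraction_in_ext_alg:
  assumes "clinear \<phi>" "q \<in> ext_alg U"
  shows "contraction \<phi> q \<in> ext_alg U"
  using assms(2)
  by (induction rule: ext_alg_induct)
    (auto simp: contraction_one[OF assms(1)] contraction_mult[OF assms(1)]
      clinear_simps[OF clinear_contraction[OF assms(1)]] ext_mult_in_ext_alg
      intro!: subspace_simps[OF subspace_ext_alg])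

lemma derivation_in_ext_alg:
  assumes D: "clinear D" "\<And>x. x \<in> U \<Longrightarrow> D x \<in> U" and q: "q \<in> ext_alg U"
  shows "derivation D q \<in> ext_alg U"
  using q
  by (induction rule: ext_alg_induct)
    (auto simp: derivation_one[OF D(1)] derivation_mult[OF D(1)]
      clinear_simps[OF clinear_derivation[OF D(1)]] ext_mult_in_ext_alg D(2)
      intro!: subspace_simps[OF subspace_ext_alg])

lemma derivation_in_ext_pow:
  assumes D: "clinear D" "\<And>x. x \<in> U \<Longrightarrow> D x \<in> U" and q: "q \<in> ext_pow p U"
  shows "derivation D q \<in> ext_pow p U"
  using q
proof (induction p arbitrary: q)
  case 0
  then show ?case
    by (auto elim!: ext_pow_0E simp: derivation_one[OF D(1)]
      cvec.linear_scale[OF clinear_derivation[OF D(1)]] cvec.subspace_0[OF subspace_ext_pow])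
next
  case (Suc p)
  show ?case
    by (rule ext_pow_Suc_image[OF clinear_derivation[OF D(1)] subspace_ext_pow _ Suc(2)])
      (auto simp: derivation_mult[OF D(1)] intro!: Suc(1) ext_mult_in_ext_pow D(2)
        cvec.subspace_add[OF subspace_ext_pow])
qed

lemma antiderivation_in_ext_pow:
  fixes C :: "'v::complex_vector \<Rightarrow> 'v ext \<Rightarrow> 'v ext"
  assumes C: "\<And>q. clinear (\<lambda>x. C x q)" "\<And>x. clinear (C x)"
    and comm: "\<And>x q. C x (ext_mult x q) = ext_mult x (C x q)"
    and deg: "\<And>x q p. x \<in> U \<Longrightarrow> q \<in> ext_pow p U \<Longrightarrow> C x q \<in> ext_pow (Suc (Suc p)) U"
    and q: "q \<in> ext_pow p U"
  shows "antiderivation C q \<in> ext_pow (Suc p) U"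
  using q
proof (induction p arbitrary: q)
  case 0
  then show ?case
    by (auto elim!: ext_pow_0E simp: antiderivation_one[OF C comm]
      cvec.linear_scale[OF clinear_antiderivation[OF C comm]] cvec.subspace_0[OF subspace_ext_pow])
next
  case (Suc p)
  show ?case
    by (rule ext_pow_Suc_image[OF clinear_antiderivation[OF C comm] subspace_ext_pow _ Suc(2)])
      (auto simp: antiderivation_mult[OF C comm] intro!: Suc(1) ext_mult_in_ext_pow deg
        cvec.subspace_diff[OF subspace_ext_pow])
qed

lemma boundary_in_ext_pow:
  fixes br :: "'v::complex_vector \<Rightarrow> 'v \<Rightarrow> 'v"
  assumes br: "\<And>y. clinear (\<lambda>x. br x y)" "\<And>x. clinear (br x)" and self: "\<And>x. br x x = 0"
    and U: "\<And>x y. x \<in> U \<Longrightarrow> y \<in> U \<Longrightarrow> br x y \<in> U"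
    and q: "q \<in> ext_pow (Suc p) U"
  shows "boundary br q \<in> ext_pow p U"
  using q
proof (induction p arbitrary: q)
  case 0
  show ?case
  proof (rule ext_pow_Suc_image[OF clinear_boundary[OF br self] subspace_ext_pow _ 0])
    fix x q assume "q \<in> ext_pow 0 U"
    then show "boundary br (ext_mult x q) \<in> ext_pow 0 U"
      by (auto elim!: ext_pow_0E
        simp: boundary_mult[OF br self] boundary_one[OF br self] derivation_one[OF br(2)]
          cvec.linear_scale[OF clinear_boundary[OF br self]] cvec.subspace_0[OF subspace_ext_pow]
          cvec.linear_scale[OF clinear_derivation[OF br(2)]])
  qed
next
  case (Suc p)
  show ?case
    by (rule ext_pow_Suc_image[OF clinear_boundary[OF br self] subspace_ext_pow _ Suc(2)])
      (auto simp: boundary_mult[OF br self] intro!: Suc(1) ext_mult_in_ext_pow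
        derivation_in_ext_pow[OF br(2)] U
        subspace_simps[OF subspace_ext_pow])
qed

lemma derivation_wedge:
  assumes "clinear D"
  shows "derivation D (wedge Xs) = (\<Sum>i<length Xs. wedge (Xs[i := D (Xs ! i)]))"
proof (induction Xs)
  case Nil
  show ?case by (simp add: derivation_one assms)
next
  case (Cons x Xs)
  have "derivation D (wedge (x # Xs)) = derivation D (ext_mult x (wedge Xs))" by simp
  also have "\<dots> = (\<Sum>i<length (x # Xs). wedge ((x # Xs)[i := D ((x # Xs) ! i)]))"
    unfolding derivation_mult[OF assms] Cons by (simp add: sum.lessThan_Suc_shift del: sum.lessThan_Suc)
  finally show ?case .
qed

lemma ext_derivation_eq_derivation:
  assumes D: "clinear D" and E: "\<And>x. x \<in> U \<Longrightarrow> D x = E x" and U: "cvec.subspace U" "q \<in> ext_alg U"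
  shows "ext_derivation U E q = derivation D q"
  unfolding ext_derivation_def
proof (rule ext_lift_linear_wedge[OF clinear_derivation[OF D] _ U])
  fix Xs assume "Xs \<in> lists U"
  then have "Xs ! i \<in> U" if "i < length Xs" for i using that by auto
  then show "(\<Sum>i<length Xs. wedge (Xs[i := E (Xs ! i)])) = derivation D (wedge Xs)"
    by (simp add: derivation_wedge[OF D] E)
qed

text \<open>Moving the \<open>j\<close>-th factor to the front costs the sign of a cycle of length \<open>j + 1\<close>.\<close>

lemma wedge_move_front:
  "j < length Xs \<Longrightarrow> (- 1) ^ j *\<^sub>C wedge (a # nths Xs (- {j})) = wedge (Xs[j := a])"
proof (induction Xs arbitrary: j)
  case (Cons x Xs)
  show ?case
  proof (cases j)
    case 0
    have "{j. Suc j \<noteq> 0} = UNIV" by auto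
    then show ?thesis by (simp add: 0 nths_Cons Compl_eq nths_all cscale_one)
  next
    case (Suc k)
    have "nths (x # Xs) (- {Suc k}) = x # nths Xs (- {k})"
      by (simp add: nths_Cons) (simp add: Compl_eq)
    then have "(- 1) ^ j *\<^sub>C wedge (a # nths (x # Xs) (- {j}))
      = (- 1) ^ j *\<^sub>C ext_mult a (ext_mult x (wedge (nths Xs (- {k}))))" by (simp add: Suc)
    also have "\<dots> = ext_mult x ((- 1) ^ k *\<^sub>C wedge (a # nths Xs (- {k})))"
      by (simp add: Suc ext_mult_anticommute[of a] del: ext_mult_wedge) simp
    also have "(- 1) ^ k *\<^sub>C wedge (a # nths Xs (- {k})) = wedge (Xs[k := a])"
      using Cons Suc by simp
    finally show ?thesis by (simp add: Suc)
  qed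
qed simp

lemma boundary_wedge:
  fixes br :: "'v::complex_vector \<Rightarrow> 'v \<Rightarrow> 'v"
  assumes br: "\<And>y. clinear (\<lambda>x. br x y)" "\<And>x. clinear (br x)" and self: "\<And>x. br x x = 0"
  shows "boundary br (wedge Xs) = (\<Sum>(i, j)\<in>{(i, j). i < j \<and> j < length Xs}.
     (-1) ^ (i + j) *\<^sub>C wedge (br (Xs ! i) (Xs ! j) # nths Xs (- {i, j})))"
proof (induction Xs)
  case Nil
  show ?case by (simp add: boundary_one[OF br self])
next
  case (Cons x Xs)
  let ?P = "\<lambda>n. {(i, j). i < j \<and> j < (n::nat)}"
  let ?f = "\<lambda>Xs (i, j). (-1) ^ (i + j) *\<^sub>C wedge (br (Xs ! i) (Xs ! j) # nths Xs (- {i, j}))"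
  have fin: "finite (?P n)" for n by (rule finite_subset[of _ "{..<n} \<times> {..<n}"]) auto
  have P: "?P (Suc n) = (\<lambda>j. (0, Suc j)) ` {..<n} \<union> (\<lambda>(i, j). (Suc i, Suc j)) ` ?P n" for n
  proof (rule Set.set_eqI)
    fix p :: "nat \<times> nat"
    obtain i j where p: "p = (i, j)" by (cases p)
    show "p \<in> ?P (Suc n) \<longleftrightarrow> p \<in> (\<lambda>j. (0, Suc j)) ` {..<n} \<union> (\<lambda>(i, j). (Suc i, Suc j)) ` ?P n"
      unfolding p by (cases i; cases j) (auto simp: image_iff)
  qed
  have n1: "nths (x # Xs) (- {0, Suc j}) = nths Xs (- {j})" for j
    by (simp add: nths_Cons) (simp add: Compl_eq)
  have n2: "nths (x # Xs) (- {Suc i, Suc j}) = x # nths Xs (- {i, j})" for i j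
    by (simp add: nths_Cons) (simp add: Compl_eq)
  have "(\<Sum>p\<in>?P (length (x # Xs)). ?f (x # Xs) p) =
    (\<Sum>j<length Xs. ?f (x # Xs) (0, Suc j)) + (\<Sum>(i, j)\<in>?P (length Xs). ?f (x # Xs) (Suc i, Suc j))"
    unfolding list.size add_Suc_right add_0_right P
    by (subst sum.union_disjoint) (auto simp: fin sum.reindex inj_on_def o_def intro!: sum.cong)
  also have "(\<Sum>j<length Xs. ?f (x # Xs) (0, Suc j)) = - (\<Sum>j<length Xs. wedge (Xs[j := br x (Xs ! j)]))"
    unfolding sum_negf[symmetric]
    by (intro sum.cong refl) (simp add: n1 wedge_move_front[symmetric])
  also have "(\<Sum>(i, j)\<in>?P (length Xs). ?f (x # Xs) (Suc i, Suc j)) = (\<Sum>p\<in>?P (length Xs). - ext_mult x (?f Xs p))"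
    by (intro sum.cong refl)
      (auto simp: n2 ext_mult_wedge[symmetric] ext_mult_anticommute[of "br _ _"] simp del: ext_mult_wedge)
  also have "\<dots> = - ext_mult x (\<Sum>p\<in>?P (length Xs). ?f Xs p)"
    by (simp add: sum_negf)
  also have "- (\<Sum>j<length Xs. wedge (Xs[j := br x (Xs ! j)])) = - derivation (br x) (wedge Xs)"
    by (simp add: derivation_wedge[OF br(2)])
  finally have "(\<Sum>p\<in>?P (length (x # Xs)). ?f (x # Xs) p) = boundary br (ext_mult x (wedge Xs))"
    unfolding boundary_mult[OF br self] Cons by simp
  then show ?case by simp
qed

lemma ce_boundary_eq_boundary:
  fixes br :: "'v::complex_vector \<Rightarrow> 'v \<Rightarrow> 'v"
  assumes br: "\<And>y. clinear (\<lambda>x. br x y)" "\<And>x. clinear (br x)" and self: "\<And>x. br x x = 0"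
    and br': "\<And>x y. x \<in> U \<Longrightarrow> y \<in> U \<Longrightarrow> br' x y = br x y" and U: "cvec.subspace U" "q \<in> ext_alg U"
  shows "ce_boundary U br' q = boundary br q"
  unfolding ce_boundary_def
proof (rule ext_lift_linear_wedge[OF clinear_boundary[OF br self] _ U])
  fix Xs assume "Xs \<in> lists U"
  then have "Xs ! i \<in> U" if "i < length Xs" for i using that by auto
  then show "(\<Sum>(i, j)\<in>{(i, j). i < j \<and> j < length Xs}.
     (-1) ^ (i + j) *\<^sub>C wedge (br' (Xs ! i) (Xs ! j) # nths Xs (- {i, j}))) = boundary br (wedge Xs)"
    by (simp add: boundary_wedge[OF br self]) (intro sum.cong refl, auto simp: br')
qed

lemma derivation_in_family:
  fixes br :: "'v::complex_vector \<Rightarrow> 'v \<Rightarrow> 'v"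
  assumes br: "\<And>y. clinear (\<lambda>x. br x y)" "\<And>x. clinear (br x)"
  shows "clinear (\<lambda>x. derivation (br x) q)"
proof (rule clinearI)
  fix x y :: 'v and c
  have "br (x + y) = (\<lambda>z. br x z + br y z)" using cvec.linear_add[OF br(1)] by blast
  then show "derivation (br (x + y)) q = derivation (br x) q + derivation (br y) q"
    using derivation_add_left[OF br(2) br(2), of x y q] by simp
  have "br (c *\<^sub>C x) = (\<lambda>z. c *\<^sub>C br x z)" using cvec.linear_scale[OF br(1)] by blast
  then show "derivation (br (c *\<^sub>C x)) q = c *\<^sub>C derivation (br x) q"
    using derivation_scale_left[OF br(2), of c x q] by simp
qed

section \<open>Determinants as iterated contractions\<close>

lemma contraction_wedge:
  assumes "clinear \<phi>"
  shows "contraction \<phi> (wedge Xs) =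
    (\<Sum>j<length Xs. ((- 1) ^ j * \<phi> (Xs ! j)) *\<^sub>C wedge (take j Xs @ drop (Suc j) Xs))"
proof (induction Xs)
  case Nil
  show ?case by (simp add: contraction_one[OF assms])
next
  case (Cons x Xs)
  have "contraction \<phi> (wedge (x # Xs)) = \<phi> x *\<^sub>C wedge Xs - ext_mult x (contraction \<phi> (wedge Xs))"
    using contraction_mult[OF assms, of x "wedge Xs"] by simp
  also have "\<dots> = (\<Sum>j<length (x # Xs). ((- 1) ^ j * \<phi> ((x # Xs) ! j)) *\<^sub>C
      wedge (take j (x # Xs) @ drop (Suc j) (x # Xs)))"
    unfolding Cons by (simp add: sum.lessThan_Suc_shift sum_negf[symmetric] del: sum.lessThan_Suc)
  finally show ?case .
qed

lemma clinear_fold_contraction: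
  assumes "\<And>\<phi>. \<phi> \<in> set \<phi>s \<Longrightarrow> clinear \<phi>"
  shows "clinear (\<lambda>q. scalar_part (fold contraction \<phi>s q))"
  using assms
proof (induction \<phi>s)
  case Nil
  show ?case using clinear_scalar_part by simp
next
  case (Cons \<phi> \<phi>s)
  then show ?case
    using Vector_Spaces.linear_compose[OF clinear_contraction[of \<phi>] Cons(1)] by (simp add: o_def)
qed

text \<open>Contracting a decomposable element with one functional after the other yields the determinant of
  the pairings, because contraction with the first functional is the Laplace expansion along the first
  row. Hence the Hermitian form on the exterior algebra is governed by contractions, and the
  determinant disappears from all later arguments.\<close>

lemma scalar_part_fold_contraction:
  fixes \<phi>s :: "('v::complex_vector \<Rightarrow> complex) list"
  assumes "\<And>\<phi>. \<phi> \<in> set \<phi>s \<Longrightarrow> clinear \<phi>"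
  shows "scalar_part (fold contraction \<phi>s (wedge Xs)) =
    (if length \<phi>s = length Xs
     then det (mat (length Xs) (length Xs) (\<lambda>(i, j). (\<phi>s ! i) (Xs ! j))) else 0)"
  using assms
proof (induction \<phi>s arbitrary: Xs)
  case Nil
  show ?case
  proof (cases Xs)
    case (Cons x Ys)
    then show ?thesis using scalar_part_mult[of x "wedge Ys"] by simp
  qed simp
next
  case (Cons \<phi> \<phi>s)
  let ?n = "length Xs"
  let ?rem = "\<lambda>j. take j Xs @ drop (Suc j) Xs"
  let ?A = "mat ?n ?n (\<lambda>(i, j). ((\<phi> # \<phi>s) ! i) (Xs ! j))"
  have lin: "clinear (\<lambda>q. scalar_part (fold contraction \<phi>s q))"
    by (rule clinear_fold_contraction) (use Cons(2) in auto)
  have \<phi>: "clinear \<phi>" by (rule Cons(2)) simp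
  have "scalar_part (fold contraction (\<phi> # \<phi>s) (wedge Xs)) =
     (\<Sum>j<?n. ((- 1) ^ j * \<phi> (Xs ! j)) * scalar_part (fold contraction \<phi>s (wedge (?rem j))))"
    by (simp add: contraction_wedge[OF \<phi>] clinear_simps[OF lin] cscale_complex_def)
  also have "\<dots> = (if length (\<phi> # \<phi>s) = ?n then det ?A else 0)"
  proof (cases "length (\<phi> # \<phi>s) = ?n")
    case True
    then have n: "?n = Suc (length \<phi>s)" by simp
    have "det ?A = (\<Sum>j<?n. ?A $$ (0, j) * cofactor ?A 0 j)"
      by (rule laplace_expansion_row) (auto simp: n)
    also have "\<dots> = (\<Sum>j<?n. ((- 1) ^ j * \<phi> (Xs ! j)) * scalar_part (fold contraction \<phi>s (wedge (?rem j))))"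
    proof (intro sum.cong refl)
      fix j assume "j \<in> {..<?n}"
      then have j: "j < ?n" by simp
      have len: "length (?rem j) = length \<phi>s" using j n by simp
      have "mat_delete ?A 0 j =
        mat (length (?rem j)) (length (?rem j)) (\<lambda>(i, k). (\<phi>s ! i) (?rem j ! k))"
        unfolding mat_delete_def
        by (rule eq_matI) (use j n in \<open>auto simp: nth_append len\<close>)
      then have "scalar_part (fold contraction \<phi>s (wedge (?rem j))) = det (mat_delete ?A 0 j)"
        using Cons(1)[of "?rem j"] Cons(2) len by simp
      then show "?A $$ (0, j) * cofactor ?A 0 j =
          ((- 1) ^ j * \<phi> (Xs ! j)) * scalar_part (fold contraction \<phi>s (wedge (?rem j)))"
        using j n by (simp add: cofactor_def)
    qed
    finally show ?thesis using True by simp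
  next
    case False
    then have "scalar_part (fold contraction \<phi>s (wedge (?rem j))) = 0" if "j < ?n" for j
      using Cons(1)[of "?rem j"] Cons(2) that by auto
    then show ?thesis using False by simp
  qed
  finally show ?case .
qed

lemma det_cnj:
  assumes "A \<in> carrier_mat n n"
  shows "det (map_mat cnj A) = cnj (det A)"
proof -
  interpret comm_ring_hom cnj by unfold_locales auto
  show ?thesis by (rule hom_det)
qed

text \<open>The adjoint of multiplication by \<open>u\<close> is contraction with the functional dual to \<open>u\<close>. The form on
  vectors is written once as a linear functional \<open>\<chi> y\<close> of its first argument and once as the conjugate of
  a linear functional \<open>\<psi> x\<close> of its second argument. Expanding the determinant along columns uses \<open>\<chi>\<close> and shows
  that the extended form is linear in its first argument; expanding along rows uses \<open>\<psi>\<close> and gives the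
  adjointness.\<close>

lemma
  fixes h :: "'v::complex_vector \<Rightarrow> 'v \<Rightarrow> complex" and \<chi> \<psi> :: "'v \<Rightarrow> 'v \<Rightarrow> complex"
  assumes U: "cvec.subspace U"
    and \<chi>: "\<And>y. y \<in> U \<Longrightarrow> clinear (\<chi> y)" "\<And>x y. x \<in> U \<Longrightarrow> y \<in> U \<Longrightarrow> h x y = \<chi> y x"
    and \<psi>: "\<And>x. x \<in> U \<Longrightarrow> clinear (\<psi> x)" "\<And>x y. x \<in> U \<Longrightarrow> y \<in> U \<Longrightarrow> h x y = cnj (\<psi> x y)"
    and y: "y \<in> ext_alg U"
  shows ext_hermitian_linear: "\<exists>T. clinear T \<and> (\<forall>x\<in>ext_alg U. ext_hermitian U h x y = T x)"
    and ext_hermitian_one: "ext_hermitian U h (wedge []) y = cnj (scalar_part y)"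
    and ext_hermitian_mult: "u \<in> U \<Longrightarrow> x \<in> ext_alg U \<Longrightarrow>
      ext_hermitian U h (ext_mult u x) y = ext_hermitian U h x (contraction (\<psi> u) y)"
proof -
  define G where "G = (\<lambda>Xs Ys. if length Xs = length Ys
        then det (mat (length Xs) (length Xs) (\<lambda>(i, j). h (Xs ! i) (Ys ! j))) else 0)"
  have row: "cnj (G Xs Ys) = scalar_part (fold contraction (map \<psi> Xs) (wedge Ys))"
    if X: "Xs \<in> lists U" "Ys \<in> lists U" for Xs Ys
  proof -
    have "Xs ! i \<in> U" "Ys ! j \<in> U" if "i < length Xs" "j < length Ys" for i j
      using that X by auto
    then have "length Xs = length Ys \<Longrightarrow> mat (length Ys) (length Ys) (\<lambda>(i, j). (map \<psi> Xs ! i) (Ys ! j))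
       = map_mat cnj (mat (length Xs) (length Xs) (\<lambda>(i, j). h (Xs ! i) (Ys ! j)))"
      by (intro eq_matI) (auto simp: \<psi>(2))
    moreover have "cnj (det (mat (length Xs) (length Xs) (\<lambda>(i, j). h (Xs ! i) (Ys ! j)))) =
      det (map_mat cnj (mat (length Xs) (length Xs) (\<lambda>(i, j). h (Xs ! i) (Ys ! j))))"
      by (rule det_cnj[OF mat_carrier, symmetric])
    ultimately show ?thesis
      unfolding G_def using X \<psi>(1) by (subst scalar_part_fold_contraction) auto
  qed
  have col: "G Xs Ys = scalar_part (fold contraction (map \<chi> Ys) (wedge Xs))"
    if X: "Xs \<in> lists U" "Ys \<in> lists U" for Xs Ys
  proof -
    have "Xs ! i \<in> U" "Ys ! j \<in> U" if "i < length Xs" "j < length Ys" for i j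
      using that X by auto
    then have "length Xs = length Ys \<Longrightarrow> mat (length Xs) (length Xs) (\<lambda>(i, j). (map \<chi> Ys ! i) (Xs ! j))
       = transpose_mat (mat (length Xs) (length Xs) (\<lambda>(i, j). h (Xs ! i) (Ys ! j)))"
      by (intro eq_matI) (auto simp: \<chi>(2))
    moreover have "det (mat (length Xs) (length Xs) (\<lambda>(i, j). h (Xs ! i) (Ys ! j))) =
      det (transpose_mat (mat (length Xs) (length Xs) (\<lambda>(i, j). h (Xs ! i) (Ys ! j))))"
      by (rule det_transpose[OF mat_carrier, symmetric])
    ultimately show ?thesis
      unfolding G_def using X \<chi>(1) by (subst scalar_part_fold_contraction) auto
  qed
  define F where "F = (\<lambda>y Xs. cnj (ext_lift U (\<lambda>Ys. cnj (G Xs Ys)) y))"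
  have E: "ext_hermitian U h x y = ext_lift U (F y) x" for x y
    by (simp add: ext_hermitian_def F_def G_def)
  have lr: "clinear (\<lambda>q. scalar_part (fold contraction (map \<psi> Xs) q))" if "Xs \<in> lists U" for Xs
    by (rule clinear_fold_contraction) (use that \<psi>(1) in auto)
  have lc: "clinear (\<lambda>q. scalar_part (fold contraction (map \<chi> Ys) q))" if "Ys \<in> lists U" for Ys
    by (rule clinear_fold_contraction) (use that \<chi>(1) in auto)
  have F: "F y Xs = cnj (scalar_part (fold contraction (map \<psi> Xs) y))"
    if "y \<in> ext_alg U" "Xs \<in> lists U" for y Xs
    using ext_lift_linear_wedge[OF lr[OF that(2)] row[OF that(2)] U that(1)] by (simp add: F_def)
  have FT: "\<exists>T. clinear T \<and> (\<forall>Xs\<in>lists U. F y Xs = T (wedge Xs))" if "y \<in> ext_alg U" for y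
  proof -
    have "y \<in> ext_alg U \<and> (\<exists>T. clinear T \<and> (\<forall>Xs\<in>lists U. F y Xs = T (wedge Xs)))"
      using that unfolding ext_alg_def
    proof (induction rule: cvec.span_induct_alt)
      case base
      have "F 0 Xs = 0" if "Xs \<in> lists U" for Xs
        using that F[OF cvec.subspace_0[OF subspace_ext_alg] that] cvec.linear_0[OF lr[OF that]] by simp
      then show ?case
        by (intro conjI cvec.span_zero exI[of _ "\<lambda>_. 0"]) (auto intro: clinearI)
    next
      case (step c x y)
      obtain Ys where Ys: "Ys \<in> lists U" "x = wedge Ys" using step(1) by blast
      obtain T where T: "clinear T" "\<And>Xs. Xs \<in> lists U \<Longrightarrow> F y Xs = T (wedge Xs)"
        using step(2) by blast
      have y: "y \<in> ext_alg U" using step(2) by (simp add: ext_alg_def)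
      define S where "S = (\<lambda>q. cnj c *\<^sub>C scalar_part (fold contraction (map \<chi> Ys) q) + T q)"
      have mem: "c *\<^sub>C x + y \<in> ext_alg U"
        using Ys y wedge_in_ext_alg[of Ys U]
        by (auto intro!: subspace_simps[OF subspace_ext_alg])
      have "F (c *\<^sub>C x + y) Xs = S (wedge Xs)" if X: "Xs \<in> lists U" for Xs
      proof -
        have "F (c *\<^sub>C x + y) Xs = cnj c * cnj (scalar_part (fold contraction (map \<psi> Xs) x)) + F y Xs"
          using F[OF mem X] F[OF y X]
          by (simp add: clinear_simps[OF lr[OF X]] cscale_complex_def)
        also have "\<dots> = S (wedge Xs)"
          using row[OF X Ys(1)] col[OF X Ys(1)] by (simp add: S_def T(2)[OF X] Ys(2) cscale_complex_def)
            (metis complex_cnj_cnj)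
        finally show ?thesis .
      qed
      moreover have "clinear S"
        unfolding S_def
        by (rule cvec.linear_compose_add[OF cvec.linear_compose_scale_right[OF lc[OF Ys(1)]] T(1)])
      ultimately show ?case using mem by (auto simp: ext_alg_def)
    qed
    then show ?thesis by simp
  qed
  have ET: "\<exists>T. clinear T \<and> (\<forall>x\<in>ext_alg U. ext_hermitian U h x z = T x)" if z: "z \<in> ext_alg U" for z
  proof -
    obtain T where T: "clinear T" "\<And>Xs. Xs \<in> lists U \<Longrightarrow> F z Xs = T (wedge Xs)"
      using FT[OF z] by blast
    then show ?thesis
      using ext_lift_linear_wedge[of T U "F z", OF T U] by (auto simp: E)
  qed
  show "\<exists>T. clinear T \<and> (\<forall>x\<in>ext_alg U. ext_hermitian U h x y = T x)" by (rule ET[OF y])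
  have EW: "ext_hermitian U h (wedge Xs) z = cnj (scalar_part (fold contraction (map \<psi> Xs) z))"
    if z: "z \<in> ext_alg U" and X: "Xs \<in> lists U" for z Xs
  proof -
    obtain T where T: "clinear T" "\<And>Xs. Xs \<in> lists U \<Longrightarrow> F z Xs = T (wedge Xs)"
      using FT[OF z] by blast
    have "ext_hermitian U h (wedge Xs) z = F z Xs"
      unfolding E
      by (rule ext_lift_wedge[OF U multilinear_alternating_on_linear_wedge[OF T U] X])
    then show ?thesis using F z X by simp
  qed
  show "ext_hermitian U h (wedge []) y = cnj (scalar_part y)"
    using EW[OF y, of "[]"] by simp
  assume u: "u \<in> U" and x: "x \<in> ext_alg U"
  have y': "contraction (\<psi> u) y \<in> ext_alg U"
    by (rule contraction_in_ext_alg[OF \<psi>(1)[OF u] y])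
  obtain S where S: "clinear S" "\<And>x. x \<in> ext_alg U \<Longrightarrow> ext_hermitian U h x y = S x"
    using ET[OF y] by auto
  obtain T where T: "clinear T" "\<And>x. x \<in> ext_alg U \<Longrightarrow> ext_hermitian U h x (contraction (\<psi> u) y) = T x"
    using ET[OF y'] by auto
  have "S (ext_mult u x) = T x"
  proof (rule ext_alg_linear_eq[OF Vector_Spaces.linear_compose[OF clinear_ext_mult S(1), unfolded o_def] T(1) _ x])
    fix Xs assume X: "Xs \<in> lists U"
    then have "u # Xs \<in> lists U" using u by simp
    then show "S (ext_mult u (wedge Xs)) = T (wedge Xs)"
      using EW[OF y, of "u # Xs"] EW[OF y' X] S(2)[OF wedge_in_ext_alg[of "u # Xs" U]] T(2)[OF wedge_in_ext_alg[OF X]]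
      by simp
  qed
  then show "ext_hermitian U h (ext_mult u x) y = ext_hermitian U h x (contraction (\<psi> u) y)"
    using S(2)[OF ext_mult_in_ext_alg[OF u x]] T(2)[OF x] by simp
qed

section \<open>Lie algebras with a triangular decomposition\<close>

text \<open>What the Laplacian computation needs from a Lie algebra with a triangular decomposition.

  \<^item> \<open>L\<close> is the Lie algebra, \<open>U\<close> its negative part, and \<open>pm\<close>, \<open>pz\<close>, \<open>pp\<close> are the projections onto the
    negative, zero and positive part.
  \<^item> \<open>u i\<close> and \<open>u' i\<close> form dual bases of the negative and the positive part, \<open>b a\<close> and \<open>b' a\<close> dual bases of the
    zero part. Duality is expressed by the reconstruction formulas \<open>recon_m\<close>, \<open>recon_p\<close>, \<open>recon_z\<close>, which is the
    only form in which it is applied; in particular the families may contain zero vectors.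
  \<^item> The negative part may have infinite dimension, so sums over the dual bases are truncated: \<open>J n\<close>
    indexes the basis vectors of depth less than \<open>n\<close>, and \<open>dep n\<close>, \<open>hgt n\<close> consist of the vectors whose
    components have depth, respectively height, less than \<open>n\<close>. By \<open>pm_vanish\<close> the sums that occur in the
    operators do not depend on a sufficiently large truncation.

  Elements outside \<open>L\<close> are admitted as arguments of the operations so that these are total linear maps.\<close>

locale triangular_lie_algebra =
  fixes br :: "'v::complex_vector \<Rightarrow> 'v \<Rightarrow> 'v" and form :: "'v \<Rightarrow> 'v \<Rightarrow> complex"
    and L U :: "'v set" and pm pz pp :: "'v \<Rightarrow> 'v"
    and dep hgt :: "nat \<Rightarrow> 'v set"
    and J :: "nat \<Rightarrow> 'i set" and u u' :: "'i \<Rightarrow> 'v"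
    and K :: "'k set" and b b' :: "'k \<Rightarrow> 'v"
  assumes br_left: "\<And>y. clinear (\<lambda>x. br x y)" and br_right: "\<And>x. clinear (br x)"
    and br_skew: "\<And>x y. br x y = - br y x"
    and br_jacobi: "\<And>x y z. br x (br y z) = br (br x y) z + br y (br x z)"
    and form_left: "\<And>y. clinear (\<lambda>x. form x y)" and form_right: "\<And>x. clinear (form x)"
    and form_sym: "\<And>x y. form x y = form y x"
    and form_inv: "\<And>x y z. form (br x y) z = form x (br y z)"
    and br_L: "\<And>x y. x \<in> L \<Longrightarrow> y \<in> L \<Longrightarrow> br x y \<in> L"
    and U_subspace: "cvec.subspace U" and U_L: "\<And>x. x \<in> U \<Longrightarrow> x \<in> L"
    and br_U: "\<And>x y. x \<in> U \<Longrightarrow> y \<in> U \<Longrightarrow> br x y \<in> U"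
    and pm: "clinear pm" and pm_U: "\<And>x. x \<in> L \<Longrightarrow> pm x \<in> U" and pm_id: "\<And>x. x \<in> U \<Longrightarrow> pm x = x"
    and decomp: "\<And>x. x \<in> L \<Longrightarrow> x = pm x + pz x + pp x"
    and finite_J: "\<And>n. finite (J n)" and J_mono: "\<And>m n. m \<le> n \<Longrightarrow> J m \<subseteq> J n"
    and u_U: "\<And>i. u i \<in> U" and u'_L: "\<And>i. u' i \<in> L"
    and b_L: "\<And>a. a \<in> K \<Longrightarrow> b a \<in> L" and b_U: "\<And>a x. a \<in> K \<Longrightarrow> x \<in> U \<Longrightarrow> br (b a) x \<in> U"
    and b'_U: "\<And>a x. a \<in> K \<Longrightarrow> x \<in> U \<Longrightarrow> br (b' a) x \<in> U"
    and dep_mono: "\<And>m n. m \<le> n \<Longrightarrow> dep m \<subseteq> dep n" and dep_ex: "\<And>x. \<exists>n. x \<in> dep n"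
    and dep_subspace: "\<And>n. cvec.subspace (dep n)"
    and dep_br: "\<And>x y m n. x \<in> dep m \<Longrightarrow> y \<in> dep n \<Longrightarrow> br x y \<in> dep (m + n)"
    and dep_u: "\<And>i n. i \<in> J n \<Longrightarrow> u i \<in> dep n"
    and dep_u': "\<And>i n x. x \<in> dep n \<Longrightarrow> br (u' i) x \<in> dep n"
    and dep_b: "\<And>a n x. a \<in> K \<Longrightarrow> x \<in> dep n \<Longrightarrow> br x (b a) \<in> dep n"
    and pm_vanish: "\<And>x n i. x \<in> dep n \<Longrightarrow> i \<notin> J n \<Longrightarrow> pm (br (u' i) x) = 0"
    and recon_m: "\<And>x n. x \<in> L \<Longrightarrow> x \<in> dep n \<Longrightarrow> (\<Sum>i\<in>J n. form (u' i) x *\<^sub>C u i) = pm x"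
    and recon_p: "\<And>x n. x \<in> L \<Longrightarrow> x \<in> hgt n \<Longrightarrow> (\<Sum>i\<in>J n. form (u i) x *\<^sub>C u' i) = pp x"
    and hgt_br: "\<And>i n x. i \<in> J n \<Longrightarrow> x \<in> U \<Longrightarrow> br (u' i) x \<in> hgt n"
    and hgt_ex: "\<And>x. \<exists>n. \<forall>m\<ge>n. x \<in> hgt m"
    and finite_K: "finite K"
    and recon_z: "\<And>x. x \<in> L \<Longrightarrow> (\<Sum>a\<in>K. form (b a) x *\<^sub>C b' a) = pz x"
    and b_fix: "\<And>a. a \<in> K \<Longrightarrow> pz (b a) = b a"
begin

lemmas br_linear = clinear_simps[OF br_left] clinear_simps[OF br_right]

lemmas pm_linear = clinear_simps[OF pm]

lemma br_self: "br x x = 0"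
proof -
  have "br x x + br x x = 0" using br_skew[of x x] by (metis add.right_inverse)
  then have "2 *\<^sub>C br x x = 0" using cscale_add_left[of 1 1 "br x x"] by (simp add: cscale_one)
  then show ?thesis by simp
qed

lemma form_cycle: "form (u' i) (br x y) = form y (br (u' i) x)"
  by (metis form_inv form_sym)

lemma form_skew: "form x (br y z) = - form y (br x z)"
proof -
  have "form x (br y z) = form (br x y) z" by (simp add: form_inv)
  also have "\<dots> = - form (br y x) z"
    by (subst br_skew) (simp add: cvec.linear_neg[OF form_left])
  finally show ?thesis by (simp add: form_inv)
qed

definition bilin :: "('v \<Rightarrow> 'v \<Rightarrow> 'w::complex_vector) \<Rightarrow> bool" where
  "bilin \<beta> \<longleftrightarrow> (\<forall>y. clinear (\<lambda>x. \<beta> x y)) \<and> (\<forall>x. clinear (\<beta> x))"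

lemma bilinD: "bilin \<beta> \<Longrightarrow> clinear (\<lambda>x. \<beta> x y)" "bilin \<beta> \<Longrightarrow> clinear (\<beta> x)"
  by (auto simp: bilin_def)

lemmas bilin_simps = clinear_simps[OF bilinD(1)] clinear_simps[OF bilinD(2)]

lemma bilin_comp: "bilin \<beta> \<Longrightarrow> clinear f \<Longrightarrow> clinear g \<Longrightarrow> bilin (\<lambda>x y. \<beta> (f x) (g y))"
  unfolding bilin_def
  using Vector_Spaces.linear_compose[of cscale cscale f cscale] Vector_Spaces.linear_compose[of cscale cscale g cscale]
  unfolding o_def by blast

lemma clinear_ident: "clinear (\<lambda>x. x)"
  by (rule clinearI) auto

lemma clinear_pm_br: "clinear (\<lambda>x. pm (br x y))" "clinear (\<lambda>x. pm (br y x))"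
  using Vector_Spaces.linear_compose[OF br_left pm] Vector_Spaces.linear_compose[OF br_right pm]
  unfolding o_def by blast+

text \<open>This lemma and the next two are the rules for moving a bracket across the canonical element
  \<open>\<Sum>i. u i \<otimes> u' i\<close>. They follow from invariance of the form by expanding one factor in the dual basis
  and collecting the other one. The component of \<open>[u' i, X]\<close> that is kept decides where the sum ends up:
  for the negative component both tensor factors lie in \<open>U\<close> and the result is antisymmetric.\<close>

lemma skew_transfer:
  assumes X: "X \<in> U" "X \<in> dep n" and \<beta>: "bilin \<beta>"
  shows "(\<Sum>i\<in>J n. \<beta> (u i) (pm (br (u' i) X))) = - (\<Sum>i\<in>J n. \<beta> (pm (br (u' i) X)) (u i))"
proof -
  note B = bilin_simps[OF \<beta>]
  have r: "pm (br (u' i) X) = (\<Sum>l\<in>J n. form (u' l) (br (u' i) X) *\<^sub>C u l)" for i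
    using X by (intro recon_m[symmetric] br_L u'_L U_L dep_u')
  have "(\<Sum>i\<in>J n. \<beta> (u i) (pm (br (u' i) X))) = (\<Sum>i\<in>J n. \<Sum>l\<in>J n. form (u' l) (br (u' i) X) *\<^sub>C \<beta> (u i) (u l))"
    by (simp add: r B)
  also have "\<dots> = (\<Sum>l\<in>J n. \<Sum>i\<in>J n. form (u' l) (br (u' i) X) *\<^sub>C \<beta> (u i) (u l))"
    by (rule sum.swap)
  also have "\<dots> = - (\<Sum>l\<in>J n. \<Sum>i\<in>J n. form (u' i) (br (u' l) X) *\<^sub>C \<beta> (u i) (u l))"
    unfolding sum_negf[symmetric]
    by (intro sum.cong refl) (subst form_skew, simp)
  also have "\<dots> = - (\<Sum>i\<in>J n. \<beta> (pm (br (u' i) X)) (u i))"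
    by (simp add: r B)
  finally show ?thesis .
qed

text \<open>For the zero component the canonical element of the zero part appears.\<close>

lemma zero_transfer:
  assumes X: "X \<in> U" "X \<in> dep n" and \<beta>: "bilin \<beta>"
  shows "(\<Sum>i\<in>J n. \<beta> (u i) (pz (br (u' i) X))) = (\<Sum>a\<in>K. \<beta> (br X (b a)) (b' a))"
proof -
  note B = bilin_simps[OF \<beta>]
  have r: "pz (br (u' i) X) = (\<Sum>a\<in>K. form (b a) (br (u' i) X) *\<^sub>C b' a)" for i
    using X by (intro recon_z[symmetric] br_L u'_L U_L)
  have "(\<Sum>i\<in>J n. \<beta> (u i) (pz (br (u' i) X))) = (\<Sum>i\<in>J n. \<Sum>a\<in>K. form (b a) (br (u' i) X) *\<^sub>C \<beta> (u i) (b' a))"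
    by (simp add: r B)
  also have "\<dots> = (\<Sum>a\<in>K. \<Sum>i\<in>J n. form (u' i) (br X (b a)) *\<^sub>C \<beta> (u i) (b' a))"
    by (subst sum.swap) (simp add: form_cycle)
  also have "\<dots> = (\<Sum>a\<in>K. \<beta> (\<Sum>i\<in>J n. form (u' i) (br X (b a)) *\<^sub>C u i) (b' a))"
    by (simp add: B)
  also have "\<dots> = (\<Sum>a\<in>K. \<beta> (br X (b a)) (b' a))"
  proof (intro sum.cong refl)
    fix a assume a: "a \<in> K"
    have "br X (b a) \<in> U"
      using b_U[OF a X(1)] by (subst br_skew) (rule cvec.subspace_neg[OF U_subspace])
    then show "\<beta> (\<Sum>i\<in>J n. form (u' i) (br X (b a)) *\<^sub>C u i) (b' a) = \<beta> (br X (b a)) (b' a)"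
      using recon_m[of "br X (b a)" n] dep_b[OF a X(2)] by (simp add: U_L pm_id)
  qed
  finally show ?thesis .
qed

text \<open>For the positive component the bracket moves from the second to the first tensor factor. This rule
  changes the degrees of the first factor, so the truncation has to be enlarged: the bracket of two
  vectors of depth less than \<open>m\<close> has depth less than \<open>2 * m\<close>.\<close>

lemma plus_transfer:
  assumes X: "X \<in> U" "X \<in> dep m" and \<beta>: "bilin \<beta>" and v: "\<And>x l. l \<notin> J m \<Longrightarrow> \<beta> x (u' l) = 0"
    and n: "2 * m \<le> n"
  shows "(\<Sum>i\<in>J n. \<beta> (u i) (pp (br (u' i) X))) = (\<Sum>i\<in>J n. \<beta> (br X (u i)) (u' i))"
proof -
  note B = bilin_simps[OF \<beta>]
  have r: "pp (br (u' i) X) = (\<Sum>l\<in>J n. form (u l) (br (u' i) X) *\<^sub>C u' l)" if "i \<in> J n" for i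
    using X that by (intro recon_p[symmetric] br_L u'_L U_L hgt_br)
  have "(\<Sum>i\<in>J n. \<beta> (u i) (pp (br (u' i) X))) = (\<Sum>i\<in>J n. \<Sum>l\<in>J n. form (u l) (br (u' i) X) *\<^sub>C \<beta> (u i) (u' l))"
    by (simp add: r B)
  also have "\<dots> = (\<Sum>l\<in>J n. \<Sum>i\<in>J n. form (u' i) (br X (u l)) *\<^sub>C \<beta> (u i) (u' l))"
    by (subst sum.swap) (simp add: form_cycle)
  also have "\<dots> = (\<Sum>l\<in>J n. \<beta> (\<Sum>i\<in>J n. form (u' i) (br X (u l)) *\<^sub>C u i) (u' l))"
    by (simp add: B)
  also have "\<dots> = (\<Sum>l\<in>J n. \<beta> (br X (u l)) (u' l))"
  proof (intro sum.cong refl)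
    fix l
    show "\<beta> (\<Sum>i\<in>J n. form (u' i) (br X (u l)) *\<^sub>C u i) (u' l) = \<beta> (br X (u l)) (u' l)"
    proof (cases "l \<in> J m")
      case True
      have "br X (u l) \<in> U" using X u_U by (simp add: br_U)
      moreover have "br X (u l) \<in> dep n"
        using dep_br[OF X(2) dep_u[OF True]] dep_mono[OF n] by (auto simp: mult_2)
      ultimately show ?thesis using recon_m[of "br X (u l)" n] by (simp add: U_L pm_id)
    qed (simp add: v)
  qed
  finally show ?thesis .
qed

text \<open>The canonical element of the zero part is symmetric because the form is.\<close>

lemma casimir_swap:
  assumes \<beta>: "bilin \<beta>"
  shows "(\<Sum>a\<in>K. \<beta> (b' a) (b a)) = (\<Sum>a\<in>K. \<beta> (b a) (b' a))"
proof -
  note B = bilin_simps[OF \<beta>]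
  have "(\<Sum>a\<in>K. \<beta> (b' a) (b a)) = (\<Sum>a\<in>K. \<beta> (b' a) (\<Sum>c\<in>K. form (b c) (b a) *\<^sub>C b' c))"
    by (intro sum.cong refl arg_cong2[of _ _ _ _ \<beta>]) (simp add: recon_z b_L b_fix)
  also have "\<dots> = (\<Sum>a\<in>K. \<Sum>c\<in>K. form (b c) (b a) *\<^sub>C \<beta> (b' a) (b' c))"
    by (simp add: B)
  also have "\<dots> = (\<Sum>c\<in>K. \<Sum>a\<in>K. form (b a) (b c) *\<^sub>C \<beta> (b' a) (b' c))"
    by (subst sum.swap) (simp add: form_sym)
  also have "\<dots> = (\<Sum>c\<in>K. \<beta> (\<Sum>a\<in>K. form (b a) (b c) *\<^sub>C b' a) (b' c))"
    by (simp add: B)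
  also have "\<dots> = (\<Sum>a\<in>K. \<beta> (b a) (b' a))"
    by (intro sum.cong refl arg_cong2[of _ _ _ _ \<beta>]) (simp add: recon_z b_L b_fix)
  finally show ?thesis .
qed

lemma pz_U:
  assumes "x \<in> L" "y \<in> U"
  shows "br (pz x) y \<in> U"
proof -
  have "br (pz x) y = (\<Sum>a\<in>K. form (b a) x *\<^sub>C br (b' a) y)"
    by (simp add: recon_z[OF assms(1), symmetric] br_linear)
  then show ?thesis
    by (auto intro!: subspace_simps[OF U_subspace] b'_U assms)
qed

lemma pm_br_split:
  assumes "x \<in> L" "y \<in> U"
  shows "pm (br x y) = br (pm x) y + br (pz x) y + pm (br (pp x) y)"
proof -
  have "br x y = br (pm x) y + br (pz x) y + br (pp x) y"
    by (subst decomp[OF assms(1)]) (simp add: br_linear)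
  moreover have "br (pm x) y \<in> U" "br (pz x) y \<in> U"
    using assms by (auto intro: br_U pm_U pz_U)
  ultimately show ?thesis by (simp add: pm_linear pm_id)
qed

lemma pm_br_split':
  assumes "x \<in> L" "y \<in> U"
  shows "pm (br y x) = br y (pm x) + br y (pz x) + pm (br y (pp x))"
proof -
  have "pm (br y x) = - pm (br x y)" by (subst br_skew) (simp add: pm_linear)
  also have "\<dots> = - (br (pm x) y + br (pz x) y + pm (br (pp x) y))"
    by (simp add: pm_br_split[OF assms])
  also have "\<dots> = br y (pm x) + br y (pz x) + pm (br y (pp x))"
    by (subst (4 5 6) br_skew) (simp add: pm_linear)
  finally show ?thesis .
qed

text \<open>The identity behind the commutator of \<open>dstar\<close> with \<open>ad x\<close>, stated for an arbitrary alternating bilinear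
  map \<open>\<beta>\<close>. Expanding \<open>[u' i, [x, y]]\<close> by the Jacobi identity and splitting the inner brackets into their
  negative, zero and positive components gives six sums. The transfer rules turn the two zero components
  into Casimir terms and the two positive ones into the sums already present on the left.\<close>

lemma quadratic_identity:
  assumes x: "x \<in> U" "x \<in> dep m" and y: "y \<in> U" "y \<in> dep m" and \<beta>: "bilin \<beta>"
    and alt: "\<And>x y. \<beta> x y = - \<beta> y x" and n: "2 * m \<le> n"
  shows "(\<Sum>i\<in>J n. \<beta> (u i) (pm (br (u' i) (br x y))))
     - (\<Sum>i\<in>J n. \<beta> (br x (u i)) (pm (br (u' i) y)))
     - (\<Sum>i\<in>J n. \<beta> (u i) (br x (pm (br (u' i) y))))
     - (\<Sum>i\<in>J n. \<beta> (u i) (br (pm (br (u' i) x)) y))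
     + (\<Sum>i\<in>J n. \<beta> (pm (br (u' i) x)) (br (u i) y))
    = - 2 *\<^sub>C (\<Sum>a\<in>K. \<beta> (br (b a) x) (br (b' a) y))"
proof -
  note B = bilin_simps[OF \<beta>]
  have mn: "dep m \<subseteq> dep n" using n by (intro dep_mono) auto
  then have xn: "x \<in> dep n" and yn: "y \<in> dep n" using x y by auto
  define T1 where "T1 = (\<Sum>i\<in>J n. \<beta> (u i) (br (pm (br (u' i) x)) y))"
  define T2 where "T2 = (\<Sum>i\<in>J n. \<beta> (pm (br (u' i) x)) (br (u i) y))"
  define T3 where "T3 = (\<Sum>i\<in>J n. \<beta> (u i) (pm (br (u' i) (br x y))))"
  define T4 where "T4 = (\<Sum>i\<in>J n. \<beta> (br x (u i)) (pm (br (u' i) y)))"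
  define T5 where "T5 = (\<Sum>i\<in>J n. \<beta> (u i) (br x (pm (br (u' i) y))))"
  define C where "C = (\<Sum>a\<in>K. \<beta> (br (b a) x) (br (b' a) y))"
  have T12: "T1 = - T2"
    unfolding T1_def T2_def
    by (rule skew_transfer[OF x(1) xn bilin_comp[OF \<beta> clinear_ident br_left]])
  have split: "pm (br (u' i) (br x y)) =
      (br (pm (br (u' i) x)) y + br (pz (br (u' i) x)) y + pm (br (pp (br (u' i) x)) y)) +
      (br x (pm (br (u' i) y)) + br x (pz (br (u' i) y)) + pm (br x (pp (br (u' i) y))))" for i
    unfolding br_jacobi[of "u' i" x y] pm_linear
    using x y by (simp add: pm_br_split pm_br_split' br_L u'_L U_L)
  have c1: "(\<Sum>i\<in>J n. \<beta> (u i) (br (pz (br (u' i) x)) y)) = - C"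
    unfolding zero_transfer[OF x(1) xn bilin_comp[OF \<beta> clinear_ident br_left]] C_def sum_negf[symmetric]
    by (intro sum.cong refl, subst (1) br_skew) (simp add: B)
  have "(\<Sum>i\<in>J n. \<beta> (u i) (br x (pz (br (u' i) y)))) = (\<Sum>a\<in>K. \<beta> (br y (b a)) (br x (b' a)))"
    by (rule zero_transfer[OF y(1) yn bilin_comp[OF \<beta> clinear_ident br_right]])
  also have "\<dots> = - (\<Sum>a\<in>K. \<beta> (br (b' a) x) (br (b a) y))"
    unfolding sum_negf[symmetric]
    by (intro sum.cong refl) (simp add: br_skew[of y] br_skew[of x] B, rule alt)
  also have "\<dots> = - C"
    unfolding C_def using casimir_swap[OF bilin_comp[OF \<beta> br_left br_left], of x y] by simp
  finally have c2: "(\<Sum>i\<in>J n. \<beta> (u i) (br x (pz (br (u' i) y)))) = - C" .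
  have p1: "(\<Sum>i\<in>J n. \<beta> (u i) (pm (br (pp (br (u' i) x)) y))) = T4"
    unfolding T4_def
    by (rule plus_transfer[OF x(1,2) bilin_comp[OF \<beta> clinear_ident clinear_pm_br(1)] _ n])
      (simp add: pm_vanish[OF y(2)] cvec.linear_0[OF bilinD(2)[OF \<beta>]])
  have "pm (br x (u' l)) = 0" if "l \<notin> J m" for l
    using pm_vanish[OF x(2) that] br_skew[of x "u' l"] by (simp add: pm_linear)
  then have "(\<Sum>i\<in>J n. \<beta> (u i) (pm (br x (pp (br (u' i) y))))) = (\<Sum>i\<in>J n. \<beta> (br y (u i)) (pm (br x (u' i))))"
    by (intro plus_transfer[OF y(1,2) bilin_comp[OF \<beta> clinear_ident clinear_pm_br(2)] _ n])
      (simp add: cvec.linear_0[OF bilinD(2)[OF \<beta>]])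
  also have "\<dots> = - T2"
    unfolding T2_def sum_negf[symmetric]
    by (intro sum.cong refl) (simp add: br_skew[of y] br_skew[of x] B pm_linear, rule alt)
  finally have p2: "(\<Sum>i\<in>J n. \<beta> (u i) (pm (br x (pp (br (u' i) y))))) = - T2" .
  have "T3 = T1 + (- C) + T4 + (T5 + (- C) + (- T2))"
    unfolding T3_def split B sum.distrib c1 c2 p1 p2 T1_def[symmetric] T5_def[symmetric] ..
  then have "T3 - T4 - T5 - T1 + T2 = - C - C" by (simp add: T12)
  also have "\<dots> = - 2 *\<^sub>C C" using cscale_add_left[of 1 1 C] by (simp add: cscale_one)
  finally show ?thesis unfolding T1_def T2_def T3_def T4_def T5_def C_def .
qed

section \<open>The coboundary operator and the Laplacian\<close>

definition depth :: "'v \<Rightarrow> nat" where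
  "depth x = (LEAST n. x \<in> dep n)"

lemma dep_depth: "x \<in> dep (depth x)"
  unfolding depth_def using dep_ex[of x] by (rule LeastI_ex)

text \<open>Multiplication by \<open>- 1/2 * (\<Sum>i. u i \<and> pm [u' i, x])\<close>, the value of \<open>dstar\<close> on the vector \<open>x\<close>; the sum is
  truncated at the depth of \<open>x\<close>.\<close>

definition cobracket :: "'v \<Rightarrow> 'v ext \<Rightarrow> 'v ext" where
  "cobracket x q = (- 1/2) *\<^sub>C (\<Sum>i\<in>J (depth x). ext_mult (u i) (ext_mult (pm (br (u' i) x)) q))"

lemma cobracket_eq:
  assumes "x \<in> dep n"
  shows "cobracket x q = (- 1/2) *\<^sub>C (\<Sum>i\<in>J n. ext_mult (u i) (ext_mult (pm (br (u' i) x)) q))"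
proof -
  have "depth x \<le> n" unfolding depth_def by (rule Least_le) (rule assms)
  then have "(\<Sum>i\<in>J (depth x). ext_mult (u i) (ext_mult (pm (br (u' i) x)) q)) =
    (\<Sum>i\<in>J n. ext_mult (u i) (ext_mult (pm (br (u' i) x)) q))"
    by (intro sum.mono_neutral_left finite_J J_mono) (auto simp: pm_vanish[OF dep_depth])
  then show ?thesis by (simp add: cobracket_def)
qed

lemma cobracket_linear_left: "clinear (\<lambda>x. cobracket x q)"
proof (rule clinearI)
  fix x y
  define n where "n = max (depth x) (depth y)"
  have xy: "x \<in> dep n" "y \<in> dep n"
    using dep_depth[of x] dep_depth[of y] dep_mono[of "depth x" n] dep_mono[of "depth y" n]
    by (auto simp: n_def)
  then have "x + y \<in> dep n" by (rule cvec.subspace_add[OF dep_subspace])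
  then show "cobracket (x + y) q = cobracket x q + cobracket y q"
    by (simp add: cobracket_eq[OF xy(1)] cobracket_eq[OF xy(2)] cobracket_eq br_linear pm_linear
        sum.distrib cscale_add_right)
next
  fix c x
  have d: "c *\<^sub>C x \<in> dep (depth x)" using dep_depth by (rule cvec.subspace_scale[OF dep_subspace])
  show "cobracket (c *\<^sub>C x) q = c *\<^sub>C cobracket x q"
    by (simp add: cobracket_eq[OF d] cobracket_eq[OF dep_depth[of x]] br_linear pm_linear
        cvec.scale_sum_right cscale_cscale mult.commute)
qed

lemma cobracket_linear_right: "clinear (cobracket x)"
  unfolding cobracket_def
  by (rule clinearI)
    (simp_all add: sum.distrib cscale_add_right cvec.scale_sum_right cscale_cscale mult.commute)

lemma cobracket_commute: "cobracket x (ext_mult y q) = ext_mult y (cobracket x q)"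
  unfolding cobracket_def
  by (simp add: ext_mult_anticommute[of y])

lemmas cobracket_conds = cobracket_linear_left cobracket_linear_right cobracket_commute

text \<open>The antiderivation that will turn out to be the adjoint of the boundary operator: up to sign it is
  the Chevalley-Eilenberg differential of the positive part, under the identification of the positive
  part with the dual of \<open>U\<close>.\<close>

definition dstar :: "'v ext \<Rightarrow> 'v ext" where
  "dstar = antiderivation cobracket"

lemma
  shows clinear_dstar: "clinear dstar" and dstar_one: "dstar (wedge []) = 0"
    and dstar_mult: "dstar (ext_mult x q) = cobracket x q - ext_mult x (dstar q)"
  unfolding dstar_def
  by (rule clinear_antiderivation[OF cobracket_conds] antiderivation_one[OF cobracket_conds]
    antiderivation_mult[OF cobracket_conds])+

lemma cobracket_in_ext_pow:
  assumes "x \<in> U" "q \<in> ext_pow p U"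
  shows "cobracket x q \<in> ext_pow (Suc (Suc p)) U"
  unfolding cobracket_def using assms
  by (intro subspace_simps[OF subspace_ext_pow]
     ext_mult_in_ext_pow u_U pm_U br_L u'_L U_L) auto

lemma cobracket_in_ext_alg:
  assumes "x \<in> U" "q \<in> ext_alg U"
  shows "cobracket x q \<in> ext_alg U"
  unfolding cobracket_def using assms
  by (intro subspace_simps[OF subspace_ext_alg]
     ext_mult_in_ext_alg u_U pm_U br_L u'_L U_L) auto

lemma dstar_in_ext_pow: "q \<in> ext_pow p U \<Longrightarrow> dstar q \<in> ext_pow (Suc p) U"
  unfolding dstar_def
  by (rule antiderivation_in_ext_pow[OF cobracket_conds cobracket_in_ext_pow])

abbreviation bdr :: "'v ext \<Rightarrow> 'v ext" where "bdr \<equiv> boundary br"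

lemmas clinear_bdr = clinear_boundary[OF br_left br_right br_self]
lemmas bdr_one = boundary_one[OF br_left br_right br_self]
lemmas bdr_mult = boundary_mult[OF br_left br_right br_self]
lemmas clinear_ad = clinear_derivation[OF br_right]
lemmas ad_one = derivation_one[OF br_right]
lemmas ad_mult = derivation_mult[OF br_right]

lemmas op_linear =
  clinear_simps[OF clinear_bdr] clinear_simps[OF clinear_dstar] clinear_simps[OF clinear_ad] clinear_simps[OF cobracket_linear_right]


lemmas clinear_ad_left = derivation_in_family[OF br_left br_right]

lemma sum_J_extend:
  assumes x: "x \<in> dep n" and n: "n \<le> n'" and f: "\<And>i. pm (br (u' i) x) = 0 \<Longrightarrow> f i = 0"
  shows "(\<Sum>i\<in>J n. f i) = (\<Sum>i\<in>J n'. f i :: 'w::complex_vector)"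
  by (intro sum.mono_neutral_left finite_J J_mono n) (auto intro!: f pm_vanish[OF x])

lemma bilin_mult: "bilin (\<lambda>x y. ext_mult x (ext_mult y q))"
  unfolding bilin_def by (auto intro!: clinearI)

lemma dep_common: "\<exists>m. n \<le> m \<and> x \<in> dep m"
proof (intro exI conjI)
  show "n \<le> max n (depth x)" by simp
  show "x \<in> dep (max n (depth x))" using dep_depth[of x] dep_mono[of "depth x" "max n (depth x)"] by auto
qed

text \<open>The second-order terms that the two commutators below have in common; they cancel in the
  Laplacian.\<close>

definition remainder :: "nat \<Rightarrow> 'v \<Rightarrow> 'v ext \<Rightarrow> 'v ext" where
  "remainder n x q = (\<Sum>i\<in>J n. ext_mult (u i) (derivation (br (pm (br (u' i) x))) q)
      - ext_mult (pm (br (u' i) x)) (derivation (br (u i)) q))"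

lemma remainder_extend:
  "x \<in> dep n \<Longrightarrow> n \<le> n' \<Longrightarrow> remainder n x q = remainder n' x q"
  unfolding remainder_def
proof (rule sum_J_extend)
  fix i assume z: "pm (br (u' i) x) = 0"
  show "ext_mult (u i) (derivation (br (pm (br (u' i) x))) q)
      - ext_mult (pm (br (u' i) x)) (derivation (br (u i)) q) = 0"
    unfolding z by (simp add: cvec.linear_0[OF clinear_ad_left])
qed

lemma remainder_linear: "clinear (remainder n x)"
  unfolding remainder_def
  by (rule clinearI)
    (simp_all add: op_linear sum.distrib cvec.scale_sum_right sum_subtractf cvec.scale_right_diff_distrib)

lemma remainder_mult:
  "remainder n x (ext_mult y q) = (\<Sum>i\<in>J n. ext_mult (u i) (ext_mult (br (pm (br (u' i) x)) y) q))
      - (\<Sum>i\<in>J n. ext_mult (pm (br (u' i) x)) (ext_mult (br (u i) y) q)) - ext_mult y (remainder n x q)"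
proof -
  have "remainder n x (ext_mult y q) = (\<Sum>i\<in>J n.
      ext_mult (u i) (ext_mult (br (pm (br (u' i) x)) y) q)
     - ext_mult (pm (br (u' i) x)) (ext_mult (br (u i) y) q) -
      ext_mult y (ext_mult (u i) (derivation (br (pm (br (u' i) x))) q)
      - ext_mult (pm (br (u' i) x)) (derivation (br (u i)) q)))"
    unfolding remainder_def
    by (intro sum.cong refl) (simp add: ad_mult ext_mult_anticommute[of y])
  also have "\<dots> = (\<Sum>i\<in>J n. ext_mult (u i) (ext_mult (br (pm (br (u' i) x)) y) q))
      - (\<Sum>i\<in>J n. ext_mult (pm (br (u' i) x)) (ext_mult (br (u i) y) q)) - ext_mult y (remainder n x q)"
    unfolding remainder_def by (simp add: sum_subtractf)
  finally show ?thesis .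
qed

text \<open>The cross terms that \<open>\<Sum>a. ad (b a) \<circ> ad (b' a)\<close>, acting by derivations, produces on a product
  \<open>x \<and> q\<close>.\<close>

definition zero_part :: "'v \<Rightarrow> 'v ext \<Rightarrow> 'v ext" where
  "zero_part x q = (\<Sum>a\<in>K. ext_mult (br (b a) x) (derivation (br (b' a)) q))"

lemma zero_part_linear: "clinear (zero_part x)"
  unfolding zero_part_def
  by (rule clinearI) (simp_all add: op_linear sum.distrib cvec.scale_sum_right)

lemma zero_part_mult:
  "zero_part x (ext_mult y q) = (\<Sum>a\<in>K. ext_mult (br (b a) x) (ext_mult (br (b' a) y) q)) - ext_mult y (zero_part x q)"
  unfolding zero_part_def by (simp add: ad_mult sum.distrib ext_mult_anticommute[of y] sum_negf)

lemma half_scale: "(1/2::complex) *\<^sub>C x + (1/2) *\<^sub>C x = (x::'a::complex_vector)"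
  by (simp add: cscale_add_left[symmetric] cscale_one)

text \<open>Both sides are antiderivations of \<open>q\<close> that vanish in degree zero, so it is enough to compare their
  values on a vector \<open>y\<close>, where the claim is \<open>quadratic_identity\<close>.\<close>

lemma dstar_ad_commutator:
  assumes x: "x \<in> U" "x \<in> dep n" and q: "q \<in> ext_alg U"
  shows "dstar (derivation (br x) q) - derivation (br x) (dstar q) =
    zero_part x q - (1/2) *\<^sub>C remainder n x q"
proof (rule ext_alg_operator_eq[where S = "\<lambda>q. dstar (derivation (br x) q) - derivation (br x) (dstar q)"
      and T = "\<lambda>q. zero_part x q - (1/2) *\<^sub>C remainder n x q", OF _ _ _ _ q], goal_cases)
  case 1
  show ?case by (rule clinearI) (simp_all add: op_linear cvec.scale_right_diff_distrib)
next
  case 2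
  show ?case
    by (intro cvec.linear_compose_sub cvec.linear_compose_scale_right zero_part_linear remainder_linear)
next
  case 3
  have "remainder n x (wedge []) = 0" "zero_part x (wedge []) = 0"
    by (simp_all add: remainder_def zero_part_def ad_one)
  then show ?case by (simp add: ad_one dstar_one op_linear)
next
  case mult: (4 y q)
  obtain m where m: "n \<le> m" "y \<in> dep m" using dep_common by blast
  then have xm: "x \<in> dep m" using dep_mono[of n m] x by auto
  \<comment> \<open>The brackets of \<open>x\<close> with vectors of depth less than \<open>m\<close> must be covered by the truncation.\<close>
  define n' where "n' = 2 * m"
  have n': "n \<le> n'" using m by (simp add: n'_def)
  have yn: "y \<in> dep n'" and xn: "x \<in> dep n'" using m xm dep_mono[of m n'] by (auto simp: n'_def)
  have xyn: "br x y \<in> dep n'" using dep_br[OF xm m(2)] by (simp add: n'_def mult_2)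
  define T1 where "T1 = (\<Sum>i\<in>J n'. ext_mult (u i) (ext_mult (br (pm (br (u' i) x)) y) q))"
  define T2 where "T2 = (\<Sum>i\<in>J n'. ext_mult (pm (br (u' i) x)) (ext_mult (br (u i) y) q))"
  define T3 where "T3 = (\<Sum>i\<in>J n'. ext_mult (u i) (ext_mult (pm (br (u' i) (br x y))) q))"
  define T4 where "T4 = (\<Sum>i\<in>J n'. ext_mult (br x (u i)) (ext_mult (pm (br (u' i) y)) q))"
  define T5 where "T5 = (\<Sum>i\<in>J n'. ext_mult (u i) (ext_mult (br x (pm (br (u' i) y))) q))"
  define C where "C = (\<Sum>a\<in>K. ext_mult (br (b a) x) (ext_mult (br (b' a) y) q))"
  have Q: "T3 - T4 - T5 - T1 + T2 = - 2 *\<^sub>C C"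
    unfolding T1_def T2_def T3_def T4_def T5_def C_def
    by (rule quadratic_identity[OF x(1) xm mult(1) m(2) bilin_mult]) (auto simp: n'_def intro: ext_mult_anticommute)
  have c1: "cobracket (br x y) q = (- 1/2) *\<^sub>C T3"
    by (simp add: cobracket_eq[OF xyn] T3_def)
  have c2: "derivation (br x) (cobracket y q) - cobracket y (derivation (br x) q) = (- 1/2) *\<^sub>C (T4 + T5)"
    unfolding T4_def T5_def
    by (simp add: cobracket_eq[OF yn] op_linear ad_mult sum.distrib cscale_add_right)
  have "dstar (derivation (br x) (ext_mult y q)) - derivation (br x) (dstar (ext_mult y q)) =
    cobracket (br x y) q - (derivation (br x) (cobracket y q) - cobracket y (derivation (br x) q))
     - ext_mult y (dstar (derivation (br x) q) - derivation (br x) (dstar q))"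
    by (simp add: ad_mult dstar_mult op_linear)
  also have "\<dots> = (- 1/2) *\<^sub>C T3 - (- 1/2) *\<^sub>C (T4 + T5) - ext_mult y (zero_part x q - (1/2) *\<^sub>C remainder n x q)"
    unfolding c1 c2 mult(3) ..
  also have "(- 1/2) *\<^sub>C T3 - (- 1/2) *\<^sub>C (T4 + T5) = (- 1/2) *\<^sub>C (T3 - T4 - T5 - T1 + T2) - (1/2) *\<^sub>C (T1 - T2)"
    by (simp add: cvec.scale_right_diff_distrib cscale_add_right)
  also have "\<dots> = C - (1/2) *\<^sub>C (T1 - T2)"
    unfolding Q by (simp add: cscale_cscale cscale_one)
  also have "\<dots> - ext_mult y (zero_part x q - (1/2) *\<^sub>C remainder n x q) =
     zero_part x (ext_mult y q) - (1/2) *\<^sub>C remainder n' x (ext_mult y q)"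
    unfolding remainder_mult zero_part_mult T1_def[symmetric] T2_def[symmetric] C_def[symmetric]
      remainder_extend[OF x(2) n']
    by (simp add: cvec.scale_right_diff_distrib)
  finally show ?case unfolding remainder_extend[OF x(2) n'] .
qed

lemma bdr_cobracket_commutator:
  assumes x: "x \<in> dep n"
  shows "bdr (cobracket x q) - cobracket x (bdr q) =
    (1/2) *\<^sub>C ext_mult (\<Sum>i\<in>J n. br (u i) (pm (br (u' i) x))) q - (1/2) *\<^sub>C remainder n x q"
proof -
  have "bdr (ext_mult a (ext_mult c q)) = ext_mult a (ext_mult c (bdr q)) +
     (ext_mult a (derivation (br c) q) - ext_mult c (derivation (br a) q)) - ext_mult (br a c) q" for a c
    by (simp add: bdr_mult ad_mult)
  then have "bdr (cobracket x q) - cobracket x (bdr q) =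
    (- 1/2) *\<^sub>C (remainder n x q - (\<Sum>i\<in>J n. ext_mult (br (u i) (pm (br (u' i) x))) q))"
    unfolding cobracket_eq[OF x] op_linear remainder_def
    by (simp add: sum.distrib sum_subtractf cvec.scale_right_diff_distrib cscale_add_right)
  then show ?thesis by (simp add: cvec.scale_right_diff_distrib)
qed

text \<open>Applying the Laplacian to \<open>x \<and> q\<close> and subtracting \<open>x \<and>\<close> the Laplacian of \<open>q\<close> leaves the two
  commutators above. Their difference is the degree-one value of the Laplacian on \<open>x\<close>, which is given by
  hypothesis \<open>cas\<close>, minus the cross terms of the Casimir operator; the right-hand side satisfies the same
  recursion.\<close>

theorem laplacian_eq_casimir:
  assumes D: "clinear D"
    and cas: "\<And>x n. x \<in> U \<Longrightarrow> x \<in> dep n \<Longrightarrow>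
      (\<Sum>i\<in>J n. br (u i) (pm (br (u' i) x))) = - (D x + (\<Sum>a\<in>K. br (b a) (br (b' a) x)))"
    and q: "q \<in> ext_alg U"
  shows "bdr (dstar q) + dstar (bdr q) =
    (- 1/2) *\<^sub>C (derivation D q + (\<Sum>a\<in>K. derivation (br (b a)) (derivation (br (b' a)) q)))"
proof (rule ext_alg_operator_eq[where S = "\<lambda>q. bdr (dstar q) + dstar (bdr q)" and
      T = "\<lambda>q. (- 1/2) *\<^sub>C (derivation D q + (\<Sum>a\<in>K. derivation (br (b a)) (derivation (br (b' a)) q)))",
      OF _ _ _ _ q], goal_cases)
  case 1
  show ?case by (rule clinearI) (simp_all add: op_linear cscale_add_right)
next
  case 2
  have "clinear (\<lambda>q. \<Sum>a\<in>K. derivation (br (b a)) (derivation (br (b' a)) q))"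
    by (rule clinearI) (simp_all add: op_linear sum.distrib cvec.scale_sum_right)
  then show ?case
    by (intro cvec.linear_compose_scale_right cvec.linear_compose_add clinear_derivation D)
next
  case 3
  show ?case by (simp add: dstar_one bdr_one op_linear derivation_one[OF D] ad_one)
next
  case mult: (4 x q)
  let ?C = "\<lambda>q. \<Sum>a\<in>K. derivation (br (b a)) (derivation (br (b' a)) q)"
  let ?c = "\<Sum>a\<in>K. br (b a) (br (b' a) x)"
  define n where "n = depth x"
  have n: "x \<in> dep n" by (simp add: n_def dep_depth)
  have "bdr (dstar (ext_mult x q)) + dstar (bdr (ext_mult x q)) =
    ext_mult x (bdr (dstar q) + dstar (bdr q)) + (bdr (cobracket x q) - cobracket x (bdr q))
    - (dstar (derivation (br x) q) - derivation (br x) (dstar q))"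
    by (simp add: dstar_mult bdr_mult op_linear)
  also have "\<dots> = ext_mult x (bdr (dstar q) + dstar (bdr q)) +
     (1/2) *\<^sub>C ext_mult (- (D x + ?c)) q - zero_part x q"
    unfolding bdr_cobracket_commutator[OF n] dstar_ad_commutator[OF mult(1) n mult(2)] cas[OF mult(1) n]
    by simp
  also have "\<dots> = (- 1/2) *\<^sub>C (ext_mult (D x) q + ext_mult x (derivation D q) +
     (ext_mult ?c q + (zero_part x q + zero_part x q) + ext_mult x (?C q)))"
    unfolding mult(3)
    using half_scale[of "zero_part x q"]
    by (simp add: cscale_add_right algebra_simps)
  also have "ext_mult ?c q + (zero_part x q + zero_part x q) + ext_mult x (?C q) = ?C (ext_mult x q)"
  proof -
    have "bilin (\<lambda>a c. ext_mult (br a x) (derivation (br c) q))"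
      unfolding bilin_def
      by (auto intro!: clinearI simp: br_linear clinear_simps[OF clinear_ad_left])
    from casimir_swap[OF this] have "zero_part x q = (\<Sum>a\<in>K. ext_mult (br (b' a) x) (derivation (br (b a)) q))"
      by (simp add: zero_part_def)
    then have z: "zero_part x q + zero_part x q = (\<Sum>a\<in>K. ext_mult (br (b' a) x) (derivation (br (b a)) q)
        + ext_mult (br (b a) x) (derivation (br (b' a)) q))"
      by (simp add: zero_part_def sum.distrib)
    show ?thesis unfolding z by (simp add: ad_mult op_linear sum.distrib)
  qed
  finally show ?case by (simp add: derivation_mult[OF D])
qed

text \<open>A Cartan formula: the anticommutator of the two odd antiderivations is an even derivation, hence
  determined by its values on vectors. There the two halves of the sum defining \<open>cobracket\<close> contribute
  equally, by \<open>skew_transfer\<close>.\<close>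

lemma dstar_contraction:
  assumes v: "v \<in> L" "pp v = v" and q: "q \<in> ext_alg U"
  shows "dstar (contraction (form v) q) + contraction (form v) (dstar q) = - derivation (\<lambda>x. pm (br v x)) q"
proof -
  note lin = clinear_contraction[OF form_right]
  note I = contraction_mult[OF form_right, of v] clinear_simps[OF lin]
  note D = clinear_pm_br(2)[of v]
  show ?thesis
  proof (rule ext_alg_operator_eq[where S = "\<lambda>q. dstar (contraction (form v) q) + contraction (form v) (dstar q)"
        and T = "\<lambda>q. - derivation (\<lambda>x. pm (br v x)) q", OF _ _ _ _ q], goal_cases)
    case 1
    show ?case by (rule clinearI) (simp_all add: I op_linear cscale_add_right)
  next
    case 2
    show ?case by (rule clinearI) (simp_all add: clinear_simps[OF clinear_derivation[OF D]])
  next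
    case 3
    show ?case by (simp add: dstar_one derivation_one[OF D] contraction_one[OF form_right] op_linear
          cvec.linear_0[OF lin])
  next
    case mult: (4 x q)
    obtain N where N: "\<And>m. N \<le> m \<Longrightarrow> v \<in> hgt m" using hgt_ex by blast
    obtain n where n: "N \<le> n" "x \<in> dep n" using dep_common by blast
    define S where "S = (\<Sum>i\<in>J n. form v (u i) *\<^sub>C ext_mult (pm (br (u' i) x)) q)"
    have "bilin (\<lambda>x y. form v y *\<^sub>C ext_mult x q)"
      unfolding bilin_def using clinear_complex_simps[OF form_right]
      by (auto intro!: clinearI simp: cscale_add_right cscale_add_left cscale_cscale mult.commute)
    from skew_transfer[OF mult(1) n(2) this]
    have s: "(\<Sum>i\<in>J n. form v (pm (br (u' i) x)) *\<^sub>C ext_mult (u i) q) = - S"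
      by (simp add: S_def)
    have "S = ext_mult (pm (br (\<Sum>i\<in>J n. form (u i) v *\<^sub>C u' i) x)) q"
      by (simp add: S_def br_linear pm_linear form_sym[of v])
    also have "(\<Sum>i\<in>J n. form (u i) v *\<^sub>C u' i) = v"
      using recon_p[OF v(1) N[OF n(1)]] v(2) by simp
    finally have S: "S = ext_mult (pm (br v x)) q" .
    have "contraction (form v) (cobracket x q) - cobracket x (contraction (form v) q) =
      (- 1/2) *\<^sub>C (S - (\<Sum>i\<in>J n. form v (pm (br (u' i) x)) *\<^sub>C ext_mult (u i) q))"
    proof -
      have "contraction (form v) (ext_mult (u i) (ext_mult (pm (br (u' i) x)) q)) =
        form v (u i) *\<^sub>C ext_mult (pm (br (u' i) x)) q - form v (pm (br (u' i) x)) *\<^sub>C ext_mult (u i) q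
        + ext_mult (u i) (ext_mult (pm (br (u' i) x)) (contraction (form v) q))" for i
        by (simp add: I)
      then show ?thesis
        unfolding cobracket_eq[OF n(2)] S_def I
        by (simp add: sum_subtractf cvec.scale_right_diff_distrib sum.distrib cscale_add_right)
    qed
    also have "\<dots> = - ((1/2) *\<^sub>C S + (1/2) *\<^sub>C S)" unfolding s by (simp add: cscale_add_right)
    also have "\<dots> = - S" unfolding half_scale ..
    finally have c: "contraction (form v) (cobracket x q) - cobracket x (contraction (form v) q) =
      - ext_mult (pm (br v x)) q" by (simp add: S)
    have "dstar (contraction (form v) (ext_mult x q)) + contraction (form v) (dstar (ext_mult x q)) =
      (contraction (form v) (cobracket x q) - cobracket x (contraction (form v) q))
      + ext_mult x (dstar (contraction (form v) q) + contraction (form v) (dstar q))"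
      by (simp add: dstar_mult I op_linear)
    also have "\<dots> = - derivation (\<lambda>x. pm (br v x)) (ext_mult x q)"
      unfolding c mult(3) by (simp add: derivation_mult[OF D])
    finally show ?case .
  qed
qed

text \<open>Multiplying back what was contracted away, summed over dual bases, is the derivation extending the
  identity, that is, multiplication by the degree.\<close>

lemma euler:
  assumes q: "q \<in> ext_alg U"
  shows "\<exists>N. \<forall>n\<ge>N. (\<Sum>i\<in>J n. ext_mult (u i) (contraction (form (u' i)) q)) = derivation (\<lambda>x. x) q"
    (is "\<exists>N. \<forall>n\<ge>N. ?S n q = ?D q")
proof -
  note lin = clinear_contraction[OF form_right]
  note I = contraction_mult[OF form_right] clinear_simps[OF lin]
  note DL = clinear_simps[OF clinear_derivation[OF clinear_ident]]
  show ?thesis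
    using q
  proof (induction rule: ext_alg_induct)
    case one
    show ?case by (simp add: contraction_one[OF form_right] derivation_one[OF clinear_ident])
  next
    case (mult x q)
    then obtain N where N: "\<And>n. n \<ge> N \<Longrightarrow> ?S n q = ?D q" by blast
    have "?S n (ext_mult x q) = ?D (ext_mult x q)" if n: "n \<ge> max N (depth x)" for n
    proof -
      have "x \<in> dep n" using dep_depth[of x] dep_mono[of "depth x" n] n by auto
      then have x: "(\<Sum>i\<in>J n. form (u' i) x *\<^sub>C u i) = x"
        using recon_m[of x n] mult(1) by (simp add: U_L pm_id)
      have "?S n (ext_mult x q) = ext_mult (\<Sum>i\<in>J n. form (u' i) x *\<^sub>C u i) q + ext_mult x (?S n q)"
        by (simp add: I ext_mult_anticommute[of x] sum_negf sum_subtractf)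
      then show ?thesis using N n by (simp add: x derivation_mult[OF clinear_ident])
    qed
    then show ?case by blast
  next
    case (add a c)
    then obtain N M where "\<And>n. n \<ge> N \<Longrightarrow> ?S n a = ?D a" "\<And>n. n \<ge> M \<Longrightarrow> ?S n c = ?D c" by blast
    then have "\<forall>n\<ge>max N M. ?S n (a + c) = ?D (a + c)"
      by (simp add: I DL sum.distrib)
    then show ?case by blast
  next
    case (scale c a)
    then obtain N where "\<And>n. n \<ge> N \<Longrightarrow> ?S n a = ?D a" by blast
    then have "\<forall>n\<ge>N. ?S n (c *\<^sub>C a) = ?D (c *\<^sub>C a)"
      by (simp add: I DL cvec.scale_sum_right[symmetric])
    then show ?case by blast
  qed
qed

lemma derivation_ident:
  assumes "q \<in> ext_pow p U"
  shows "derivation (\<lambda>x. x) q = of_nat p *\<^sub>C q"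
proof -
  have 1: "(\<Sum>i<n. w) = of_nat n *\<^sub>C w" for n and w :: "'v ext"
    by (induction n) (simp_all add: cscale_add_left cscale_one add.commute)
  have "derivation (\<lambda>x. x) q - of_nat p *\<^sub>C q \<in> {0}"
  proof (rule ext_pow_linear_image[OF _ cvec.subspace_single_0 _ assms])
    show "clinear (\<lambda>q. derivation (\<lambda>x. x) q - of_nat p *\<^sub>C q)"
      by (intro cvec.linear_compose_sub clinear_derivation clinear_ident cvec.linear_compose_scale_right)
  qed (simp add: derivation_wedge[OF clinear_ident] 1)
  then show ?thesis by simp
qed

end

section \<open>Adjointness with respect to the Hermitian form\<close>

text \<open>A sesquilinear form \<open>h\<close> on \<open>U\<close> that arises from the bilinear form through a map \<open>V\<close> from \<open>U\<close> to the
  positive part that reaches all dual basis vectors. The condition \<open>h_br\<close> says that the adjoint of \<open>ad x\<close> on \<open>U\<close> is the bracket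
  with \<open>V x\<close> followed by the projection to \<open>U\<close>.\<close>

locale adjoint_triangular = triangular_lie_algebra +
  fixes h :: "'a \<Rightarrow> 'a \<Rightarrow> complex" and \<chi> :: "'a \<Rightarrow> 'a \<Rightarrow> complex" and V :: "'a \<Rightarrow> 'a"
  assumes \<chi>: "\<And>y. y \<in> U \<Longrightarrow> clinear (\<chi> y)" and h_\<chi>: "\<And>x y. x \<in> U \<Longrightarrow> y \<in> U \<Longrightarrow> h x y = \<chi> y x"
    and h_form: "\<And>x y. x \<in> U \<Longrightarrow> y \<in> U \<Longrightarrow> h x y = cnj (form (V x) y)"
    and V_L: "\<And>x. x \<in> U \<Longrightarrow> V x \<in> L" and V_pp: "\<And>x. x \<in> U \<Longrightarrow> pp (V x) = V x"
    and h_br: "\<And>x y z. x \<in> U \<Longrightarrow> y \<in> U \<Longrightarrow> z \<in> U \<Longrightarrow> h (br x y) z = h y (pm (br (V x) z))"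
    and V_surj: "\<And>i. \<exists>w\<in>U. V w = u' i"
begin

abbreviation E :: "'a ext \<Rightarrow> 'a ext \<Rightarrow> complex" where "E \<equiv> ext_hermitian U h"

lemma E_linear: "y \<in> ext_alg U \<Longrightarrow> \<exists>T. clinear T \<and> (\<forall>x\<in>ext_alg U. E x y = T x)"
  by (rule ext_hermitian_linear[OF U_subspace \<chi> h_\<chi> form_right h_form])

lemma E_one: "y \<in> ext_alg U \<Longrightarrow> E (wedge []) y = cnj (scalar_part y)"
  by (rule ext_hermitian_one[OF U_subspace \<chi> h_\<chi> form_right h_form])

lemma E_mult: "y \<in> ext_alg U \<Longrightarrow> x \<in> U \<Longrightarrow> q \<in> ext_alg U \<Longrightarrow>
    E (ext_mult x q) y = E q (contraction (form (V x)) y)"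
  by (rule ext_hermitian_mult[OF U_subspace \<chi> h_\<chi> form_right h_form])

lemma E_add_left: "y \<in> ext_alg U \<Longrightarrow> a \<in> ext_alg U \<Longrightarrow> c \<in> ext_alg U \<Longrightarrow> E (a + c) y = E a y + E c y"
  using E_linear[of y] by (auto simp: cvec.subspace_add[OF subspace_ext_alg] cvec.linear_add)

lemma E_scale_left: "y \<in> ext_alg U \<Longrightarrow> a \<in> ext_alg U \<Longrightarrow> E (c *\<^sub>C a) y = c * E a y"
  using E_linear[of y] by (auto simp: cvec.subspace_scale[OF subspace_ext_alg] clinear_complex_simps)

lemma E_neg_left: "y \<in> ext_alg U \<Longrightarrow> a \<in> ext_alg U \<Longrightarrow> E (- a) y = - E a y"
  using E_scale_left[of y a "-1"] by (simp add: cscale_one)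

lemma E_zero_left: "y \<in> ext_alg U \<Longrightarrow> E 0 y = 0"
  using E_scale_left[of y "wedge []" 0] by (simp add: wedge_in_ext_alg)

lemma E_zero_right: "q \<in> ext_alg U \<Longrightarrow> E q 0 = 0"
  by (induction rule: ext_alg_induct)
    (auto simp: E_one E_mult E_add_left E_scale_left cvec.subspace_0[OF subspace_ext_alg]
      cvec.linear_0[OF clinear_scalar_part] cvec.linear_0[OF clinear_contraction[OF form_right]])

lemma E_add_right:
  assumes "q \<in> ext_alg U" "y \<in> ext_alg U" "z \<in> ext_alg U"
  shows "E q (y + z) = E q y + E q z"
  using assms
  by (induction arbitrary: y z rule: ext_alg_induct)
    (auto simp: E_one E_mult E_add_left E_scale_left cvec.subspace_add[OF subspace_ext_alg]
      cvec.linear_add[OF clinear_scalar_part] cvec.linear_add[OF clinear_contraction[OF form_right]]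
      contraction_in_ext_alg[OF form_right] distrib_left)

lemma E_neg_right: "q \<in> ext_alg U \<Longrightarrow> y \<in> ext_alg U \<Longrightarrow> E q (- y) = - E q y"
  using E_add_right[of q y "- y"] E_zero_right[of q] cvec.subspace_neg[OF subspace_ext_alg, of y U]
  by (simp add: eq_neg_iff_add_eq_0 add.commute)

lemma contraction_derivation_commutator:
  assumes D: "clinear D'" and dual: "\<And>z. z \<in> U \<Longrightarrow> form v (D' z) = form w z" and y: "y \<in> ext_alg U"
  shows "contraction (form v) (derivation D' y) = derivation D' (contraction (form v) y) + contraction (form w) y"
proof -
  note lin = clinear_contraction[OF form_right]
  note I = contraction_mult[OF form_right] clinear_simps[OF lin]
  note dl = clinear_derivation[OF D]
  note DL = clinear_simps[OF dl]
    derivation_mult[OF D]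
  show ?thesis
    using y
    by (induction rule: ext_alg_induct)
      (simp_all add: contraction_one[OF form_right] derivation_one[OF D] I DL dual cscale_add_right)
qed

text \<open>Adjointness passes from vectors to the derivations extending them, because contraction with a vector and
  such a derivation commute up to contraction with the image of the vector.\<close>

lemma derivation_adjoint:
  assumes x: "x \<in> U" and q: "q \<in> ext_alg U" and y: "y \<in> ext_alg U"
  shows "E (derivation (br x) q) y = E q (derivation (\<lambda>z. pm (br (V x) z)) y)"
  using q y
proof (induction arbitrary: y rule: ext_alg_induct)
  let ?D' = "\<lambda>z. pm (br (V x) z)"
  note D' = clinear_pm_br(2)[of "V x"]
  have D'U: "?D' z \<in> U" if "z \<in> U" for z using that x by (intro pm_U br_L V_L U_L)
  {
    case one
    have "scalar_part (derivation ?D' y) = 0"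
      by (induction y rule: ext_induct)
       (simp_all add: derivation_mult[OF D'] derivation_one[OF D'] clinear_simps[OF clinear_derivation[OF D']] clinear_simps[OF clinear_scalar_part])
    then show ?case
      using one by (simp add: ad_one E_zero_left E_one derivation_in_ext_alg[OF D' D'U])
  next
    case (mult w q)
    note m = ext_mult_in_ext_alg derivation_in_ext_alg[OF br_right br_U] x mult(1,2,4) br_U
      derivation_in_ext_alg[OF D' D'U] contraction_in_ext_alg[OF form_right]
    have dual: "form (V w) (?D' z) = form (V (br x w)) z" if "z \<in> U" for z
    proof -
      have "cnj (form (V w) (?D' z)) = cnj (form (V (br x w)) z)"
        using h_form[OF mult(1) D'U[OF that]] h_form[OF br_U[OF x mult(1)] that] h_br[OF x mult(1) that] by simp
      then show ?thesis by (metis complex_cnj_cnj)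
    qed
    have c: "contraction (form (V w)) (derivation ?D' y) =
        derivation ?D' (contraction (form (V w)) y) + contraction (form (V (br x w))) y"
      by (rule contraction_derivation_commutator[OF D' _ mult(4)]) (rule dual)
    have "E (derivation (br x) (ext_mult w q)) y = E q (contraction (form (V (br x w))) y)
        + E (derivation (br x) q) (contraction (form (V w)) y)"
      by (simp add: ad_mult E_add_left E_mult m)
    also have "\<dots> = E q (contraction (form (V w)) (derivation ?D' y))"
      by (subst c, subst E_add_right) (simp_all add: mult(3) m)
    finally show ?case by (simp add: E_mult m)
  next
    case (add a c)
    then show ?case
      by (simp add: E_add_left op_linear x derivation_in_ext_alg[OF br_right br_U] derivation_in_ext_alg[OF D' D'U])
  next
    case (scale c a)
    then show ?case
      by (simp add: E_scale_left op_linear x derivation_in_ext_alg[OF br_right br_U] derivation_in_ext_alg[OF D' D'U])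
  }
qed

lemma dstar_in_ext_alg: "q \<in> ext_alg U \<Longrightarrow> dstar q \<in> ext_alg U"
  by (induction rule: ext_alg_induct)
    (auto simp: dstar_one dstar_mult op_linear cobracket_in_ext_alg ext_mult_in_ext_alg
      subspace_simps[OF subspace_ext_alg])

lemma bdr_in_ext_alg: "q \<in> ext_alg U \<Longrightarrow> bdr q \<in> ext_alg U"
  by (induction rule: ext_alg_induct)
    (auto simp: bdr_one bdr_mult op_linear ext_mult_in_ext_alg derivation_in_ext_alg[OF br_right br_U]
      subspace_simps[OF subspace_ext_alg])

text \<open>Induction on the first argument: \<open>{\<partial>(x \<and> q), y}\<close> equals \<open>- {\<partial> q, \<iota> y} - {q, \<theta> y}\<close>, where \<open>\<iota>\<close> is the contraction
  with \<open>V x\<close> and \<open>\<theta>\<close> the derivation extending the adjoint of \<open>ad x\<close>, and \<open>dstar_contraction\<close> identifies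
  \<open>- (dstar \<circ> \<iota>) - \<theta>\<close> with \<open>\<iota> \<circ> dstar\<close>.\<close>

theorem dstar_adjoint:
  assumes q: "q \<in> ext_alg U" and y: "y \<in> ext_alg U"
  shows "E (bdr q) y = E q (dstar y)"
  using q y
proof (induction arbitrary: y rule: ext_alg_induct)
  case one
  have "scalar_part (dstar y) = 0"
    by (induction y rule: ext_induct)
     (simp_all add: dstar_mult dstar_one op_linear cobracket_def clinear_simps[OF clinear_scalar_part])
  then show ?case using one by (simp add: bdr_one E_zero_left E_one dstar_in_ext_alg)
next
  case (mult x q)
  let ?D' = "\<lambda>z. pm (br (V x) z)"
  have D'U: "?D' z \<in> U" if "z \<in> U" for z using that mult by (intro pm_U br_L V_L U_L) auto
  note m = ext_mult_in_ext_alg mult(1,2,4) contraction_in_ext_alg[OF form_right] bdr_in_ext_alg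
    dstar_in_ext_alg derivation_in_ext_alg[OF br_right br_U] derivation_in_ext_alg[OF clinear_pm_br(2) D'U]
    subspace_simps[OF subspace_ext_alg]
  have d: "contraction (form (V x)) (dstar y) = - dstar (contraction (form (V x)) y) + (- derivation ?D' y)"
    using dstar_contraction[OF V_L[OF mult(1)] V_pp[OF mult(1)] mult(4)]
    by (simp add: algebra_simps eq_neg_iff_add_eq_0)
  have "E (bdr (ext_mult x q)) y = E (- ext_mult x (bdr q) + - derivation (br x) q) y"
    by (simp add: bdr_mult)
  also have "\<dots> = - E q (dstar (contraction (form (V x)) y)) - E q (derivation ?D' y)"
    by (subst E_add_left) (simp_all add: m E_neg_left E_mult mult(3) derivation_adjoint)
  also have "\<dots> = E q (contraction (form (V x)) (dstar y))"
    unfolding d by (subst E_add_right) (simp_all add: m E_neg_right)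
  finally show ?case by (simp add: E_mult m)
next
  case (add a c)
  then show ?case by (simp add: E_add_left op_linear bdr_in_ext_alg dstar_in_ext_alg)
next
  case (scale c a)
  then show ?case by (simp add: E_scale_left op_linear bdr_in_ext_alg dstar_in_ext_alg)
qed

text \<open>If \<open>z\<close> is orthogonal to everything of its degree, all its contractions are, hence vanish by induction;
  by Euler's formula \<open>z\<close> is then zero unless its degree is.\<close>

theorem E_nondegenerate:
  assumes "z \<in> ext_pow p U" "\<And>q. q \<in> ext_pow p U \<Longrightarrow> E q z = 0"
  shows "z = 0"
  using assms
proof (induction p arbitrary: z)
  case 0
  obtain c where c: "z = c *\<^sub>C wedge []" using 0(1) by (rule ext_pow_0E)
  have "E (wedge []) z = 0" using wedge_in_ext_pow[of "[]" U] by (intro 0(2)) simp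
  then show ?case
    using 0(1) by (simp add: E_one ext_pow_subset_ext_alg c cvec.linear_scale[OF clinear_scalar_part] cscale_complex_def)
next
  case (Suc p)
  have z: "z \<in> ext_alg U" by (rule ext_pow_subset_ext_alg[OF Suc(2)])
  have "contraction (form (u' i)) z = 0" for i
  proof (rule Suc(1))
    obtain w where w: "w \<in> U" "V w = u' i" using V_surj by blast
    show "contraction (form (u' i)) z \<in> ext_pow p U" by (rule contraction_in_ext_pow[OF form_right Suc(2)])
    fix q assume q: "q \<in> ext_pow p U"
    show "E q (contraction (form (u' i)) z) = 0"
      using Suc(3)[OF ext_mult_in_ext_pow[OF w(1) q]] E_mult[OF z w(1) ext_pow_subset_ext_alg[OF q]] w(2) by simp
  qed
  then have "derivation (\<lambda>x. x) z = 0" using euler[OF z] by auto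
  then show ?case using derivation_ident[OF Suc(2)] by (metis cvec.scale_eq_0_iff of_nat_eq_0_iff nat.distinct(1))
qed

lemma adjoint_unique:
  assumes y: "y \<in> ext_alg U" "dstar y \<in> ext_pow p U"
  shows "(THE z. z \<in> ext_pow p U \<and> (\<forall>x\<in>ext_pow p U. E (bdr x) y = E x z)) = dstar y"
proof (rule the_equality)
  show "dstar y \<in> ext_pow p U \<and> (\<forall>x\<in>ext_pow p U. E (bdr x) y = E x (dstar y))"
    using y dstar_adjoint ext_pow_subset_ext_alg by blast
  fix z assume z: "z \<in> ext_pow p U \<and> (\<forall>x\<in>ext_pow p U. E (bdr x) y = E x z)"
  have "z + - dstar y = 0"
  proof (rule E_nondegenerate)
    show "z + - dstar y \<in> ext_pow p U" using z y
      by (intro subspace_simps[OF subspace_ext_pow]) auto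
    fix q assume "q \<in> ext_pow p U"
    then show "E q (z + - dstar y) = 0"
      using z y dstar_adjoint[of q y]
      by (subst E_add_right)
        (auto simp: E_neg_right ext_pow_subset_ext_alg cvec.subspace_neg[OF subspace_ext_alg])
  qed
  then show "z = dstar y" by simp
qed

end

section \<open>Traces and the Killing form\<close>

text \<open>A finite family of vectors with coefficient functionals that reconstruct every vector. The vectors
  may be dependent, which allows systems that are assembled from projections of a basis.\<close>

definition complete_system :: "'s set \<Rightarrow> ('s \<Rightarrow> 'g::complex_vector) \<Rightarrow> ('s \<Rightarrow> 'g \<Rightarrow> complex) \<Rightarrow> bool" where
  "complete_system S e l \<longleftrightarrow> finite S \<and> (\<forall>s\<in>S. clinear (l s)) \<and> (\<forall>x. (\<Sum>s\<in>S. l s x *\<^sub>C e s) = x)"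

lemma finite_basis:
  assumes "cvec.independent (B :: 'g::complex_lie_algebra set)"
  shows "finite B"
proof -
  obtain S :: "'g set" where S: "finite S" "\<forall>x. \<exists>a. x = (\<Sum>b\<in>S. a b *\<^sub>C b)"
    using finite_dimensional by blast
  then have "B \<subseteq> cvec.span S"
    by (metis (no_types, lifting) cvec.span_base cvec.span_scale cvec.span_sum subsetI)
  then show ?thesis using cvec.independent_span_bound[OF S(1) assms] by blast
qed

text \<open>The trace of a rank-one operator \<open>x \<mapsto> l x *\<^sub>C v\<close> is \<open>l v\<close>, and a complete system writes \<open>f\<close> as a sum of
  such operators.\<close>

lemma ctrace_complete_system:
  fixes f :: "'g::complex_lie_algebra \<Rightarrow> 'g"
  assumes f: "clinear f" and S: "complete_system S e l"
  shows "ctrace f = (\<Sum>s\<in>S. l s (f (e s)))"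
proof -
  define B :: "'g set" where "B = (SOME B. cvec.independent B \<and> cvec.span B = UNIV)"
  have "\<exists>B :: 'g set. cvec.independent B \<and> cvec.span B = UNIV"
    using cvec.maximal_independent_subset[of UNIV] by (metis top.extremum_uniqueI)
  from someI_ex[OF this] have B: "cvec.independent B" "cvec.span B = UNIV" by (auto simp: B_def)
  have fin: "finite B" by (rule finite_basis[OF B(1)])
  have sum: "(\<Sum>s\<in>S. l s x *\<^sub>C e s) = x" and l: "s \<in> S \<Longrightarrow> clinear (l s)" for x s
    using S by (auto simp: complete_system_def)
  have "ctrace f = (\<Sum>b\<in>B. cvec.representation B (f b) b)"
    by (simp add: ctrace_def B_def Let_def)
  also have "\<dots> = (\<Sum>b\<in>B. \<Sum>s\<in>S. l s b * cvec.representation B (f (e s)) b)"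
  proof (intro sum.cong refl)
    fix b
    have "f b = (\<Sum>s\<in>S. l s b *\<^sub>C f (e s))"
      using sum[of b] by (metis (mono_tags, lifting) clinear_simps[OF f] sum.cong)
    then show "cvec.representation B (f b) b = (\<Sum>s\<in>S. l s b * cvec.representation B (f (e s)) b)"
      by (simp add: cvec.representation_sum B cvec.representation_scale)
  qed
  also have "\<dots> = (\<Sum>s\<in>S. \<Sum>b\<in>B. cvec.representation B (f (e s)) b * l s b)"
    by (subst sum.swap) (simp add: mult.commute)
  also have "\<dots> = (\<Sum>s\<in>S. l s (\<Sum>b\<in>B. cvec.representation B (f (e s)) b *\<^sub>C b))"
    by (intro sum.cong refl) (simp add: cvec.linear_sum[OF l] clinear_complex_simps[OF l])
  also have "\<dots> = (\<Sum>s\<in>S. l s (f (e s)))"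
    by (simp add: cvec.sum_representation_eq B fin)
  finally show ?thesis .
qed

lemma complete_system_exists:
  obtains B :: "'g::complex_lie_algebra set" and l
  where "complete_system B (\<lambda>b. b) l" "cvec.independent B"
    "\<And>x. (\<Sum>s\<in>B. l s x *\<^sub>C s) = x" "\<And>s. s \<in> B \<Longrightarrow> clinear (l s)" "finite B"
proof -
  obtain B :: "'g set" where B: "cvec.independent B" "cvec.span B = UNIV"
    using cvec.maximal_independent_subset[of UNIV] by (metis top.extremum_uniqueI)
  have "complete_system B (\<lambda>b. b) (\<lambda>b x. cvec.representation B x b)"
    unfolding complete_system_def using finite_basis[OF B(1)]
    by (auto intro!: clinearI simp: B cvec.representation_add cvec.representation_scale cscale_complex_def
        cvec.sum_representation_eq)
  then show thesis using B by (intro that) (auto simp: complete_system_def)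
qed

lemma ctrace_commute:
  fixes f :: "'g::complex_lie_algebra \<Rightarrow> 'g"
  assumes f: "clinear f" and g: "clinear g"
  shows "ctrace (\<lambda>x. f (g x)) = ctrace (\<lambda>x. g (f x))"
proof -
  obtain B :: "'g set" and l where S: "complete_system B (\<lambda>b. b) l" and ind: "cvec.independent B"
    and sum: "\<And>x. (\<Sum>s\<in>B. l s x *\<^sub>C s) = x" and l: "\<And>s. s \<in> B \<Longrightarrow> clinear (l s)" and fin: "finite B"
    by (rule complete_system_exists) (rule that)
  have e: "l s (f (g s)) = (\<Sum>t\<in>B. l t (g s) * l s (f t))"
    if "clinear f" "s \<in> B" for s and f g :: "'g \<Rightarrow> 'g"
  proof -
    have "l s (f (g s)) = l s (f (\<Sum>t\<in>B. l t (g s) *\<^sub>C t))" by (simp add: sum)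
    then show ?thesis
      by (simp add: clinear_simps[OF that(1)] cvec.linear_sum[OF l[OF that(2)]]
        clinear_complex_simps[OF l[OF that(2)]])
  qed
  have "ctrace (\<lambda>x. f (g x)) = (\<Sum>s\<in>B. \<Sum>t\<in>B. l t (g s) * l s (f t))"
    using ctrace_complete_system[OF Vector_Spaces.linear_compose[OF g f] S] e[OF f] by (simp add: o_def)
  also have "\<dots> = (\<Sum>t\<in>B. \<Sum>s\<in>B. l s (f t) * l t (g s))"
    by (subst sum.swap) (simp add: mult.commute)
  also have "\<dots> = ctrace (\<lambda>x. g (f x))"
    using ctrace_complete_system[OF Vector_Spaces.linear_compose[OF f g] S] e[OF g] by (simp add: o_def)
  finally show ?thesis .
qed

lemma ctrace_linear:
  fixes f g :: "'g::complex_lie_algebra \<Rightarrow> 'g"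
  assumes f: "clinear f" and g: "clinear g"
  shows "ctrace (\<lambda>x. f x + g x) = ctrace f + ctrace g" "ctrace (\<lambda>x. f x - g x) = ctrace f - ctrace g"
    "ctrace (\<lambda>x. c *\<^sub>C f x) = c * ctrace f"
proof -
  obtain B :: "'g set" and l where S: "complete_system B (\<lambda>b. b) l" and ind: "cvec.independent B"
    and sum: "\<And>x. (\<Sum>s\<in>B. l s x *\<^sub>C s) = x" and l: "\<And>s. s \<in> B \<Longrightarrow> clinear (l s)" and fin: "finite B"
    by (rule complete_system_exists) (rule that)
  show "ctrace (\<lambda>x. f x + g x) = ctrace f + ctrace g" "ctrace (\<lambda>x. f x - g x) = ctrace f - ctrace g"
    "ctrace (\<lambda>x. c *\<^sub>C f x) = c * ctrace f"
    by (simp_all add: ctrace_complete_system[OF _ S] f g cvec.linear_compose_add cvec.linear_compose_sub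
      cvec.linear_compose_scale_right clinear_complex_simps[OF l] sum.distrib sum_subtractf
      cvec.linear_diff[OF l] sum_distrib_left)
qed

text \<open>The images of a basis under \<open>T\<close> form a complete system whose coefficient functionals are the conjugates of
  the old ones transported by the inverse of \<open>T\<close>.\<close>

lemma ctrace_antilinear_conjugate:
  fixes f g :: "'g::complex_lie_algebra \<Rightarrow> 'g"
  assumes f: "clinear f" and g: "clinear g" and T: "antilinear_on UNIV T" and T': "antilinear_on UNIV T'"
    and inv: "\<And>x. T (T' x) = x" "\<And>x. T' (T x) = x" and conj: "\<And>x. T (f x) = g (T x)"
  shows "ctrace g = cnj (ctrace f)"
proof -
  obtain B :: "'g set" and l where S: "complete_system B (\<lambda>b. b) l" and ind: "cvec.independent B"
    and sum: "\<And>x. (\<Sum>s\<in>B. l s x *\<^sub>C s) = x" and l: "\<And>s. s \<in> B \<Longrightarrow> clinear (l s)" and fin: "finite B"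
    by (rule complete_system_exists) (rule that)
  have Ta: "T (x + y) = T x + T y" "T (c *\<^sub>C x) = cnj c *\<^sub>C T x" for x y c
    using T by (auto simp: antilinear_on_def)
  have Ta': "T' (x + y) = T' x + T' y" "T' (c *\<^sub>C x) = cnj c *\<^sub>C T' x" for x y c
    using T' by (auto simp: antilinear_on_def)
  have T0: "T 0 = 0" using Ta(2)[of 0 0] by simp
  have Ts: "finite A \<Longrightarrow> T (\<Sum>s\<in>A. h s) = (\<Sum>s\<in>A. T (h s))" for A and h :: "'g \<Rightarrow> 'g"
    by (induction A rule: finite_induct) (simp_all add: T0 Ta)
  have "complete_system B T (\<lambda>b x. cnj (l b (T' x)))"
    unfolding complete_system_def
  proof (intro conjI ballI allI fin)
    fix s assume "s \<in> B"
    then show "clinear (\<lambda>x. cnj (l s (T' x)))"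
      by (intro clinearI) (simp_all add: Ta' clinear_complex_simps[OF l] cscale_complex_def)
  next
    fix x
    have "(\<Sum>s\<in>B. cnj (l s (T' x)) *\<^sub>C T s) = T (\<Sum>s\<in>B. l s (T' x) *\<^sub>C s)"
      by (simp add: Ts fin Ta)
    then show "(\<Sum>s\<in>B. cnj (l s (T' x)) *\<^sub>C T s) = x" by (simp add: sum inv)
  qed
  from ctrace_complete_system[OF g this] show ?thesis
    by (simp add: conj[symmetric] inv ctrace_complete_system[OF f S])
qed

lemma lie_skew: "lie x y = - lie y (x::'g::complex_lie_algebra)"
proof -
  have "lie x x + lie y x + (lie x y + lie y y) = 0"
    using lie_self[of "x + y"] unfolding lie_add_left lie_add_right .
  then show ?thesis by (simp add: lie_self eq_neg_iff_add_eq_0 add.commute)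
qed

lemma clinear_lie: "clinear (lie (x::'g::complex_lie_algebra))" "clinear (\<lambda>x. lie x (y::'g))"
  by (auto intro!: clinearI simp: lie_add_left lie_add_right lie_cscale_left lie_cscale_right)

lemmas lie_linear = clinear_simps[OF clinear_lie(1)] clinear_simps[OF clinear_lie(2)]
  lie_add_left lie_add_right lie_cscale_left lie_cscale_right

lemma lie_derivation: "lie x (lie y z) = lie (lie x y) z + lie y (lie x (z::'g::complex_lie_algebra))"
proof -
  have "lie x (lie y z) = - lie y (lie z x) - lie z (lie x y)"
    using lie_jacobi[of x y z] by (simp add: algebra_simps eq_neg_iff_add_eq_0)
  also have "\<dots> = lie y (lie x z) + lie (lie x y) z"
    by (simp add: lie_skew[of z] lie_linear)
  finally show ?thesis by (simp add: add.commute)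
qed

lemma clinear_lie_lie: "clinear (\<lambda>z. lie x (lie y (z::'g::complex_lie_algebra)))"
  using Vector_Spaces.linear_compose[OF clinear_lie(1) clinear_lie(1)] by (simp add: o_def)

lemma killing_sym: "killing x y = killing y (x::'g::complex_lie_algebra)"
  unfolding killing_def by (rule ctrace_commute[OF clinear_lie(1) clinear_lie(1)])

lemma clinear_killing: "clinear (\<lambda>x. killing x (y::'g::complex_lie_algebra))" "clinear (killing (y::'g))"
proof -
  show 1: "clinear (\<lambda>x. killing x (y::'g))" for y
    unfolding killing_def
    by (rule clinearI) (simp_all add: lie_add_left lie_cscale_left ctrace_linear[OF clinear_lie_lie clinear_lie_lie]
       cscale_complex_def)
  have "killing y = (\<lambda>x. killing x y)" using killing_sym by blast
  then show "clinear (killing y)" using 1 by simp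
qed

lemmas killing_add = cvec.linear_add[OF clinear_killing(1)] cvec.linear_add[OF clinear_killing(2)]

lemmas killing_linear = clinear_simps[OF clinear_killing(1)] clinear_simps[OF clinear_killing(2)]
  cscale_complex_def

lemma killing_invariant: "killing (lie x y) z = killing x (lie y (z::'g::complex_lie_algebra))"
proof -
  have c: "clinear (\<lambda>w. lie x (lie y (lie z w)))" for x y z :: 'g
    using Vector_Spaces.linear_compose[OF clinear_lie_lie clinear_lie(1)] by (simp add: o_def)
  have 1: "lie (lie x y) w = lie x (lie y w) - lie y (lie x w)" for x y w :: 'g
    using lie_derivation[of x y w] by (simp add: algebra_simps)
  have "killing (lie x y) z = ctrace (\<lambda>w. lie x (lie y (lie z w))) - ctrace (\<lambda>w. lie y (lie x (lie z w)))"
    unfolding killing_def 1 by (rule ctrace_linear(2)[OF c c])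
  also have "ctrace (\<lambda>w. lie y (lie x (lie z w))) = ctrace (\<lambda>w. lie x (lie z (lie y w)))"
    by (rule ctrace_commute[OF clinear_lie(1) clinear_lie_lie])
  also have "ctrace (\<lambda>w. lie x (lie y (lie z w))) - \<dots> = killing x (lie y z)"
    unfolding killing_def 1 lie_linear by (rule ctrace_linear(2)[OF c c, symmetric])
  finally show ?thesis .
qed

locale involutive_lie =
  fixes \<sigma> :: "'g::complex_lie_algebra \<Rightarrow> 'g"
  assumes semisimple: "semisimple TYPE('g)" and involutive: "involutive_automorphism \<sigma>"
begin

lemma clinear_\<sigma>: "clinear \<sigma>" and \<sigma>_lie: "\<sigma> (lie x y) = lie (\<sigma> x) (\<sigma> y)" and \<sigma>_\<sigma>: "\<sigma> (\<sigma> x) = x"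
  using involutive by (auto simp: involutive_automorphism_def clinear_iff_clinear_on)

lemmas \<sigma>_linear = clinear_simps[OF clinear_\<sigma>]

lemma killing_\<sigma>: "killing (\<sigma> x) (\<sigma> y) = killing x y"
proof -
  obtain B :: "'g set" and l where S: "complete_system B (\<lambda>b. b) l" and ind: "cvec.independent B"
    and sum: "\<And>x. (\<Sum>s\<in>B. l s x *\<^sub>C s) = x" and l: "\<And>s. s \<in> B \<Longrightarrow> clinear (l s)" and fin: "finite B"
    by (rule complete_system_exists) (rule that)
  have "complete_system B \<sigma> (\<lambda>b x. l b (\<sigma> x))"
    unfolding complete_system_def
  proof (intro conjI ballI allI fin)
    fix s assume "s \<in> B"
    then show "clinear (\<lambda>x. l s (\<sigma> x))"
      using Vector_Spaces.linear_compose[OF clinear_\<sigma> l] by (simp add: o_def)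
  next
    fix x
    have "(\<Sum>s\<in>B. l s (\<sigma> x) *\<^sub>C \<sigma> s) = \<sigma> (\<Sum>s\<in>B. l s (\<sigma> x) *\<^sub>C s)"
      by (simp add: cvec.linear_sum[OF clinear_\<sigma>] \<sigma>_linear)
    then show "(\<Sum>s\<in>B. l s (\<sigma> x) *\<^sub>C \<sigma> s) = x" by (simp add: sum \<sigma>_\<sigma>)
  qed
  from ctrace_complete_system[OF clinear_lie_lie this, of "\<sigma> x" "\<sigma> y"]
  show ?thesis unfolding killing_def ctrace_complete_system[OF clinear_lie_lie S]
    by (simp add: \<sigma>_lie[symmetric] \<sigma>_\<sigma>)
qed

abbreviation "k_part \<equiv> fix_part \<sigma>"
abbreviation "p_part \<equiv> anti_part \<sigma>"

lemma subspace_parts: "cvec.subspace k_part" "cvec.subspace p_part"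
  by (auto intro!: cvec.subspaceI simp: fix_part_def anti_part_def \<sigma>_linear)

lemma lie_parts:
  "x \<in> k_part \<Longrightarrow> y \<in> k_part \<Longrightarrow> lie x y \<in> k_part" "x \<in> k_part \<Longrightarrow> y \<in> p_part \<Longrightarrow> lie x y \<in> p_part"
  "x \<in> p_part \<Longrightarrow> y \<in> k_part \<Longrightarrow> lie x y \<in> p_part" "x \<in> p_part \<Longrightarrow> y \<in> p_part \<Longrightarrow> lie x y \<in> k_part"
  by (auto simp: fix_part_def anti_part_def \<sigma>_lie lie_linear)

lemma killing_orthogonal: "x \<in> k_part \<Longrightarrow> y \<in> p_part \<Longrightarrow> killing x y = 0" "x \<in> p_part \<Longrightarrow> y \<in> k_part \<Longrightarrow> killing x y = 0"
proof -
  show 1: "killing x y = 0" if "x \<in> k_part" "y \<in> p_part" for x y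
    using killing_\<sigma>[of x y] that by (simp add: fix_part_def anti_part_def killing_linear)
  then show "x \<in> p_part \<Longrightarrow> y \<in> k_part \<Longrightarrow> killing x y = 0" using killing_sym by metis
qed

definition Pk :: "'g \<Rightarrow> 'g" where "Pk x = (1/2) *\<^sub>C (x + \<sigma> x)"
definition Pp :: "'g \<Rightarrow> 'g" where "Pp x = (1/2) *\<^sub>C (x - \<sigma> x)"

lemma Pk_in: "Pk x \<in> k_part" and Pp_in: "Pp x \<in> p_part"
  by (auto simp: Pk_def Pp_def fix_part_def anti_part_def \<sigma>_linear \<sigma>_\<sigma> add.commute
    cvec.scale_minus_right[symmetric] simp del: cvec.scale_minus_right)

lemma Pk_Pp: "Pk x + Pp x = x"
proof -
  have "Pk x + Pp x = (1/2) *\<^sub>C x + (1/2) *\<^sub>C x"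
    by (simp add: Pk_def Pp_def cscale_add_right cvec.scale_right_diff_distrib)
  then show ?thesis by (simp add: cscale_add_left[symmetric] cscale_one)
qed

lemma clinear_Pk: "clinear Pk" and clinear_Pp: "clinear Pp"
  by (auto intro!: clinearI simp: Pk_def Pp_def \<sigma>_linear cscale_add_right cvec.scale_right_diff_distrib
    cscale_cscale mult.commute)

lemma Pk_Pp_parts: "x \<in> k_part \<Longrightarrow> Pk x = x" "x \<in> k_part \<Longrightarrow> Pp x = 0" "x \<in> p_part \<Longrightarrow> Pk x = 0" "x \<in> p_part \<Longrightarrow> Pp x = x"
  using Pk_Pp[of x] by (auto simp: Pk_def Pp_def fix_part_def anti_part_def)

end

locale involutive_lie_dual = involutive_lie \<sigma> for \<sigma> :: "'g::complex_lie_algebra \<Rightarrow> 'g" +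
  fixes I :: "'i set" and b b' :: "'i \<Rightarrow> 'g"
  assumes dual: "dual_bases (fix_part \<sigma>) I b b'"
begin

lemma finite_I: "finite I" and b_in: "i \<in> I \<Longrightarrow> b i \<in> k_part" and b'_in: "i \<in> I \<Longrightarrow> b' i \<in> k_part"
  and b_b': "i \<in> I \<Longrightarrow> j \<in> I \<Longrightarrow> killing (b i) (b' j) = (if i = j then 1 else 0)"
proof -
  show "finite I" using dual by (simp add: dual_bases_def)
  show "b i \<in> k_part" if "i \<in> I" using dual cvec.span_base[of "b i" "b ` I"] that by (auto simp: dual_bases_def)
  show "b' i \<in> k_part" if "i \<in> I" using dual cvec.span_base[of "b' i" "b' ` I"] that by (auto simp: dual_bases_def)
  show "killing (b i) (b' j) = (if i = j then 1 else 0)" if "i \<in> I" "j \<in> I"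
    using dual that by (simp add: dual_bases_def)
qed

lemma k_part_expand:
  assumes "x \<in> k_part"
  shows "(\<Sum>i\<in>I. killing (b' i) x *\<^sub>C b i) = x" "(\<Sum>i\<in>I. killing (b i) x *\<^sub>C b' i) = x"
proof -
  have "x \<in> cvec.span (b ` I)" "x \<in> cvec.span (b' ` I)" using assms dual by (auto simp: dual_bases_def)
  have inj: "inj_on b I" "inj_on b' I" using dual by (auto simp: dual_bases_def)
  have ex: "\<exists>c. x = (\<Sum>i\<in>I. c i *\<^sub>C e i)" if x: "x \<in> cvec.span (e ` I)" and e: "inj_on e I" for e :: "'i \<Rightarrow> 'g"
  proof -
    obtain c where "x = (\<Sum>v\<in>e ` I. c v *\<^sub>C v)"
      using x unfolding cvec.span_finite[OF finite_imageI[OF finite_I]] by (rule rangeE)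
    then show ?thesis by (intro exI[of _ "\<lambda>i. c (e i)"]) (simp add: sum.reindex e)
  qed
  obtain c where c: "x = (\<Sum>i\<in>I. c i *\<^sub>C b i)" using ex \<open>x \<in> cvec.span (b ` I)\<close> inj by blast
  obtain d where d: "x = (\<Sum>i\<in>I. d i *\<^sub>C b' i)" using ex \<open>x \<in> cvec.span (b' ` I)\<close> inj by blast
  have "killing (b' i) x = c i" if "i \<in> I" for i
    unfolding c killing_sym[of "b' i"] by (simp add: killing_linear b_b' that finite_I if_distrib cong: if_cong)
  then show "(\<Sum>i\<in>I. killing (b' i) x *\<^sub>C b i) = x" using c by simp
  have "killing (b i) x = d i" if "i \<in> I" for i
    unfolding d by (simp add: killing_linear b_b' that finite_I if_distrib cong: if_cong)
  then show "(\<Sum>i\<in>I. killing (b i) x *\<^sub>C b' i) = x" using d by simp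
qed

text \<open>The dual bases show that the radical of the Killing form meets the fixed part trivially. Since it is
  stable under \<open>\<sigma>\<close>, it lies in the anti-fixed part, so brackets of its elements lie in the fixed part and
  in the radical and vanish. An abelian ideal is solvable, hence zero by semisimplicity.\<close>

lemma killing_nondegenerate:
  fixes x :: 'g
  assumes "\<And>y. killing x y = 0"
  shows "x = 0"
proof -
  define R :: "'g set" where "R = {x. \<forall>y. killing x y = 0}"
  have k: "x = 0" if "x \<in> R" "x \<in> k_part" for x
    using k_part_expand(1)[OF that(2)] that(1) by (simp add: R_def killing_sym[of _ x])
  have sub: "cvec.subspace R" by (auto intro!: cvec.subspaceI simp: R_def killing_linear)
  have ideal: "lie x y \<in> R" if "y \<in> R" for x y
    using that killing_invariant[of y x] by (auto simp: R_def lie_skew[of x] killing_linear)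
  have p: "x \<in> p_part" if "x \<in> R" for x
  proof -
    have "killing (\<sigma> x) y = 0" for y using that killing_\<sigma>[of x "\<sigma> y"] by (simp add: R_def \<sigma>_\<sigma>)
    then have "x + \<sigma> x \<in> R" using that by (simp add: R_def killing_linear)
    then have "x + \<sigma> x = 0" by (rule k) (simp add: fix_part_def \<sigma>_linear \<sigma>_\<sigma> add.commute)
    then show ?thesis by (simp add: anti_part_def eq_neg_iff_add_eq_0 add.commute)
  qed
  have "lie x y = 0" if "x \<in> R" "y \<in> R" for x y
    by (rule k[OF ideal[OF that(2)] lie_parts(4)[OF p[OF that(1)] p[OF that(2)]]])
  then have "lie_set R R = {0}"
  proof -
    have "{lie x y | x y. x \<in> R \<and> y \<in> R} = {0}"
      using \<open>\<And>x y. x \<in> R \<Longrightarrow> y \<in> R \<Longrightarrow> lie x y = 0\<close> cvec.subspace_0[OF sub] by force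
    then show ?thesis by (simp add: lie_set_def)
  qed
  then have "((\<lambda>A. lie_set A A) ^^ 1) R = {0}" by simp
  then have "R = {0}"
    using semisimple sub ideal unfolding semisimple_def lie_solvable_def lie_ideal_def by blast
  moreover have "x \<in> R" using assms by (simp add: R_def)
  ultimately show ?thesis by blast
qed

lemma killing_representation:
  fixes \<phi> :: "'g \<Rightarrow> complex"
  assumes \<phi>: "clinear \<phi>"
  shows "\<exists>v. \<forall>x. \<phi> x = killing v x"
proof -
  obtain B :: "'g set" and l where S: "complete_system B (\<lambda>b. b) l" and ind: "cvec.independent B"
    and sum: "\<And>x. (\<Sum>s\<in>B. l s x *\<^sub>C s) = x" and l: "\<And>s. s \<in> B \<Longrightarrow> clinear (l s)" and fin: "finite B"
    by (rule complete_system_exists) (rule that)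
  have span: "cvec.span B = UNIV"
    using sum by (metis (no_types, lifting) UNIV_eq_I cvec.span_base cvec.span_scale cvec.span_sum)
  interpret F: finite_dimensional_vector_space "cscale :: complex \<Rightarrow> 'g \<Rightarrow> 'g" B
    by unfold_locales (use fin ind span in auto)
  have zero: "c s = 0" if "(\<Sum>s\<in>B. c s *\<^sub>C s) = 0" "s \<in> B" for c s
    using ind that fin by (metis cvec.independentD subset_refl)
  have ext: "\<psi> x = (\<Sum>s\<in>B. l s x * \<psi> s)" if "clinear \<psi>" for \<psi> :: "'g \<Rightarrow> complex" and x
  proof -
    have "\<psi> x = \<psi> (\<Sum>s\<in>B. l s x *\<^sub>C s)" by (simp add: sum)
    then show ?thesis by (simp add: cvec.linear_sum[OF that] clinear_complex_simps[OF that])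
  qed
  define T where "T = (\<lambda>x. \<Sum>s\<in>B. killing x s *\<^sub>C s)"
  have T: "clinear T"
    by (auto intro!: clinearI simp: T_def killing_linear cscale_add_left sum.distrib cscale_cscale cvec.scale_sum_right)
  have "inj T"
  proof (rule injI)
    fix x y assume "T x = T y"
    then have "T (x - y) = 0" by (simp add: cvec.linear_diff[OF T])
    then have "killing (x - y) s = 0" if "s \<in> B" for s using zero[OF _ that] by (simp add: T_def)
    then have "killing (x - y) z = 0" for z by (subst ext[OF clinear_killing(2)]) simp
    then have "x - y = 0" by (rule killing_nondegenerate)
    then show "x = y" by simp
  qed
  then have "surj T" by (rule F.linear_inj_imp_surj[OF T])
  then obtain v where v: "T v = (\<Sum>s\<in>B. \<phi> s *\<^sub>C s)" by (metis surjD)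
  then have "(\<Sum>s\<in>B. (killing v s - \<phi> s) *\<^sub>C s) = 0"
    by (simp add: T_def cvec.scale_left_diff_distrib sum_subtractf)
  then have "killing v s = \<phi> s" if "s \<in> B" for s using zero[OF _ that, of "\<lambda>s. killing v s - \<phi> s"] by simp
  then have "\<phi> x = killing v x" for x
    by (subst ext[OF \<phi>], subst ext[OF clinear_killing(2)]) simp
  then show ?thesis by blast
qed

text \<open>Dual families for the anti-fixed part, obtained by projecting a basis of the whole algebra and the
  vectors that represent its coordinate functionals.\<close>

lemma p_part_system_exists:
  "\<exists>B (e :: 'g \<Rightarrow> 'g) e'. finite B \<and> (\<forall>s. e s \<in> p_part \<and> e' s \<in> p_part) \<and>
    (\<forall>x\<in>p_part. (\<Sum>s\<in>B. killing (e' s) x *\<^sub>C e s) = x) \<and> (\<forall>x\<in>p_part. (\<Sum>s\<in>B. killing (e s) x *\<^sub>C e' s) = x)"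
proof -
  obtain B :: "'g set" and l where S: "complete_system B (\<lambda>b. b) l" and ind: "cvec.independent B"
    and sum: "\<And>x. (\<Sum>s\<in>B. l s x *\<^sub>C s) = x" and l: "\<And>s. s \<in> B \<Longrightarrow> clinear (l s)" and fin: "finite B"
    by (rule complete_system_exists) (rule that)
  have "\<forall>s. \<exists>v. s \<in> B \<longrightarrow> (\<forall>x. l s (Pp x) = killing v x)"
    using killing_representation[OF Vector_Spaces.linear_compose[OF clinear_Pp l]] by (auto simp: o_def)
  then obtain v where v: "s \<in> B \<Longrightarrow> l s (Pp x) = killing (v s) x" for s x by metis
  have orth: "killing (Pp y) x = killing y x" if "x \<in> p_part" for x y
    using killing_orthogonal(1)[OF Pk_in that, of y] Pk_Pp[of y] by (metis add_0 killing_add(1))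
  have 1: "(\<Sum>s\<in>B. killing (Pp (v s)) x *\<^sub>C Pp s) = x" if x: "x \<in> p_part" for x
  proof -
    have "(\<Sum>s\<in>B. killing (Pp (v s)) x *\<^sub>C Pp s) = (\<Sum>s\<in>B. l s (Pp x) *\<^sub>C Pp s)"
      by (intro sum.cong refl) (simp add: orth[OF x] v)
    also have "\<dots> = Pp (\<Sum>s\<in>B. l s (Pp x) *\<^sub>C s)"
      by (simp add: clinear_simps[OF clinear_Pp])
    finally show ?thesis using x by (simp add: sum Pk_Pp_parts)
  qed
  have 2: "(\<Sum>s\<in>B. killing (Pp s) x *\<^sub>C Pp (v s)) = x" if x: "x \<in> p_part" for x
  proof -
    let ?z = "(\<Sum>s\<in>B. killing (Pp s) x *\<^sub>C Pp (v s))"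
    have z: "?z - x \<in> p_part"
      by (intro subspace_simps[OF subspace_parts(2)] Pp_in x)
    have y: "killing (?z - x) y = 0" if y: "y \<in> p_part" for y
    proof -
      have "killing ?z y = killing (\<Sum>s\<in>B. killing (Pp (v s)) y *\<^sub>C Pp s) x"
        by (simp add: killing_linear mult.commute)
      then show ?thesis by (simp add: 1[OF y] killing_linear killing_sym[of y])
    qed
    have "killing (?z - x) y = 0" for y
      using y[OF Pp_in[of y]] killing_orthogonal(2)[OF z Pk_in[of y]] Pk_Pp[of y]
      by (metis add_0 killing_add(2))
    then show ?thesis using killing_nondegenerate[of "?z - x"] by simp
  qed
  show ?thesis
    by (intro exI[of _ B] exI[of _ Pp] exI[of _ "\<lambda>s. Pp (v s)"]) (auto simp: fin Pp_in 1 2)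
qed

end

section \<open>Loop algebras\<close>

lemma poly_mapping_single_induct [case_names zero single add]:
  fixes f :: "'a \<Rightarrow>\<^sub>0 'b::ab_group_add"
  assumes "P 0" "\<And>r a. P (Poly_Mapping.single r a)" "\<And>f g. P f \<Longrightarrow> P g \<Longrightarrow> P (f + g)"
  shows "P f"
proof (induction f rule: update_induct)
  case const
  then show ?case using assms(1) .
next
  case (update f a b)
  have "Poly_Mapping.lookup f a = 0" using update(1) by (simp add: in_keys_iff)
  then have "Poly_Mapping.update a b f = f + Poly_Mapping.single a b"
    by (intro poly_mapping_eqI) (auto simp: lookup_update lookup_add lookup_single when_def)
  then show ?case using update assms by simp
qed

lemma poly_mapping_sum_single:
  "finite S \<Longrightarrow> Poly_Mapping.keys f \<subseteq> S \<Longrightarrow> (\<Sum>r\<in>S. Poly_Mapping.single r (Poly_Mapping.lookup f r)) = f"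
  by (intro poly_mapping_eqI) (auto simp: lookup_sum lookup_single when_def in_keys_iff)

lemma lookup_cscale [simp]: "Poly_Mapping.lookup (c *\<^sub>C f) r = c *\<^sub>C Poly_Mapping.lookup f r"
  by (simp add: cscale_poly_mapping.rep_eq)

lemma single_cscale: "Poly_Mapping.single r (c *\<^sub>C a) = c *\<^sub>C Poly_Mapping.single r a"
  by (intro poly_mapping_eqI) (simp add: lookup_single when_def)

abbreviation coef :: "(real \<Rightarrow>\<^sub>0 'g::complex_lie_algebra) \<times> complex \<times> complex \<Rightarrow> real \<Rightarrow> 'g" where
  "coef z r \<equiv> Poly_Mapping.lookup (fst z) r"

lemma loop_bracket_superset:
  assumes "finite S" "finite T" "Poly_Mapping.keys x \<subseteq> S" "Poly_Mapping.keys y \<subseteq> T"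
  shows "loop_bracket x y = (\<Sum>r\<in>S. \<Sum>s\<in>T.
     Poly_Mapping.single (r + s) (lie (Poly_Mapping.lookup x r) (Poly_Mapping.lookup y s)))"
proof -
  have "loop_bracket x y = (\<Sum>r\<in>Poly_Mapping.keys x. \<Sum>s\<in>T.
     Poly_Mapping.single (r + s) (lie (Poly_Mapping.lookup x r) (Poly_Mapping.lookup y s)))"
    unfolding loop_bracket_def
    by (intro sum.cong refl sum.mono_neutral_left) (use assms in \<open>auto simp: in_keys_iff\<close>)
  also have "\<dots> = (\<Sum>r\<in>S. \<Sum>s\<in>T.
     Poly_Mapping.single (r + s) (lie (Poly_Mapping.lookup x r) (Poly_Mapping.lookup y s)))"
    by (intro sum.mono_neutral_left) (use assms in \<open>auto simp: in_keys_iff\<close>)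
  finally show ?thesis .
qed

lemma keys_cscale: "Poly_Mapping.keys (c *\<^sub>C f) \<subseteq> Poly_Mapping.keys f"
  by (auto simp: in_keys_iff)

lemma clinear_loop_bracket: "clinear (\<lambda>x. loop_bracket x y)" "clinear (loop_bracket y)"
proof -
  note k = Poly_Mapping.keys_add keys_cscale
  show "clinear (\<lambda>x. loop_bracket x y)"
  proof (rule clinearI)
    fix x z :: "real \<Rightarrow>\<^sub>0 'a" and c
    let ?S = "Poly_Mapping.keys x \<union> Poly_Mapping.keys z"
    let ?T = "Poly_Mapping.keys y"
    show "loop_bracket (x + z) y = loop_bracket x y + loop_bracket z y"
      using Poly_Mapping.keys_add[of x z]
      by (simp add: loop_bracket_superset[of ?S ?T] lookup_add lie_add_left single_add sum.distrib)
    show "loop_bracket (c *\<^sub>C x) y = c *\<^sub>C loop_bracket x y"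
      using keys_cscale[of c x]
      by (simp add: loop_bracket_superset[of "Poly_Mapping.keys x" ?T] lie_cscale_left single_cscale cvec.scale_sum_right)
  qed
  show "clinear (loop_bracket y)"
  proof (rule clinearI)
    fix x z :: "real \<Rightarrow>\<^sub>0 'a" and c
    let ?S = "Poly_Mapping.keys x \<union> Poly_Mapping.keys z"
    let ?T = "Poly_Mapping.keys y"
    show "loop_bracket y (x + z) = loop_bracket y x + loop_bracket y z"
      using Poly_Mapping.keys_add[of x z]
      by (simp add: loop_bracket_superset[of ?T ?S] lookup_add lie_add_right single_add sum.distrib)
    show "loop_bracket y (c *\<^sub>C x) = c *\<^sub>C loop_bracket y x"
      using keys_cscale[of c x]
      by (simp add: loop_bracket_superset[of ?T "Poly_Mapping.keys x"] lie_cscale_right single_cscale cvec.scale_sum_right)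
  qed
qed

lemmas loop_bracket_linear =
  clinear_simps[OF clinear_loop_bracket(1)] clinear_simps[OF clinear_loop_bracket(2)]

lemma loop_bracket_single:
  "loop_bracket (Poly_Mapping.single r a) (Poly_Mapping.single s c) = Poly_Mapping.single (r + s) (lie a c)"
  by (simp add: loop_bracket_superset[of "{r}" "{s}"])

lemma loop_bracket_skew: "loop_bracket x y = - loop_bracket y x"
proof (induction x rule: poly_mapping_single_induct)
  case (single r a)
  show ?case
    by (induction y rule: poly_mapping_single_induct)
      (simp_all add: loop_bracket_linear loop_bracket_single lie_skew[of a] single_uminus add.commute)
qed (simp_all add: loop_bracket_linear)

lemma loop_bracket_jacobi:
  "loop_bracket x (loop_bracket y z) = loop_bracket (loop_bracket x y) z + loop_bracket y (loop_bracket x z)"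
proof (induction x rule: poly_mapping_single_induct)
  case (single r a)
  show ?case
  proof (induction y rule: poly_mapping_single_induct)
    case (single s c)
    show ?case
      by (induction z rule: poly_mapping_single_induct)
        (simp_all add: loop_bracket_linear loop_bracket_single lie_derivation[of a c] single_add algebra_simps)
  qed (simp_all add: loop_bracket_linear)
qed (simp_all add: loop_bracket_linear)

definition loop_form :: "(real \<Rightarrow>\<^sub>0 'g::complex_lie_algebra) \<Rightarrow> (real \<Rightarrow>\<^sub>0 'g) \<Rightarrow> complex" where
  "loop_form x y = (\<Sum>r\<in>Poly_Mapping.keys x. killing (Poly_Mapping.lookup x r) (Poly_Mapping.lookup y (- r)))"

lemma loop_form_superset:
  assumes "finite S" "Poly_Mapping.keys x \<subseteq> S"
  shows "loop_form x y = (\<Sum>r\<in>S. killing (Poly_Mapping.lookup x r) (Poly_Mapping.lookup y (- r)))"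
  unfolding loop_form_def
  by (intro sum.mono_neutral_left) (use assms in \<open>auto simp: in_keys_iff\<close>)

lemma clinear_loop_form: "clinear (\<lambda>x. loop_form x y)" "clinear (loop_form y)"
proof -
  show "clinear (\<lambda>x. loop_form x y)"
  proof (rule clinearI)
    fix x z :: "real \<Rightarrow>\<^sub>0 'a" and c
    let ?S = "Poly_Mapping.keys x \<union> Poly_Mapping.keys z"
    show "loop_form (x + z) y = loop_form x y + loop_form z y"
      using Poly_Mapping.keys_add[of x z]
      by (simp add: loop_form_superset[of ?S] lookup_add killing_linear sum.distrib)
    show "loop_form (c *\<^sub>C x) y = c *\<^sub>C loop_form x y"
      using keys_cscale[of c x]
      by (simp add: loop_form_superset[of "Poly_Mapping.keys x"] killing_linear cscale_complex_def sum_distrib_left)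
  qed
  show "clinear (loop_form y)"
    by (rule clinearI)
      (simp_all add: loop_form_def lookup_add killing_linear sum.distrib cscale_complex_def sum_distrib_left)
qed

lemmas loop_form_linear = cscale_complex_def
  clinear_simps[OF clinear_loop_form(1)] clinear_simps[OF clinear_loop_form(2)]

lemma loop_form_single_left: "loop_form (Poly_Mapping.single r a) y = killing a (Poly_Mapping.lookup y (- r))"
  by (simp add: loop_form_superset[of "{r}"])

lemma loop_form_sym: "loop_form x y = loop_form y x"
proof (induction x rule: poly_mapping_single_induct)
  case (single r a)
  show ?case
    by (induction y rule: poly_mapping_single_induct)
      (auto simp: loop_form_linear loop_form_single_left lookup_single when_def killing_sym[of a])
qed (simp_all add: loop_form_linear)

lemma loop_form_invariant: "loop_form (loop_bracket x y) z = loop_form x (loop_bracket y z)"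
proof (induction x rule: poly_mapping_single_induct)
  case (single r a)
  show ?case
  proof (induction y rule: poly_mapping_single_induct)
    case (single s c)
    show ?case
      by (induction z rule: poly_mapping_single_induct)
        (auto simp: loop_form_linear loop_bracket_linear loop_bracket_single loop_form_single_left
          lookup_single when_def killing_invariant)
  qed (simp_all add: loop_form_linear loop_bracket_linear)
qed (simp_all add: loop_form_linear loop_bracket_linear)

lift_definition restrict_degrees :: "(real \<Rightarrow> bool) \<Rightarrow> (real \<Rightarrow>\<^sub>0 'a::zero) \<Rightarrow> (real \<Rightarrow>\<^sub>0 'a)"
  is "\<lambda>P f r. if P r then f r else 0"
  by (rule finite_subset[rotated]) auto

text \<open>The bracket of the loop algebra, as an operation on the affine algebra that forgets the components along
  \<open>c\<close> and \<open>d\<close>. On \<open>u_minus\<close> it agrees with the affine bracket, and unlike that one it makes the bilinear form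
  below invariant on the whole type.\<close>

definition lbracket :: "'g::complex_lie_algebra affine \<Rightarrow> 'g affine \<Rightarrow> 'g affine" where
  "lbracket x y = (loop_bracket (fst x) (fst y), 0, 0)"

text \<open>The bilinear form of the loop algebra, again ignoring the components along \<open>c\<close> and \<open>d\<close>.\<close>

definition lform :: "'g::complex_lie_algebra affine \<Rightarrow> 'g affine \<Rightarrow> complex" where
  "lform x y = loop_form (fst x) (fst y)"

definition proj :: "(real \<Rightarrow> bool) \<Rightarrow> 'g::complex_lie_algebra affine \<Rightarrow> 'g affine" where
  "proj P x = (restrict_degrees P (fst x), 0, 0)"

lemma affine_eqI:
  "(\<And>r. coef x r = coef y r) \<Longrightarrow> fst (snd x) = fst (snd y) \<Longrightarrow> snd (snd x) = snd (snd y) \<Longrightarrow> x = y"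
  by (auto simp: prod_eq_iff intro: poly_mapping_eqI)

lemma affine_simps [simp]: "fst (c *\<^sub>C x) = c *\<^sub>C fst x" "snd (c *\<^sub>C x) = c *\<^sub>C snd x"
  by (simp_all add: cscale_prod_def)

lemma coef_t_pow [simp]: "coef (t_pow r x) s = (if s = r then x else 0)" "snd (t_pow r x) = 0"
  by (auto simp: t_pow_def lookup_single when_def zero_prod_def)

lemma coef_proj [simp]: "coef (proj P x) r = (if P r then coef x r else 0)" "snd (proj P x) = 0"
  by (simp_all add: proj_def restrict_degrees.rep_eq zero_prod_def)

lemma lbracket_snd [simp]: "snd (lbracket x y) = 0" by (simp add: lbracket_def zero_prod_def)

lemma clinear_proj: "clinear (proj P)"
  by (rule clinearI) (auto intro!: affine_eqI simp: lookup_add)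

lemma clinear_lbracket: "clinear (\<lambda>x. lbracket x y)" "clinear (lbracket y)"
  by (auto intro!: clinearI simp: lbracket_def loop_bracket_linear prod_eq_iff)

lemma clinear_lform: "clinear (\<lambda>x. lform x y)" "clinear (lform y)"
  by (auto intro!: clinearI simp: lform_def loop_form_linear cscale_complex_def)

lemma clinear_t_pow: "clinear (t_pow r)"
  by (auto intro!: clinearI affine_eqI simp: lookup_add)

lemma lform_t_pow: "lform (t_pow r x) y = killing x (coef y (- r))"
  by (simp add: lform_def t_pow_def loop_form_single_left)

lemma coef_lbracket_nonzero:
  assumes "coef (lbracket x y) r \<noteq> 0"
  obtains s t where "r = s + t" "coef x s \<noteq> 0" "coef y t \<noteq> 0"
proof -
  have "\<exists>s\<in>Poly_Mapping.keys (fst x). \<exists>t\<in>Poly_Mapping.keys (fst y). r = s + t"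
  proof (rule ccontr)
    assume "\<not> ?thesis"
    then have "coef (lbracket x y) r = 0"
      by (simp add: lbracket_def loop_bracket_def lookup_sum lookup_single when_def)
        (intro sum.neutral ballI, force)
    then show False using assms by simp
  qed
  then show thesis using that by (auto simp: in_keys_iff)
qed

lemma aff_bracket_lbracket:
  "aff_bracket x y = lbracket x y + (snd (snd x) *\<^sub>C loop_degree (fst y) - snd (snd y) *\<^sub>C loop_degree (fst x),
     \<Sum>r\<in>Poly_Mapping.keys (fst x). complex_of_real r * killing (coef x r) (coef y (- r)), 0)"
  by (cases x rule: prod_cases3, cases y rule: prod_cases3) (simp add: lbracket_def)

lemma lookup_loop_degree: "Poly_Mapping.lookup (loop_degree x) r = complex_of_real r *\<^sub>C Poly_Mapping.lookup x r"
  by (auto simp: loop_degree_def lookup_sum lookup_single when_def in_keys_iff)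

lemma coef_aff_bracket:
  "coef (aff_bracket x y) r = coef (lbracket x y) r + (snd (snd x) * complex_of_real r) *\<^sub>C coef y r
     - (snd (snd y) * complex_of_real r) *\<^sub>C coef x r" "snd (snd (aff_bracket x y)) = 0"
  by (simp_all add: aff_bracket_lbracket lookup_add lookup_minus lookup_loop_degree cscale_cscale algebra_simps)

lemma aff_bracket_d:
  "aff_bracket d_el y = (loop_degree (fst y), 0, 0)" "aff_bracket y d_el = - (loop_degree (fst y), 0, 0)"
  by (cases y rule: prod_cases3, simp add: d_el_def loop_bracket_def loop_degree_def cscale_one)+

lemma coef_aff_bracket_d [simp]: "coef (aff_bracket d_el y) r = complex_of_real r *\<^sub>C coef y r"
  "snd (aff_bracket d_el y) = 0"
  by (simp_all add: aff_bracket_d lookup_loop_degree zero_prod_def)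

lemma clinear_aff_bracket_d: "clinear (aff_bracket d_el)"
  by (auto intro!: clinearI affine_eqI simp: lookup_add cscale_add_right cscale_cscale mult.commute)

lemma affine_sum_t_pow:
  assumes "finite S" "Poly_Mapping.keys (fst x) \<subseteq> S" "snd x = 0"
  shows "x = (\<Sum>r\<in>S. t_pow r (coef x r))"
proof -
  have "fst (\<Sum>r\<in>S. t_pow r (coef x r)) = (\<Sum>r\<in>S. Poly_Mapping.single r (coef x r))"
    by (simp add: fst_sum t_pow_def)
  moreover have "snd (\<Sum>r\<in>S. t_pow r (coef x r)) = 0" by (simp add: snd_sum)
  ultimately show ?thesis using poly_mapping_sum_single[OF assms(1,2)] assms(3) by (simp add: prod_eq_iff)
qed

context involutive_lie begin

text \<open>The values that a coefficient at \<open>t\<^sup>r\<close> may take in the twisted loop algebra.\<close>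

definition part :: "real \<Rightarrow> 'g set" where
  "part r = (if r \<in> \<int> then k_part else if r - 1/2 \<in> \<int> then p_part else {0})"

lemma half_not_int: "r \<in> \<int> \<Longrightarrow> r - 1/2 \<notin> (\<int> :: real set)"
proof
  assume "r \<in> \<int>" "r - 1/2 \<in> \<int>"
  then have "r - (r - 1/2) \<in> \<int>" by (rule Ints_diff)
  then obtain k :: int where "1/2 = real_of_int k" by (auto elim: Ints_cases)
  then have "real_of_int (2 * k) = real_of_int 1" by simp
  then have "2 * k = 1" unfolding of_int_eq_iff .
  then show False by presburger
qed

lemma part_simps: "r \<in> \<int> \<Longrightarrow> part r = k_part" "r - 1/2 \<in> \<int> \<Longrightarrow> part r = p_part"
  using half_not_int[of r] by (auto simp: part_def)

lemma part_cases:
  assumes "x \<in> part r"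
  obtains "r \<in> \<int>" "x \<in> k_part" | "r - 1/2 \<in> \<int>" "x \<in> p_part" | "x = 0"
  using assms by (auto simp: part_def split: if_splits)

lemma subspace_part: "cvec.subspace (part r)"
  by (simp add: part_def subspace_parts cvec.subspace_single_0)

lemma part_minus: "part (- r) = part r"
proof -
  have "- r - 1/2 \<in> \<int> \<longleftrightarrow> r - 1/2 \<in> (\<int> :: real set)"
  proof -
    have "- (- r - 1/2) - 1 = r - 1/2" "- (r - 1/2) - 1 = - r - 1/2" by (auto simp: field_simps)
    then show ?thesis by (metis Ints_1 Ints_diff Ints_minus)
  qed
  then show ?thesis by (simp add: part_def)
qed

lemma lie_part:
  assumes x: "x \<in> part r" and y: "y \<in> part s"
  shows "lie x y \<in> part (r + s)"
  using x
proof (cases rule: part_cases)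
  case r: 1
  show ?thesis using y
  proof (cases rule: part_cases)
    case 1
    then show ?thesis using r by (simp add: part_simps lie_parts)
  next
    case 2
    then have "r + s - 1/2 \<in> \<int>" using Ints_add[OF r(1) 2(1)] by (simp add: algebra_simps)
    then show ?thesis using r 2 by (simp add: part_simps lie_parts)
  qed (simp add: cvec.subspace_0[OF subspace_part])
next
  case r: 2
  show ?thesis using y
  proof (cases rule: part_cases)
    case 1
    then have "r + s - 1/2 \<in> \<int>" using Ints_add[OF r(1) 1(1)] by (simp add: algebra_simps)
    then show ?thesis using r 1 by (simp add: part_simps lie_parts)
  next
    case 2
    then have "r + s \<in> \<int>" using Ints_add[OF Ints_add[OF r(1) 2(1)] Ints_1] by (simp add: algebra_simps)
    then show ?thesis using r 2 by (simp add: part_simps lie_parts)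
  qed (simp add: cvec.subspace_0[OF subspace_part])
qed (simp add: cvec.subspace_0[OF subspace_part])

lemma part_half: "part (real m / 2) = (if even m then k_part else p_part)"
proof (cases "even m")
  case True
  then obtain k where "m = 2 * k" by auto
  then show ?thesis using True by (simp add: part_simps)
next
  case False
  then obtain k where "m = 2 * k + 1" by (auto elim: oddE)
  then have "real m / 2 - 1/2 = real k" by (simp add: field_simps)
  then show ?thesis using False by (metis Ints_of_nat part_simps(2))
qed

lemma part_nonzero:
  assumes "x \<in> part r" "x \<noteq> 0"
  obtains m where "\<bar>r\<bar> = real m / 2"
proof -
  have "\<exists>k :: int. r = real_of_int k / 2"
    using assms(1)
  proof (cases rule: part_cases)
    case 1
    then obtain k where "r = real_of_int k" by (auto elim: Ints_cases)
    then show ?thesis by (intro exI[of _ "2 * k"]) simp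
  next
    case 2
    then obtain k where "r - 1/2 = real_of_int k" by (auto elim: Ints_cases)
    then show ?thesis by (intro exI[of _ "2 * k + 1"]) (simp add: field_simps)
  qed (use assms in simp)
  then obtain k :: int where "r = real_of_int k / 2" by blast
  then have "\<bar>r\<bar> = real (nat \<bar>k\<bar>) / 2" by simp
  then show thesis by (rule that)
qed

lemma loop_alg_part: "x \<in> loop_alg \<sigma> \<longleftrightarrow> (\<forall>r. Poly_Mapping.lookup x r \<in> part r)"
  by (auto simp: loop_alg_def part_def split: if_splits)

definition loops :: "'g affine set" where
  "loops = {z. snd z = 0 \<and> (\<forall>r. coef z r \<in> part r)}"

lemma affine_alg_part: "z \<in> affine_alg \<sigma> \<longleftrightarrow> (\<forall>r. coef z r \<in> part r)"
  by (cases z rule: prod_cases3) (simp add: affine_alg_def loop_alg_part)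

lemma u_minus_loops: "z \<in> u_minus \<sigma> \<longleftrightarrow> z \<in> loops \<and> (\<forall>r\<ge>0. coef z r = 0)"
  by (cases z rule: prod_cases3) (auto simp: u_minus_def loops_def loop_alg_part zero_prod_def)

lemma loops_affine: "z \<in> loops \<Longrightarrow> z \<in> affine_alg \<sigma>"
  by (simp add: loops_def affine_alg_part)

lemma subspace_loops: "cvec.subspace loops"
  by (rule cvec.subspaceI) (auto simp: loops_def lookup_add subspace_simps[OF subspace_part])

lemma subspace_u_minus: "cvec.subspace (u_minus \<sigma>)"
  by (rule cvec.subspaceI) (auto simp: u_minus_loops lookup_add subspace_simps[OF subspace_loops])

lemma t_pow_loops: "x \<in> part r \<Longrightarrow> t_pow r x \<in> loops"
  by (auto simp: loops_def cvec.subspace_0[OF subspace_part])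

lemma t_pow_u_minus: "x \<in> part r \<Longrightarrow> r < 0 \<Longrightarrow> t_pow r x \<in> u_minus \<sigma>"
  by (simp add: u_minus_loops t_pow_loops)

lemma coef_lbracket_part:
  assumes "\<And>s. coef x s \<in> part s" "\<And>s. coef y s \<in> part s"
  shows "coef (lbracket x y) r \<in> part r"
proof -
  have "coef (lbracket x y) r = (\<Sum>s\<in>Poly_Mapping.keys (fst x). \<Sum>t\<in>Poly_Mapping.keys (fst y).
      if s + t = r then lie (coef x s) (coef y t) else 0)"
    by (simp add: lbracket_def loop_bracket_def lookup_sum lookup_single when_def)
  also have "\<dots> \<in> part r"
    using assms lie_part
    by (auto intro!: cvec.subspace_sum[OF subspace_part] simp: cvec.subspace_0[OF subspace_part])
  finally show ?thesis .
qed

lemma lbracket_loops: "x \<in> loops \<Longrightarrow> y \<in> loops \<Longrightarrow> lbracket x y \<in> loops"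
  using coef_lbracket_part by (auto simp: loops_def)

lemma coef_lbracket_eq_0:
  "(\<And>s t. r = s + t \<Longrightarrow> coef x s = 0 \<or> coef y t = 0) \<Longrightarrow> coef (lbracket x y) r = 0"
  by (metis coef_lbracket_nonzero)

lemma proj_loops: "x \<in> loops \<Longrightarrow> proj P x \<in> loops"
  by (auto simp: loops_def cvec.subspace_0[OF subspace_part])

end

section \<open>The triangular decomposition of the twisted loop algebra\<close>

text \<open>The given dual bases of the fixed part, together with dual families of the anti-fixed part; both
  are indexed by one sum type below, the index set \<open>A m\<close> collecting the vectors that occur in degree
  \<open>m / 2\<close> and \<open>- m / 2\<close>.\<close>

locale twisted_loop = involutive_lie_dual \<sigma> I b b'
  for \<sigma> :: "'g::complex_lie_algebra \<Rightarrow> 'g" and I :: "'i set" and b b' :: "'i \<Rightarrow> 'g" +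
  fixes B :: "'g set" and e e' :: "'g \<Rightarrow> 'g"
  assumes finite_B: "finite B" and e_in: "e s \<in> p_part" and e'_in: "e' s \<in> p_part"
    and p_part_expand: "x \<in> p_part \<Longrightarrow> (\<Sum>s\<in>B. killing (e' s) x *\<^sub>C e s) = x"
      "x \<in> p_part \<Longrightarrow> (\<Sum>s\<in>B. killing (e s) x *\<^sub>C e' s) = x"
begin

definition A :: "nat \<Rightarrow> ('i + 'g) set" where "A m = (if even m then Inl ` I else Inr ` B)"
definition g :: "'i + 'g \<Rightarrow> 'g" where "g = case_sum b e"
definition g' :: "'i + 'g \<Rightarrow> 'g" where "g' = case_sum b' e'"

lemma finite_A: "finite (A m)" by (simp add: A_def finite_I finite_B)

lemma g_part: "s \<in> A m \<Longrightarrow> g s \<in> part (real m / 2)" "s \<in> A m \<Longrightarrow> g' s \<in> part (real m / 2)"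
  by (auto simp: A_def g_def g'_def part_half b_in b'_in e_in e'_in split: if_splits)

lemma part_expand:
  "x \<in> part (real m / 2) \<Longrightarrow> (\<Sum>s\<in>A m. killing (g' s) x *\<^sub>C g s) = x"
  "x \<in> part (real m / 2) \<Longrightarrow> (\<Sum>s\<in>A m. killing (g s) x *\<^sub>C g' s) = x"
  by (auto simp: part_half A_def g_def g'_def sum.reindex k_part_expand p_part_expand split: if_splits)

definition U :: "'g affine set" where "U = u_minus \<sigma>"
text \<open>The homogeneous dual bases. Degrees are multiples of \<open>1/2\<close>, so an index \<open>(m, s)\<close> stands for the degree
  \<open>- m / 2\<close> in \<open>u\<close> and \<open>m / 2\<close> in \<open>u'\<close>. Pairs that do not denote a basis vector are sent to zero, which makes
  the properties of \<open>u\<close> and \<open>u'\<close> hold for all indices.\<close>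

definition J :: "nat \<Rightarrow> (nat \<times> ('i + 'g)) set" where "J n = Sigma {0<..<n} A"
definition u :: "nat \<times> ('i + 'g) \<Rightarrow> 'g affine" where
  "u = (\<lambda>(m, s). if 0 < m \<and> s \<in> A m then t_pow (- (real m / 2)) (g s) else 0)"
definition u' :: "nat \<times> ('i + 'g) \<Rightarrow> 'g affine" where
  "u' = (\<lambda>(m, s). if 0 < m \<and> s \<in> A m then t_pow (real m / 2) (g' s) else 0)"
definition dep :: "nat \<Rightarrow> 'g affine set" where
  "dep n = {z. \<forall>r\<le>- (real n / 2). coef z r = 0}"
definition hgt :: "nat \<Rightarrow> 'g affine set" where
  "hgt n = {z. \<forall>r\<ge>real n / 2. coef z r = 0}"

lemma sum_J: "(\<Sum>i\<in>J n. F i) = (\<Sum>m\<in>{0<..<n}. \<Sum>s\<in>A m. F (m, s))"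
  unfolding J_def by (subst sum.Sigma) (auto simp: finite_A)

lemma ex_bound: "\<exists>n. \<forall>r. real n / 2 \<le> \<bar>r\<bar> \<longrightarrow> coef (z :: 'g affine) r = 0"
proof -
  let ?K = "Poly_Mapping.keys (fst z)"
  obtain n :: nat where n: "(\<Sum>r\<in>?K. \<bar>r\<bar>) < real n" using reals_Archimedean2 by blast
  have "coef z r = 0" if "real (2 * n) / 2 \<le> \<bar>r\<bar>" for r
  proof (rule ccontr)
    assume "coef z r \<noteq> 0"
    then have "\<bar>r\<bar> \<le> (\<Sum>r\<in>?K. \<bar>r\<bar>)" by (intro member_le_sum) (auto simp: in_keys_iff)
    then show False using n that by simp
  qed
  then show ?thesis by blast
qed

lemma lform_zero [simp]: "lform 0 x = 0" by (rule cvec.linear_0[OF clinear_lform(1)])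

text \<open>Reconstruction of one half of a loop from its pairings with homogeneous vectors: \<open>c = 1\<close> gives the
  negative half, \<open>c = - 1\<close> the positive half.\<close>

lemma reconstruct_half_line:
  assumes x: "x \<in> loops" and c: "c = 1 \<or> c = (-1::real)"
    and v: "\<And>m. m \<ge> n \<Longrightarrow> coef x (- c * (real m / 2)) = 0"
    and h: "\<And>m y. y \<in> part (real m / 2) \<Longrightarrow> (\<Sum>s\<in>A m. killing (h s) y *\<^sub>C h' s) = y"
  shows "(\<Sum>m\<in>{0<..<n}. \<Sum>s\<in>A m. lform (t_pow (c * (real m / 2)) (h s)) x *\<^sub>C t_pow (- c * (real m / 2)) (h' s))
    = proj (\<lambda>r. - c * r > 0) x" (is "?S = _")
proof -
  have S: "?S = (\<Sum>m\<in>{0<..<n}. t_pow (- c * (real m / 2)) (coef x (- c * (real m / 2))))"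
  proof (intro sum.cong refl)
    fix m
    have "(\<Sum>s\<in>A m. killing (h s) (coef x (- c * (real m / 2))) *\<^sub>C h' s) = coef x (- c * (real m / 2))"
    proof (rule h)
      have "coef x (- c * (real m / 2)) \<in> part (- c * (real m / 2))" using x by (simp add: loops_def)
      moreover have "part (- c * (real m / 2)) = part (real m / 2)" using c by (auto simp: part_minus)
      ultimately show "coef x (- c * (real m / 2)) \<in> part (real m / 2)" by simp
    qed
    then show "(\<Sum>s\<in>A m. lform (t_pow (c * (real m / 2)) (h s)) x *\<^sub>C t_pow (- c * (real m / 2)) (h' s)) =
        t_pow (- c * (real m / 2)) (coef x (- c * (real m / 2)))"
      by (simp add: lform_t_pow clinear_simps[OF clinear_t_pow, symmetric])
  qed
  show ?thesis
    unfolding S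
  proof (rule affine_eqI)
    fix r
    have "coef (\<Sum>m\<in>{0<..<n}. t_pow (- c * (real m / 2)) (coef x (- c * (real m / 2)))) r =
      (\<Sum>m\<in>{0<..<n}. if r = - c * (real m / 2) then coef x r else 0)"
      by (auto simp: fst_sum lookup_sum intro!: sum.cong)
    also have "\<dots> = (if - c * r > 0 then coef x r else 0)"
    proof (cases "- c * r > 0 \<and> coef x r \<noteq> 0")
      case True
      obtain m where m: "\<bar>r\<bar> = real m / 2"
        using part_nonzero[of "coef x r" r] True x by (auto simp: loops_def)
      have r: "r = - c * (real m / 2)" using m True c by auto
      have m0: "0 < m" using r True by (auto intro: Nat.gr0I)
      have mn: "m < n" using v[of m] r True by force
      have "(\<Sum>k\<in>{0<..<n}. if r = - c * (real k / 2) then coef x r else 0) =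
        (\<Sum>k\<in>{0<..<n}. if k = m then coef x r else 0)"
        using c by (intro sum.cong refl if_cong) (auto simp: r)
      then show ?thesis using True m0 mn by simp
    next
      case False
      have "(if r = - c * (real m / 2) then coef x r else 0) = 0" if "m \<in> {0<..<n}" for m
        using that False c by auto
      then show ?thesis using False by (auto intro!: sum.neutral)
    qed
    finally show "coef (\<Sum>m\<in>{0<..<n}. t_pow (- c * (real m / 2)) (coef x (- c * (real m / 2)))) r
       = coef (proj (\<lambda>r. - c * r > 0) x) r" by simp
  qed (simp_all add: snd_sum)
qed

lemma lbracket_t_pow_coef: "coef (lbracket (t_pow r a) x) s = lie a (coef x (s - r))"
proof -
  have "coef (lbracket (t_pow r a) x) s = (\<Sum>t\<in>Poly_Mapping.keys (fst x). if r + t = s then lie a (coef x t) else 0)"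
    by (simp add: lbracket_def t_pow_def loop_bracket_superset[of "{r}" "Poly_Mapping.keys (fst x)"] lookup_sum
        lookup_single when_def)
  also have "\<dots> = (\<Sum>t\<in>Poly_Mapping.keys (fst x). if t = s - r then lie a (coef x (s - r)) else 0)"
    by (intro sum.cong refl) auto
  also have "\<dots> = lie a (coef x (s - r))"
    by (simp add: in_keys_iff)
  finally show ?thesis .
qed

lemma lbracket_skew: "lbracket x y = - lbracket y x"
  using loop_bracket_skew[of "fst x" "fst y"] by (simp add: lbracket_def prod_eq_iff)

lemma lbracket_zero [simp]: "lbracket 0 x = 0" by (rule cvec.linear_0[OF clinear_lbracket(1)])

lemma u_in_U: "u i \<in> U"
  by (cases i) (auto simp: u_def U_def cvec.subspace_0[OF subspace_u_minus] part_minus g_part intro!: t_pow_u_minus)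

lemma u'_in_loops: "u' i \<in> loops"
  by (cases i) (auto simp: u'_def cvec.subspace_0[OF subspace_loops] g_part intro!: t_pow_loops)

lemma coef_lbracket_u': "coef (lbracket (u' (m, s)) x) r = (if 0 < m \<and> s \<in> A m then lie (g' s) (coef x (r - real m / 2)) else 0)"
  by (simp add: u'_def lbracket_t_pow_coef)

sublocale T: triangular_lie_algebra lbracket lform loops U "proj (\<lambda>r. r < 0)" "proj (\<lambda>r. r = 0)" "proj (\<lambda>r. r > 0)"
  dep hgt J u u' I "\<lambda>i. t_pow 0 (b i)" "\<lambda>i. t_pow 0 (b' i)"
proof (rule triangular_lie_algebra.intro, goal_cases)
  case (1 y) show ?case by (rule clinear_lbracket)
next
  case (2 x) show ?case by (rule clinear_lbracket)
next
  case (3 x y) show ?case by (rule lbracket_skew)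
next
  case (4 x y z) show ?case
    using loop_bracket_jacobi[of "fst x" "fst y" "fst z"] by (simp add: lbracket_def prod_eq_iff)
next
  case (5 y) show ?case by (rule clinear_lform)
next
  case (6 x) show ?case by (rule clinear_lform)
next
  case (7 x y) show ?case by (simp add: lform_def loop_form_sym)
next
  case (8 x y z) show ?case by (simp add: lform_def lbracket_def loop_form_invariant)
next
  case (9 x y) then show ?case by (rule lbracket_loops)
next
  case 10 show ?case by (simp add: U_def subspace_u_minus)
next
  case (11 x) then show ?case by (simp add: U_def u_minus_loops)
next
  case (12 x y) then show ?case
    by (auto simp: U_def u_minus_loops intro!: lbracket_loops coef_lbracket_eq_0)
     (smt (verit))
next
  case 13 show ?case by (rule clinear_proj)
next
  case (14 x) then show ?case by (simp add: U_def u_minus_loops proj_loops)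
next
  case (15 x) then show ?case
    by (intro affine_eqI) (auto simp: U_def u_minus_loops loops_def)
next
  case (16 x) then show ?case
    by (intro affine_eqI) (auto simp: loops_def lookup_add)
next
  case (17 n) show ?case by (simp add: J_def finite_A)
next
  case (18 m n) then show ?case by (auto simp: J_def)
next
  case (19 i) show ?case by (rule u_in_U)
next
  case (20 i) show ?case by (rule u'_in_loops)
next
  case (21 a) then show ?case by (simp add: t_pow_loops part_simps b_in)
next
  case (22 a x)
  then have "t_pow 0 (b a) \<in> loops" by (simp add: t_pow_loops part_simps b_in)
  then show ?case using 22 by (auto simp: U_def u_minus_loops lbracket_t_pow_coef intro!: lbracket_loops)
next
  case (23 a x)
  then have "t_pow 0 (b' a) \<in> loops" by (simp add: t_pow_loops part_simps b'_in)
  then show ?case using 23 by (auto simp: U_def u_minus_loops lbracket_t_pow_coef intro!: lbracket_loops)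
next
  case (24 m n) then show ?case by (auto simp: dep_def)
next
  case (25 x)
  obtain N where "\<And>r. real N / 2 \<le> \<bar>r\<bar> \<Longrightarrow> coef x r = 0" using ex_bound[of x] by blast
  then have "x \<in> dep N" by (auto simp: dep_def)
  then show ?case by blast
next
  case (26 n) show ?case by (rule cvec.subspaceI) (auto simp: dep_def lookup_add)
next
  case (27 x y m n) then show ?case
    unfolding dep_def mem_Collect_eq
    by (intro allI impI coef_lbracket_eq_0) (smt (verit) add_divide_distrib of_nat_add)
next
  case (28 i n) then show ?case by (cases i) (auto simp: J_def u_def dep_def)
next
  case (29 i n x) then show ?case
    by (cases i) (auto simp: dep_def coef_lbracket_u')
next
  case (30 a n x) then show ?case
    by (auto simp: dep_def lbracket_skew[of x] lbracket_t_pow_coef)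
next
  case (31 x n i)
  obtain m s where i: "i = (m, s)" by (cases i)
  show ?case
  proof (rule affine_eqI)
    fix r
    show "coef (proj (\<lambda>r. r < 0) (lbracket (u' i) x)) r = coef 0 r"
      using 31 by (auto simp: i coef_lbracket_u' J_def dep_def)
  qed (simp_all)
next
  case (32 x n)
  have "(\<Sum>i\<in>J n. lform (u' i) x *\<^sub>C u i) =
    (\<Sum>m\<in>{0<..<n}. \<Sum>s\<in>A m. lform (t_pow (1 * (real m / 2)) (g' s)) x *\<^sub>C t_pow (- 1 * (real m / 2)) (g s))"
    unfolding sum_J by (intro sum.cong refl) (auto simp: u_def u'_def)
  also have "\<dots> = proj (\<lambda>r. - 1 * r > 0) x"
    by (rule reconstruct_half_line[OF 32(1) _ _ part_expand(1)]) (use 32(2) in \<open>auto simp: dep_def\<close>)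
  finally show ?case by simp
next
  case (33 x n)
  have "(\<Sum>i\<in>J n. lform (u i) x *\<^sub>C u' i) =
    (\<Sum>m\<in>{0<..<n}. \<Sum>s\<in>A m. lform (t_pow ((-1) * (real m / 2)) (g s)) x *\<^sub>C t_pow (- (-1) * (real m / 2)) (g' s))"
    unfolding sum_J by (intro sum.cong refl) (auto simp: u_def u'_def)
  also have "\<dots> = proj (\<lambda>r. - (-1) * r > 0) x"
    by (rule reconstruct_half_line[OF 33(1) _ _ part_expand(2)]) (use 33(2) in \<open>auto simp: hgt_def\<close>)
  finally show ?case by simp
next
  case (34 i n x) then show ?case
    by (cases i) (auto simp: hgt_def coef_lbracket_u' J_def U_def u_minus_loops)
next
  case (35 x)
  obtain N where N: "\<And>r. real N / 2 \<le> \<bar>r\<bar> \<Longrightarrow> coef x r = 0" using ex_bound[of x] by blast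
  then have "x \<in> hgt m" if "m \<ge> N" for m using that by (auto simp: hgt_def)
  then show ?case by blast
next
  case 36 show ?case by (rule finite_I)
next
  case (37 x)
  have "coef x 0 \<in> k_part" using 37 by (auto simp: loops_def part_simps dest: spec[of _ 0])
  then have "(\<Sum>a\<in>I. lform (t_pow 0 (b a)) x *\<^sub>C t_pow 0 (b' a)) = t_pow 0 (coef x 0)"
    by (simp add: lform_t_pow clinear_simps[OF clinear_t_pow, symmetric] k_part_expand)
  also have "\<dots> = proj (\<lambda>r. r = 0) x" by (rule affine_eqI) simp_all
  finally show ?case .
next
  case (38 a) show ?case by (rule affine_eqI) simp_all
qed


section \<open>The Casimir operators of the two eigenspaces\<close>

text \<open>The Casimir operator of the fixed part for even \<open>m\<close>, and the corresponding sum over the anti-fixed part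
  for odd \<open>m\<close>, acting on the whole algebra.\<close>

definition casimir_part :: "nat \<Rightarrow> 'g \<Rightarrow> 'g" where
  "casimir_part m y = (\<Sum>s\<in>A m. lie (g s) (lie (g' s) y))"

text \<open>The trace of \<open>ad z \<circ> ad y\<close> restricted to, and projected onto, one of the two eigenspaces.\<close>

definition trace_part :: "nat \<Rightarrow> 'g \<Rightarrow> 'g \<Rightarrow> complex" where
  "trace_part m z y = (\<Sum>s\<in>A m. killing (g s) (lie z (lie y (g' s))))"

lemma killing_casimir_part: "killing (casimir_part m y) z = trace_part m z y"
proof -
  have "lie (lie (g' s) y) z = lie z (lie y (g' s))" for s
    by (simp add: lie_skew[of "g' s" y] lie_skew[of "lie y (g' s)" z] lie_linear)
  then have "killing (lie (g s) (lie (g' s) y)) z = killing (g s) (lie z (lie y (g' s)))" for s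
    by (simp add: killing_invariant)
  then show ?thesis by (simp add: casimir_part_def trace_part_def killing_linear)
qed

lemma part_expand_Pk_Pp: "(\<Sum>s\<in>A 0. killing (g s) x *\<^sub>C g' s) = Pk x" "(\<Sum>s\<in>A 1. killing (g s) x *\<^sub>C g' s) = Pp x"
proof -
  have "killing (g s) x = killing (g s) (Pk x)" if "s \<in> A 0" for s
    using killing_orthogonal(1)[OF _ Pp_in[of x], of "g s"] g_part(1)[OF that] Pk_Pp[of x]
    by (metis add.right_neutral even_zero killing_add(2) part_half)
  then have "(\<Sum>s\<in>A 0. killing (g s) x *\<^sub>C g' s) = (\<Sum>s\<in>A 0. killing (g s) (Pk x) *\<^sub>C g' s)" by simp
  then show "(\<Sum>s\<in>A 0. killing (g s) x *\<^sub>C g' s) = Pk x"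
    using part_expand(2)[of "Pk x" 0] Pk_in[of x] part_half[of 0] by simp
  have "killing (g s) x = killing (g s) (Pp x)" if "s \<in> A 1" for s
    using killing_orthogonal(2)[OF _ Pk_in[of x], of "g s"] g_part(1)[OF that] part_half[of 1] Pk_Pp[of x]
    by (metis add_0 odd_one killing_add(2))
  then have "(\<Sum>s\<in>A 1. killing (g s) x *\<^sub>C g' s) = (\<Sum>s\<in>A 1. killing (g s) (Pp x) *\<^sub>C g' s)" by simp
  then show "(\<Sum>s\<in>A 1. killing (g s) x *\<^sub>C g' s) = Pp x"
    using part_expand(2)[of "Pp x" 1] Pp_in[of x] part_half[of 1] by simp
qed

lemma A_disjoint: "A 0 \<inter> A 1 = {}" by (auto simp: A_def)

lemma trace_part_sum: "trace_part 0 z y + trace_part 1 z y = killing z y"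
proof -
  have "(\<Sum>s\<in>A 0 \<union> A 1. killing (g s) x *\<^sub>C g' s) = x" for x
    unfolding sum.union_disjoint[OF finite_A finite_A A_disjoint] part_expand_Pk_Pp Pk_Pp ..
  then have "complete_system (A 0 \<union> A 1) g' (\<lambda>s. killing (g s))"
    unfolding complete_system_def by (simp add: finite_A clinear_killing)
  from ctrace_complete_system[OF clinear_lie_lie this] show ?thesis
    unfolding killing_def[of z y] trace_part_def sum.union_disjoint[OF finite_A finite_A A_disjoint] by simp
qed

text \<open>The Casimir operator of the Killing form acts as the identity in the adjoint representation: pairing
  it with \<open>z\<close> yields the trace that defines the Killing form.\<close>

lemma casimir_part_sum: "casimir_part 0 y + casimir_part 1 y = y"
proof -
  have "killing (casimir_part 0 y + casimir_part 1 y - y) z = 0" for z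
    using trace_part_sum[of z y] killing_sym[of z y] by (simp add: killing_linear killing_casimir_part)
  then have "casimir_part 0 y + casimir_part 1 y - y = 0" by (rule killing_nondegenerate)
  then show ?thesis by simp
qed

text \<open>For \<open>y\<close> and \<open>z\<close> in the anti-fixed part, \<open>ad y\<close> and \<open>ad z\<close> exchange the two eigenspaces, so this is the
  cyclicity of the trace.\<close>

lemma trace_part_swap:
  assumes "y \<in> p_part" "z \<in> p_part"
  shows "trace_part 0 z y = trace_part 1 y z"
proof -
  have k: "g' s \<in> k_part" if "s \<in> A 0" for s using g_part(2)[OF that] part_half[of 0] by simp
  have p: "g' s \<in> p_part" if "s \<in> A 1" for s using g_part(2)[OF that] part_half[of 1] by simp
  have 0: "lie y (g' s) = (\<Sum>c\<in>A 1. killing (g c) (lie y (g' s)) *\<^sub>C g' c)" if "s \<in> A 0" for s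
    using part_expand_Pk_Pp(2)[of "lie y (g' s)"] Pk_Pp_parts(4)[OF lie_parts(3)[OF assms(1) k[OF that]]] by simp
  have 1: "lie z (g' c) = (\<Sum>s\<in>A 0. killing (g s) (lie z (g' c)) *\<^sub>C g' s)" if "c \<in> A 1" for c
    using part_expand_Pk_Pp(1)[of "lie z (g' c)"] Pk_Pp_parts(1)[OF lie_parts(4)[OF assms(2) p[OF that]]] by simp
  have "trace_part 0 z y = (\<Sum>s\<in>A 0. \<Sum>c\<in>A 1. killing (g c) (lie y (g' s)) * killing (g s) (lie z (g' c)))"
    unfolding trace_part_def
    by (intro sum.cong refl, subst 0) (simp_all add: lie_linear killing_linear)
  also have "\<dots> = (\<Sum>c\<in>A 1. \<Sum>s\<in>A 0. killing (g s) (lie z (g' c)) * killing (g c) (lie y (g' s)))"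
    by (subst sum.swap) (simp add: mult.commute)
  also have "\<dots> = trace_part 1 y z"
    unfolding trace_part_def
  proof (intro sum.cong refl)
    fix c assume "c \<in> A 1"
    then have "lie y (lie z (g' c)) = (\<Sum>s\<in>A 0. killing (g s) (lie z (g' c)) *\<^sub>C lie y (g' s))"
      by (subst 1) (simp_all add: lie_linear)
    then show "(\<Sum>s\<in>A 0. killing (g s) (lie z (g' c)) * killing (g c) (lie y (g' s))) =
        killing (g c) (lie y (lie z (g' c)))"
      by (simp add: killing_linear)
  qed
  finally show ?thesis .
qed

lemma trace_part_sym: "trace_part m z y = trace_part m y z"
proof -
  let ?\<beta> = "\<lambda>a c. killing a (lie z (lie y c))"
  have r: "g s = (\<Sum>t\<in>A m. killing (g t) (g s) *\<^sub>C g' t)" if "s \<in> A m" for s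
    by (rule part_expand(2)[symmetric, OF g_part(1)[OF that]])
  have "trace_part m z y = (\<Sum>s\<in>A m. \<Sum>t\<in>A m. killing (g t) (g s) * ?\<beta> (g' t) (g' s))"
    unfolding trace_part_def by (intro sum.cong refl, subst r) (simp_all add: killing_linear)
  also have "\<dots> = (\<Sum>t\<in>A m. \<Sum>s\<in>A m. killing (g s) (g t) * ?\<beta> (g' t) (g' s))"
    by (subst sum.swap) (simp add: killing_sym)
  also have "\<dots> = (\<Sum>t\<in>A m. ?\<beta> (g' t) (g t))"
  proof (intro sum.cong refl)
    fix t assume "t \<in> A m"
    then have "lie z (lie y (g t)) = (\<Sum>s\<in>A m. killing (g s) (g t) *\<^sub>C lie z (lie y (g' s)))"
      by (subst r) (simp_all add: lie_linear)
    then show "(\<Sum>s\<in>A m. killing (g s) (g t) * ?\<beta> (g' t) (g' s)) = ?\<beta> (g' t) (g t)"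
      by (simp add: killing_linear)
  qed
  also have "\<dots> = trace_part m y z"
    unfolding trace_part_def
  proof (intro sum.cong refl)
    fix t
    have "?\<beta> (g' t) (g t) = killing (lie (lie (g' t) z) y) (g t)" by (simp add: killing_invariant)
    also have "lie (lie (g' t) z) y = lie y (lie z (g' t))"
      by (simp add: lie_skew[of "g' t" z] lie_skew[of "lie z (g' t)" y] lie_linear)
    finally show "?\<beta> (g' t) (g t) = killing (g t) (lie y (lie z (g' t)))" by (simp add: killing_sym)
  qed
  finally show ?thesis .
qed

text \<open>On the anti-fixed part the Casimir operator of the fixed part is \<open>1/2\<close>: by cyclicity the two
  eigenspaces contribute equally to the Killing form there.\<close>

lemma casimir_part_on_p:
  assumes y: "y \<in> p_part"
  shows "casimir_part 0 y = (1/2) *\<^sub>C y"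
proof -
  let ?d = "casimir_part 0 y - (1/2) *\<^sub>C y"
  have "g s \<in> k_part" "g' s \<in> k_part" if "s \<in> A 0" for s using g_part[OF that] part_half[of 0] by simp_all
  then have "casimir_part 0 y \<in> p_part"
    unfolding casimir_part_def using y by (auto intro!: cvec.subspace_sum[OF subspace_parts(2)] lie_parts(2))
  then have d: "?d \<in> p_part" using y
    by (auto intro!: subspace_simps[OF subspace_parts(2)])
  have pz: "killing ?d z = 0" if z: "z \<in> p_part" for z
  proof -
    have "trace_part 1 z y = trace_part 0 z y"
      using trace_part_swap[OF z y] trace_part_sym[of 0 y z] by simp
    then have "2 * trace_part 0 z y = killing z y" using trace_part_sum[of z y] by simp
    then show ?thesis by (simp add: killing_linear killing_casimir_part killing_sym[of y z] field_simps)
  qed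
  have "killing ?d z = 0" for z
    using pz[OF Pp_in[of z]] killing_orthogonal(2)[OF d Pk_in[of z]] Pk_Pp[of z] by (metis add_0 killing_add(2))
  then have "?d = 0" by (rule killing_nondegenerate)
  then show ?thesis by simp
qed

lemma casimir_part_parity: "casimir_part m = casimir_part (if even m then 0 else 1)"
  by (simp add: casimir_part_def A_def fun_eq_iff)

text \<open>Consecutive summands add up to the identity. For odd \<open>m\<close> one summand is left over, and then \<open>y\<close> lies in
  the anti-fixed part, on which that summand is \<open>1/2\<close>.\<close>

lemma sum_casimir_parts:
  assumes y: "y \<in> part (real m / 2)"
  shows "(\<Sum>l<m. casimir_part l y) = (of_nat m / 2) *\<^sub>C y"
proof -
  have 2: "(\<Sum>l<2 * k. casimir_part l y) = of_nat k *\<^sub>C y" for k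
  proof (induction k)
    case (Suc k)
    have "casimir_part (2 * k) y + casimir_part (Suc (2 * k)) y = y"
      using casimir_part_sum[of y] by (simp add: casimir_part_parity[of "2 * k"] casimir_part_parity[of "Suc (2 * k)"])
    then show ?case using Suc by (simp add: cscale_add_left cscale_one algebra_simps)
  qed simp
  show ?thesis
  proof (cases "even m")
    case True
    then obtain k where k: "m = 2 * k" by auto
    then show ?thesis using 2[of k] by simp
  next
    case False
    then obtain k where k: "m = Suc (2 * k)" by (auto elim: oddE)
    have "y \<in> p_part" using y False by (simp add: part_half)
    then have "casimir_part (2 * k) y = (1/2) *\<^sub>C y"
      using casimir_part_on_p by (simp add: casimir_part_parity[of "2 * k"])
    moreover have "(of_nat m / 2 :: complex) = of_nat k + 1/2" using k by (simp add: field_simps)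
    moreover have "(\<Sum>l<m. casimir_part l y) = (\<Sum>l<2 * k. casimir_part l y) + casimir_part (2 * k) y"
      by (simp add: k)
    ultimately show ?thesis using 2[of k] by (simp only: cscale_add_left)
  qed
qed

text \<open>On the coefficient of \<open>x\<close> at degree \<open>- k / 2\<close>, the truncation to negative degrees cuts the sum on the left
  down to \<open>0 < m < k\<close>. The missing summand \<open>m = 0\<close> is the Casimir operator on the right, and
  \<open>d\<close> accounts for the value \<open>k / 2\<close> of the completed sum.\<close>

lemma casimir_degree_one:
  assumes x: "x \<in> U" "x \<in> dep n"
  shows "(\<Sum>i\<in>J n. lbracket (u i) (proj (\<lambda>r. r < 0) (lbracket (u' i) x))) =
    - (aff_bracket d_el x + (\<Sum>a\<in>I. lbracket (t_pow 0 (b a)) (lbracket (t_pow 0 (b' a)) x)))"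
proof (rule affine_eqI)
  fix r
  let ?y = "coef x r"
  have z: "(\<Sum>a\<in>I. lie (b a) (lie (b' a) ?y)) = casimir_part 0 ?y"
    by (simp add: casimir_part_def A_def sum.reindex g_def g'_def)
  have zero: "casimir_part m 0 = 0" for m by (simp add: casimir_part_def)
  have "coef (\<Sum>i\<in>J n. lbracket (u i) (proj (\<lambda>r. r < 0) (lbracket (u' i) x))) r =
    (\<Sum>m\<in>{0<..<n}. \<Sum>s\<in>A m. if r + real m / 2 < 0 then lie (g s) (lie (g' s) ?y) else 0)"
    unfolding sum_J fst_sum lookup_sum
    by (intro sum.cong refl) (auto simp: u_def u'_def lbracket_t_pow_coef)
  also have "\<dots> = (\<Sum>m\<in>{0<..<n}. if r + real m / 2 < 0 then casimir_part m ?y else 0)"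
    by (intro sum.cong refl) (auto simp: casimir_part_def)
  also have "\<dots> = - (complex_of_real r *\<^sub>C ?y + casimir_part 0 ?y)"
  proof (cases "?y = 0")
    case True
    show ?thesis unfolding True zero by simp
  next
    case False
    have yp: "?y \<in> part r" using x by (simp add: U_def u_minus_loops loops_def)
    obtain k where k: "\<bar>r\<bar> = real k / 2" using part_nonzero[OF yp False] .
    have neg: "r < 0" using x False by (auto simp: U_def u_minus_loops not_less[symmetric])
    then have r: "r = - (real k / 2)" and k0: "0 < k" using k by (auto intro: Nat.gr0I)
    have kn: "k < n"
    proof (rule ccontr)
      assume "\<not> k < n"
      then have "r \<le> - (real n / 2)" using r by simp
      then show False using x False by (auto simp: dep_def)
    qed
    have "(\<Sum>m\<in>{0<..<n}. if r + real m / 2 < 0 then casimir_part m ?y else 0) = (\<Sum>m\<in>{0<..<k}. casimir_part m ?y)"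
      by (intro sum.mono_neutral_cong_right) (use kn r in auto)
    moreover have "(\<Sum>m<k. casimir_part m ?y) = casimir_part 0 ?y + (\<Sum>m\<in>{0<..<k}. casimir_part m ?y)"
    proof -
      have "{..<k} = insert 0 {0<..<k}" using k0 by auto
      then show ?thesis by simp
    qed
    moreover have "(\<Sum>m<k. casimir_part m ?y) = (of_nat k / 2) *\<^sub>C ?y"
      using sum_casimir_parts[of ?y k] yp part_minus[of "real k / 2"] by (simp add: r)
    moreover have "complex_of_real r = - (of_nat k / 2)" by (simp add: r)
    ultimately show ?thesis by (simp add: algebra_simps)
  qed
  finally show "coef (\<Sum>i\<in>J n. lbracket (u i) (proj (\<lambda>r. r < 0) (lbracket (u' i) x))) r =
    coef (- (aff_bracket d_el x + (\<Sum>a\<in>I. lbracket (t_pow 0 (b a)) (lbracket (t_pow 0 (b' a)) x)))) r"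
    by (simp add: lookup_add lookup_minus lookup_uminus fst_sum lookup_sum lbracket_t_pow_coef z)
qed (simp_all add: snd_sum)

end

context involutive_lie begin

lemma aff_bracket_affine_alg:
  assumes "x \<in> affine_alg \<sigma>" "y \<in> affine_alg \<sigma>"
  shows "aff_bracket x y \<in> affine_alg \<sigma>"
  unfolding affine_alg_part coef_aff_bracket
  using assms coef_lbracket_part[of x y]
  by (auto simp: affine_alg_part intro!: subspace_simps[OF subspace_part])

lemma subspace_affine_alg: "cvec.subspace (affine_alg \<sigma>)"
  by (rule cvec.subspaceI) (auto simp: affine_alg_part lookup_add subspace_simps[OF subspace_part])

lemma d_el_affine: "d_el \<in> affine_alg \<sigma>"
  by (simp add: affine_alg_part d_el_def cvec.subspace_0[OF subspace_part])

lemma homogeneous: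
  assumes "aff_bracket d_el z = complex_of_real r *\<^sub>C z"
  shows "s \<noteq> r \<Longrightarrow> coef z s = 0" "r \<noteq> 0 \<Longrightarrow> z = t_pow r (coef z r)"
proof -
  have e: "(loop_degree (fst z), 0, 0) = complex_of_real r *\<^sub>C z" using assms by (simp add: aff_bracket_d)
  then have "complex_of_real s *\<^sub>C coef z s = complex_of_real r *\<^sub>C coef z s" for s
    using lookup_loop_degree[of "fst z" s] by (metis affine_simps(1) fst_conv lookup_cscale)
  then show 0: "coef z s = 0" if "s \<noteq> r" for s
    using that by (metis cvec.scale_cancel_right of_real_eq_iff)
  assume r: "r \<noteq> 0"
  have "complex_of_real r *\<^sub>C snd z = 0" using e by (metis affine_simps(2) snd_conv zero_prod_def)
  then have "snd z = 0" using r by simp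
  then show "z = t_pow r (coef z r)" by (intro affine_eqI) (auto simp: 0)
qed

end

section \<open>Antiautomorphisms fixing the degree derivation\<close>

text \<open>Since \<open>\<tau>\<close> reverses brackets and fixes \<open>d\<close>, it maps the eigenspace of \<open>ad d\<close> for \<open>r\<close> to the one for
  \<open>- r\<close>. In nonzero degree these eigenspaces are \<open>t\<^sup>r \<otimes> x\<close> without a component along \<open>c\<close> or \<open>d\<close>, so \<open>\<tau>\<close>
  induces maps \<open>rho r\<close> between coefficients.\<close>

locale graded_antiautomorphism = involutive_lie +
  fixes \<tau> :: "'a affine \<Rightarrow> 'a affine"
  assumes anti: "antilinear_antiautomorphism \<sigma> \<tau>" and \<tau>_d: "\<tau> d_el = d_el"
begin

abbreviation "aff \<equiv> affine_alg \<sigma>"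

lemma \<tau>_in: "x \<in> aff \<Longrightarrow> \<tau> x \<in> aff" and \<tau>_inj: "inj_on \<tau> aff" and \<tau>_surj: "\<tau> ` aff = aff"
  and \<tau>_add: "x \<in> aff \<Longrightarrow> y \<in> aff \<Longrightarrow> \<tau> (x + y) = \<tau> x + \<tau> y"
  and \<tau>_scale: "x \<in> aff \<Longrightarrow> \<tau> (c *\<^sub>C x) = cnj c *\<^sub>C \<tau> x"
  and \<tau>_bracket: "x \<in> aff \<Longrightarrow> y \<in> aff \<Longrightarrow> \<tau> (aff_bracket x y) = aff_bracket (\<tau> y) (\<tau> x)"
  using anti by (auto simp: antilinear_antiautomorphism_def antilinear_on_def bij_betw_def)

lemma \<tau>_zero: "\<tau> 0 = 0"
  using \<tau>_scale[of 0 0] cvec.subspace_0[OF subspace_affine_alg] by simp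

lemma \<tau>_sum: "finite S \<Longrightarrow> (\<And>i. i \<in> S \<Longrightarrow> f i \<in> aff) \<Longrightarrow> \<tau> (\<Sum>i\<in>S. f i) = (\<Sum>i\<in>S. \<tau> (f i))"
  by (induction S rule: finite_induct)
    (simp_all add: \<tau>_zero \<tau>_add cvec.subspace_sum[OF subspace_affine_alg])

definition inv_\<tau> :: "'a affine \<Rightarrow> 'a affine" where "inv_\<tau> = inv_into aff \<tau>"

lemma inv_\<tau>_in: "x \<in> aff \<Longrightarrow> inv_\<tau> x \<in> aff" and \<tau>_inv: "x \<in> aff \<Longrightarrow> \<tau> (inv_\<tau> x) = x"
  and inv_\<tau>: "x \<in> aff \<Longrightarrow> inv_\<tau> (\<tau> x) = x"
  using \<tau>_surj \<tau>_inj unfolding inv_\<tau>_def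
  by (auto simp: inv_into_into f_inv_into_f)

lemma inverse: "graded_antiautomorphism \<sigma> inv_\<tau>"
proof unfold_locales
  have "bij_betw inv_\<tau> aff aff"
    unfolding inv_\<tau>_def by (rule bij_betw_inv_into) (simp add: bij_betw_def \<tau>_inj \<tau>_surj)
  moreover have "antilinear_on aff inv_\<tau>"
    unfolding antilinear_on_def
  proof (intro conjI ballI allI)
    fix x y c assume xy: "x \<in> aff" "y \<in> aff"
    then have "\<tau> (inv_\<tau> x + inv_\<tau> y) = x + y" by (simp add: \<tau>_add inv_\<tau>_in \<tau>_inv)
    then show "inv_\<tau> (x + y) = inv_\<tau> x + inv_\<tau> y"
      using xy inv_\<tau>[of "inv_\<tau> x + inv_\<tau> y"] by (simp add: inv_\<tau>_in cvec.subspace_add[OF subspace_affine_alg])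
  next
    fix x c assume x: "x \<in> aff"
    then have "\<tau> (cnj c *\<^sub>C inv_\<tau> x) = c *\<^sub>C x" by (simp add: \<tau>_scale inv_\<tau>_in \<tau>_inv)
    then show "inv_\<tau> (c *\<^sub>C x) = cnj c *\<^sub>C inv_\<tau> x"
      using x inv_\<tau>[of "cnj c *\<^sub>C inv_\<tau> x"] by (simp add: inv_\<tau>_in cvec.subspace_scale[OF subspace_affine_alg])
  qed
  moreover have "inv_\<tau> (aff_bracket x y) = aff_bracket (inv_\<tau> y) (inv_\<tau> x)" if xy: "x \<in> aff" "y \<in> aff" for x y
  proof -
    have "\<tau> (aff_bracket (inv_\<tau> y) (inv_\<tau> x)) = aff_bracket x y" using xy by (simp add: \<tau>_bracket inv_\<tau>_in \<tau>_inv)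
    then show ?thesis using xy inv_\<tau>[of "aff_bracket (inv_\<tau> y) (inv_\<tau> x)"]
      by (simp add: inv_\<tau>_in aff_bracket_affine_alg)
  qed
  ultimately show "antilinear_antiautomorphism \<sigma> inv_\<tau>" by (simp add: antilinear_antiautomorphism_def)
  show "inv_\<tau> d_el = d_el" using inv_\<tau>[OF d_el_affine] by (simp add: \<tau>_d)
qed

lemma \<tau>_homogeneous:
  assumes "z \<in> aff" "aff_bracket d_el z = complex_of_real r *\<^sub>C z"
  shows "aff_bracket d_el (\<tau> z) = complex_of_real (- r) *\<^sub>C \<tau> z"
proof -
  have "aff_bracket d_el (\<tau> z) = - aff_bracket (\<tau> z) (\<tau> d_el)" by (simp add: \<tau>_d aff_bracket_d)
  also have "\<dots> = - \<tau> (aff_bracket d_el z)" using assms(1) by (simp add: \<tau>_bracket d_el_affine)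
  also have "\<dots> = complex_of_real (- r) *\<^sub>C \<tau> z" using assms by (simp add: \<tau>_scale)
  finally show ?thesis .
qed

definition rho :: "real \<Rightarrow> 'a \<Rightarrow> 'a" where "rho r x = coef (\<tau> (t_pow r x)) (- r)"

lemma t_pow_aff: "x \<in> part r \<Longrightarrow> t_pow r x \<in> aff"
  by (intro loops_affine t_pow_loops)

lemma \<tau>_t_pow:
  assumes "x \<in> part r" "r \<noteq> 0"
  shows "\<tau> (t_pow r x) = t_pow (- r) (rho r x)"
  unfolding rho_def
  using homogeneous(2)[OF \<tau>_homogeneous[OF t_pow_aff[OF assms(1)] aff_bracket_d_t_pow]] assms(2) by simp

lemma rho_part: "x \<in> part r \<Longrightarrow> rho r x \<in> part r"
  using \<tau>_in[OF t_pow_aff, of x r] part_minus[of r] by (auto simp: rho_def affine_alg_part)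

lemma rho_antilinear:
  "x \<in> part r \<Longrightarrow> y \<in> part r \<Longrightarrow> rho r (x + y) = rho r x + rho r y"
  "x \<in> part r \<Longrightarrow> rho r (c *\<^sub>C x) = cnj c *\<^sub>C rho r x" "rho r 0 = 0"
  by (simp_all add: rho_def clinear_simps[OF clinear_t_pow] t_pow_aff \<tau>_add \<tau>_scale \<tau>_zero lookup_add)

lemma \<tau>_loops:
  assumes z: "z \<in> loops" "coef z 0 = 0"
  shows "coef (\<tau> z) r = rho (- r) (coef z (- r))" "snd (\<tau> z) = 0" "coef (\<tau> z) 0 = 0" "\<tau> z \<in> loops"
proof -
  let ?K = "Poly_Mapping.keys (fst z)"
  have zs: "z = (\<Sum>r\<in>?K. t_pow r (coef z r))"
    using z by (intro affine_sum_t_pow) (auto simp: loops_def)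
  have "\<tau> z = (\<Sum>r\<in>?K. \<tau> (t_pow r (coef z r)))"
    by (subst zs, rule \<tau>_sum) (use z in \<open>auto simp: loops_def t_pow_aff\<close>)
  also have "\<dots> = (\<Sum>r\<in>?K. t_pow (- r) (rho r (coef z r)))"
    using z by (intro sum.cong refl \<tau>_t_pow) (auto simp: loops_def in_keys_iff)
  finally have t: "\<tau> z = (\<Sum>r\<in>?K. t_pow (- r) (rho r (coef z r)))" .
  show c: "coef (\<tau> z) r = rho (- r) (coef z (- r))" for r
  proof -
    have "coef (\<tau> z) r = (\<Sum>s\<in>?K. if s = - r then rho (- r) (coef z (- r)) else 0)"
      unfolding t fst_sum lookup_sum by (intro sum.cong refl) auto
    then show ?thesis by (simp add: in_keys_iff rho_antilinear)
  qed
  show s: "snd (\<tau> z) = 0" by (simp add: t snd_sum)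
  show "coef (\<tau> z) 0 = 0" using c[of 0] z by (simp add: rho_antilinear)
  show "\<tau> z \<in> loops"
    using \<tau>_in[OF loops_affine[OF z(1)]] s by (simp add: loops_def affine_alg_part)
qed

text \<open>The Killing form of \<open>x\<close> and \<open>y\<close> is the trace of \<open>ad x \<circ> ad y\<close>. In the loop algebra this operator is realised by
  \<open>ad (t\<^sup>r \<otimes> x) \<circ> ad (t\<^sup>-\<^sup>r \<otimes> y)\<close> on \<open>(t\<^sup>N \<otimes> k) \<oplus> (t\<^sup>M \<otimes> p)\<close>, which \<open>\<tau>\<close> maps conjugate-linearly onto the corresponding space in the
  opposite degrees, carrying the operator to its counterpart for the images of \<open>x\<close> and \<open>y\<close>.\<close>

lemma killing_rho:
  assumes x: "x \<in> part r" and y: "y \<in> part r" and r: "r \<noteq> 0"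
  shows "killing (rho r x) (rho (- r) y) = cnj (killing x y)"
proof -
  interpret inv: graded_antiautomorphism \<sigma> inv_\<tau> by (rule inverse)
  \<comment> \<open>The degrees \<open>N\<close> and \<open>M = N + 1/2\<close> exceed \<open>\<bar>r\<bar>\<close>, so that no bracket below has a component along \<open>c\<close>.\<close>
  define N :: real where "N = real_of_int (\<lceil>\<bar>r\<bar>\<rceil> + 1)"
  define M where "M = N + 1/2"
  have N: "\<bar>r\<bar> < N" "\<bar>r\<bar> < M" unfolding N_def M_def by linarith+
  have pN: "part N = k_part" "part M = p_part" unfolding N_def M_def by (rule part_simps; simp)+
  have pN': "part (- N) = k_part" "part (- M) = p_part" using pN by (simp_all add: part_minus)
  define x' y' where "x' = rho r x" and "y' = rho (- r) y"
  define f g where "f = (\<lambda>z. lie x (lie y z))" and "g = (\<lambda>z. lie x' (lie y' z))"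
  define T where "T = (\<lambda>z. rho N (Pk z) + rho M (Pp z))"
  define T' where "T' = (\<lambda>z. inv.rho (- N) (Pk z) + inv.rho (- M) (Pp z))"
  have y_minus: "y \<in> part (- r)" using y by (simp add: part_minus)
  have step: "rho d (f z) = g (rho d z)" if d: "\<bar>r\<bar> < d" and z: "z \<in> part d" for d z
  proof -
    have d0: "d \<noteq> 0" "- r \<noteq> - d" "r \<noteq> - (- r + d)" using d by auto
    have fz: "f z \<in> part d" using lie_part[OF x lie_part[OF y_minus z]] by (simp add: f_def)
    have yz: "aff_bracket (t_pow (- r) y) (t_pow d z) = t_pow (- r + d) (lie y z)"
      using d0 by (simp add: aff_bracket_t_pow)
    \<comment> \<open>The antiautomorphism reverses both brackets, and restoring their order costs two signs.\<close>
    have e: "t_pow d (f z) = aff_bracket (t_pow r x) (aff_bracket (t_pow (- r) y) (t_pow d z))"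
      unfolding yz using d0 by (simp add: aff_bracket_t_pow f_def)
    have "\<tau> (t_pow d (f z)) = aff_bracket (aff_bracket (\<tau> (t_pow d z)) (\<tau> (t_pow (- r) y))) (\<tau> (t_pow r x))"
      unfolding e using x y_minus z by (simp add: \<tau>_bracket t_pow_aff aff_bracket_affine_alg)
    also have "\<dots> = aff_bracket (aff_bracket (t_pow (- d) (rho d z)) (t_pow r y')) (t_pow (- r) x')"
      using x y_minus z d0 r by (simp add: \<tau>_t_pow x'_def y'_def)
    also have "\<dots> = t_pow (- d) (lie (lie (rho d z) y') x')"
      using d0 by (simp add: aff_bracket_t_pow)
    also have "lie (lie (rho d z) y') x' = g (rho d z)"
      by (simp add: g_def lie_skew[of _ x'] lie_skew[of _ y'] lie_linear)
    finally show ?thesis using \<tau>_t_pow[OF fz d0(1)] by (metis coef_t_pow(1))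
  qed
  have inv1: "inv.rho (- d) (rho d z) = z" if "z \<in> part d" "d \<noteq> 0" for d z
  proof -
    have "inv_\<tau> (t_pow (- d) (rho d z)) = t_pow d z"
      using that by (simp add: \<tau>_t_pow[symmetric] inv_\<tau> t_pow_aff)
    then show ?thesis by (simp add: inv.rho_def)
  qed
  have inv2: "rho d (inv.rho (- d) z) = z" if "z \<in> part d" "d \<noteq> 0" for d z
  proof -
    have "z \<in> part (- d)" using that by (simp add: part_minus)
    then have "\<tau> (t_pow (- (- d)) (inv.rho (- d) z)) = t_pow (- d) z"
      using that by (simp add: inv.\<tau>_t_pow[symmetric] \<tau>_inv t_pow_aff del: minus_minus)
    then show ?thesis by (simp add: rho_def)
  qed
  have rk: "rho N z \<in> k_part" "inv.rho (- N) z \<in> k_part" if "z \<in> k_part" for z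
    using rho_part[of z N] inv.rho_part[of z "- N"] that by (simp_all add: pN pN')
  have rp: "rho M z \<in> p_part" "inv.rho (- M) z \<in> p_part" if "z \<in> p_part" for z
    using rho_part[of z M] inv.rho_part[of z "- M"] that by (simp_all add: pN pN')
  have PP: "Pk (a + c) = a" "Pp (a + c) = c" if "a \<in> k_part" "c \<in> p_part" for a c
    using that by (simp_all add: cvec.linear_add[OF clinear_Pk] cvec.linear_add[OF clinear_Pp] Pk_Pp_parts)
  have "ctrace g = cnj (ctrace f)"
  proof (rule ctrace_antilinear_conjugate[where T = T and T' = T'])
    show "clinear f" "clinear g" unfolding f_def g_def by (rule clinear_lie_lie)+
    show "antilinear_on UNIV T" "antilinear_on UNIV T'"
      unfolding antilinear_on_def T_def T'_def
      by (simp_all add: clinear_simps[OF clinear_Pk] clinear_simps[OF clinear_Pp] rho_antilinear inv.rho_antilinear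
        pN pN' Pk_in Pp_in cscale_add_right)
    show "T (T' z) = z" for z
      using N by (simp add: T_def T'_def PP rk rp Pk_in Pp_in inv2 pN Pk_Pp)
    show "T' (T z) = z" for z
      using N by (simp add: T_def T'_def PP rk rp Pk_in Pp_in inv1 pN Pk_Pp)
    show "T (f z) = g (T z)" for z
    proof -
      have k: "f (Pk z) \<in> k_part"
        using lie_part[OF x lie_part[OF y_minus, of "Pk z" N]] Pk_in[of z] by (simp add: f_def pN)
      have p: "f (Pp z) \<in> p_part"
        using lie_part[OF x lie_part[OF y_minus, of "Pp z" M]] Pp_in[of z] by (simp add: f_def pN)
      have "f z = f (Pk z) + f (Pp z)"
        by (subst Pk_Pp[of z, symmetric]) (simp add: f_def lie_linear)
      then have "T (f z) = rho N (f (Pk z)) + rho M (f (Pp z))" by (simp add: T_def PP k p)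
      also have "\<dots> = g (rho N (Pk z)) + g (rho M (Pp z))"
        using step[OF N(1), of "Pk z"] step[OF N(2), of "Pp z"] Pk_in[of z] Pp_in[of z] by (simp add: pN)
      finally show ?thesis by (simp add: T_def g_def lie_linear)
    qed
  qed
  then show ?thesis by (simp add: killing_def f_def g_def x'_def y'_def)
qed

lemma lform_\<tau>:
  assumes v: "v \<in> loops" "coef v 0 = 0" and y: "y \<in> loops" "coef y 0 = 0"
  shows "lform (\<tau> v) (\<tau> y) = cnj (lform v y)"
proof -
  let ?K = "Poly_Mapping.keys (fst v)"
  have "Poly_Mapping.keys (fst (\<tau> v)) \<subseteq> uminus ` ?K"
  proof
    fix s assume "s \<in> Poly_Mapping.keys (fst (\<tau> v))"
    then have "coef v (- s) \<noteq> 0" using \<tau>_loops(1)[OF v, of s] by (auto simp: in_keys_iff rho_antilinear)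
    then show "s \<in> uminus ` ?K" by (intro image_eqI[of _ _ "- s"]) (auto simp: in_keys_iff)
  qed
  then have "lform (\<tau> v) (\<tau> y) = (\<Sum>s\<in>uminus ` ?K. killing (coef (\<tau> v) s) (coef (\<tau> y) (- s)))"
    by (simp add: lform_def loop_form_superset)
  also have "\<dots> = (\<Sum>r\<in>?K. killing (rho r (coef v r)) (rho (- r) (coef y (- r))))"
    by (simp add: sum.reindex \<tau>_loops(1)[OF v] \<tau>_loops(1)[OF y])
  also have "\<dots> = (\<Sum>r\<in>?K. cnj (killing (coef v r) (coef y (- r))))"
  proof (intro sum.cong refl killing_rho)
    fix r assume r: "r \<in> ?K"
    then show "r \<noteq> 0" using v by (auto simp: in_keys_iff)
    show "coef v r \<in> part r" using v by (simp add: loops_def)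
    have "coef y (- r) \<in> part (- r)" using y by (simp add: loops_def)
    then show "coef y (- r) \<in> part r" by (simp add: part_minus)
  qed
  finally show ?thesis by (simp add: lform_def loop_form_def)
qed

end

section \<open>The Laplacian of the twisted affine algebra\<close>

locale twisted_loop_hermitian = twisted_loop \<sigma> I b b' B e e' + G: graded_antiautomorphism \<sigma> \<sigma>o
  for \<sigma> :: "'g::complex_lie_algebra \<Rightarrow> 'g" and I :: "'i set" and b b' :: "'i \<Rightarrow> 'g"
    and B :: "'g set" and e e' :: "'g \<Rightarrow> 'g" and \<sigma>o :: "'g affine \<Rightarrow> 'g affine"
begin

lemma aff_form_lform: "snd x = 0 \<Longrightarrow> aff_form x y = lform x y"
  by (cases x rule: prod_cases3, cases y rule: prod_cases3) (simp add: lform_def loop_form_def zero_prod_def)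

lemma clinear_aff_form: "clinear (\<lambda>x. aff_form x y)"
proof -
  have "aff_form x y = lform x y + fst (snd x) * snd (snd y) + snd (snd x) * fst (snd y)" for x
    by (cases x rule: prod_cases3, cases y rule: prod_cases3) (simp add: lform_def loop_form_def)
  then show ?thesis
    by (intro clinearI) (simp_all add: clinear_complex_simps[OF clinear_lform(1)] cscale_complex_def algebra_simps)
qed

lemma aff_bracket_loops: "x \<in> loops \<Longrightarrow> y \<in> loops \<Longrightarrow> fst (aff_bracket x y) = fst (lbracket x y)"
  by (simp add: aff_bracket_lbracket loops_def)

lemma aff_bracket_U:
  assumes "x \<in> U" "y \<in> U"
  shows "aff_bracket x y = lbracket x y"
proof -
  have "(\<Sum>r\<in>Poly_Mapping.keys (fst x). complex_of_real r * killing (coef x r) (coef y (- r))) = 0"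
  proof (intro sum.neutral ballI)
    fix r assume "r \<in> Poly_Mapping.keys (fst x)"
    then have "r < 0" using assms(1) by (auto simp: U_def u_minus_loops in_keys_iff not_less[symmetric])
    then show "complex_of_real r * killing (coef x r) (coef y (- r)) = 0"
      using assms(2) by (simp add: U_def u_minus_loops)
  qed
  then show ?thesis
    using assms by (simp add: aff_bracket_lbracket U_def u_minus_loops loops_def prod_eq_iff)
qed

lemma U_loops: "x \<in> U \<Longrightarrow> x \<in> loops" "x \<in> U \<Longrightarrow> coef x 0 = 0"
  by (auto simp: U_def u_minus_loops)

lemma lform_U_degree:
  assumes "y \<in> U" "\<And>r. 0 < r \<Longrightarrow> coef w r = 0"
  shows "lform y w = 0"
  unfolding lform_def loop_form_def
proof (intro sum.neutral ballI)
  fix r assume "r \<in> Poly_Mapping.keys (fst y)"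
  then have "r < 0" using assms(1) by (auto simp: U_def u_minus_loops in_keys_iff not_less[symmetric])
  then show "killing (coef y r) (coef w (- r)) = 0" using assms(2) by simp
qed

text \<open>An element without components in negative degree and along \<open>d\<close> has no image in positive degree: its
  positive part is sent to negative degrees, and the rest, a combination of \<open>t\<^sup>0 \<otimes> k\<close> and \<open>c\<close>, commutes
  with \<open>d\<close>, hence so does its image.\<close>

lemma coef_nonneg_image:
  assumes w: "w \<in> affine_alg \<sigma>" "\<And>r. r < 0 \<Longrightarrow> coef w r = 0" "snd (snd w) = 0" and r: "0 < r"
  shows "coef (\<sigma>o w) r = 0"
proof -
  define w0 where "w0 = t_pow 0 (coef w 0) + fst (snd w) *\<^sub>C c_el"
  define w1 where "w1 = proj (\<lambda>r. 0 < r) w"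
  have c0: "c_el \<in> affine_alg \<sigma>" by (simp add: affine_alg_part c_el_def cvec.subspace_0[OF subspace_part])
  have w0: "w0 \<in> affine_alg \<sigma>"
    using w(1) unfolding w0_def
    by (intro subspace_simps[OF subspace_affine_alg] c0 G.t_pow_aff)
      (simp add: affine_alg_part)
  have w1: "w1 \<in> loops" "coef w1 0 = 0"
    using w(1) by (auto simp: w1_def loops_def affine_alg_part cvec.subspace_0[OF subspace_part])
  have "w = w0 + w1"
    using w(2,3) by (intro affine_eqI) (auto simp: w0_def w1_def lookup_add c_el_def not_less_iff_gr_or_eq cscale_complex_def)
  then have "\<sigma>o w = \<sigma>o w0 + \<sigma>o w1" using G.\<tau>_add[OF w0 loops_affine[OF w1(1)]] by simp
  moreover have "coef (\<sigma>o w1) r = 0"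
    using r w1 by (simp add: G.\<tau>_loops G.rho_antilinear) (simp add: w1_def G.rho_antilinear)
  moreover have "coef (\<sigma>o w0) r = 0"
  proof -
    have "aff_bracket d_el w0 = complex_of_real 0 *\<^sub>C w0"
      by (rule affine_eqI) (auto simp: w0_def lookup_add c_el_def)
    from G.\<tau>_homogeneous[OF w0 this] show ?thesis
      using homogeneous(1)[of "\<sigma>o w0" 0 r] r by simp
  qed
  ultimately show ?thesis by (simp add: lookup_add)
qed

lemma inverse_on_u_minus:
  assumes x: "x \<in> U"
  shows "G.inv_\<tau> x \<in> loops" "coef (G.inv_\<tau> x) 0 = 0" "r < 0 \<Longrightarrow> coef (G.inv_\<tau> x) r = 0" "\<sigma>o (G.inv_\<tau> x) = x"
proof -
  interpret inv: graded_antiautomorphism \<sigma> G.inv_\<tau> by (rule G.inverse)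
  note l = inv.\<tau>_loops[OF U_loops[OF x]]
  show "G.inv_\<tau> x \<in> loops" "coef (G.inv_\<tau> x) 0 = 0" using l by auto
  show "r < 0 \<Longrightarrow> coef (G.inv_\<tau> x) r = 0"
    using l(1)[of r] x by (simp add: U_def u_minus_loops inv.rho_antilinear)
  show "\<sigma>o (G.inv_\<tau> x) = x" using U_loops[OF x] by (simp add: G.\<tau>_inv loops_affine)
qed

sublocale H: adjoint_triangular lbracket lform loops U "proj (\<lambda>r. r < 0)" "proj (\<lambda>r. r = 0)" "proj (\<lambda>r. r > 0)"
  dep hgt J u u' I "\<lambda>i. t_pow 0 (b i)" "\<lambda>i. t_pow 0 (b' i)"
  "\<lambda>x y. aff_form x (\<sigma>o y)" "\<lambda>y x. aff_form x (\<sigma>o y)" "G.inv_\<tau>"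
proof (rule adjoint_triangular.intro[OF T.triangular_lie_algebra_axioms], rule adjoint_triangular_axioms.intro, goal_cases)
  case (1 y) show ?case by (rule clinear_aff_form)
next
  case (2 x y) show ?case ..
next
  case (3 x y)
  have "aff_form x (\<sigma>o y) = lform (\<sigma>o (G.inv_\<tau> x)) (\<sigma>o y)"
    using 3 by (simp add: aff_form_lform inverse_on_u_minus U_def u_minus_loops loops_def)
  also have "\<dots> = cnj (lform (G.inv_\<tau> x) y)"
    by (rule G.lform_\<tau>[OF inverse_on_u_minus(1,2)[OF 3(1)] U_loops[OF 3(2)]])
  finally show ?case .
next
  case (4 x) then show ?case by (rule inverse_on_u_minus)
next
  case (5 x)
  then show ?case
    using inverse_on_u_minus[OF 5] by (intro affine_eqI) (auto simp: loops_def not_less_iff_gr_or_eq)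
next
  case (6 x y z)
  let ?v = "G.inv_\<tau> x"
  let ?p = "proj (\<lambda>r. r < 0) (lbracket ?v z)"
  \<comment> \<open>The part of the bracket outside \<open>u_minus\<close>, possibly with a component along \<open>c\<close>.\<close>
  define w where "w = aff_bracket ?v z - ?p"
  have v: "?v \<in> loops" and x: "x \<in> loops" and y: "y \<in> loops" and z: "z \<in> loops"
    using 6 inverse_on_u_minus U_loops by auto
  have a: "?v \<in> affine_alg \<sigma>" "z \<in> affine_alg \<sigma>" using v z by (auto intro: loops_affine)
  have p: "?p \<in> affine_alg \<sigma>" by (intro loops_affine proj_loops lbracket_loops v z)
  have wa: "w \<in> affine_alg \<sigma>"
    unfolding w_def by (intro cvec.subspace_diff[OF subspace_affine_alg] aff_bracket_affine_alg a p)
  have "lform y (\<sigma>o w) = 0"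
  proof (intro lform_U_degree[OF 6(2)] coef_nonneg_image wa)
    show "coef w r = 0" if "r < 0" for r
      using that by (simp add: w_def lookup_minus aff_bracket_loops[OF v z])
    show "snd (snd w) = 0" by (simp add: w_def coef_aff_bracket)
  qed
  moreover have "aff_bracket ?v z = ?p + w" by (simp add: w_def)
  ultimately have "lform y (\<sigma>o (aff_bracket ?v z)) = lform y (\<sigma>o ?p)"
    by (simp add: G.\<tau>_add[OF p wa] clinear_complex_simps[OF clinear_lform(2)])
  moreover have "\<sigma>o (aff_bracket ?v z) = aff_bracket (\<sigma>o z) x"
    using G.\<tau>_bracket[OF a] inverse_on_u_minus(4)[OF 6(1)] by simp
  moreover have "lform y (aff_bracket (\<sigma>o z) x) = lform y (lbracket (\<sigma>o z) x)"
    using aff_bracket_loops[OF G.\<tau>_loops(4)[OF U_loops[OF 6(3)]] x] by (simp add: lform_def)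
  ultimately have "lform y (\<sigma>o ?p) = lform y (lbracket (\<sigma>o z) x)" by simp
  also have "\<dots> = lform (lbracket x y) (\<sigma>o z)"
    by (metis T.form_inv T.form_sym)
  finally show ?case
    using 6 by (simp add: aff_form_lform U_def u_minus_loops loops_def)
next
  case (7 i)
  obtain m s where i: "i = (m, s)" by (cases i)
  have c: "coef (u' i) r = 0" if "r \<le> 0" for r using that by (auto simp: i u'_def)
  note l = G.\<tau>_loops[OF u'_in_loops[of i] c[of 0, simplified]]
  have "\<sigma>o (u' i) \<in> U"
    using l by (auto simp: U_def u_minus_loops c G.rho_antilinear)
  moreover have "G.inv_\<tau> (\<sigma>o (u' i)) = u' i" by (rule G.inv_\<tau>[OF loops_affine[OF u'_in_loops]])
  ultimately show ?case by blast
qed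

lemma bdry_eq: "q \<in> ext_alg U \<Longrightarrow> bdry \<sigma> q = boundary lbracket q"
  unfolding bdry_def
  by (rule ce_boundary_eq_boundary[OF T.br_left T.br_right T.br_self])
    (simp_all add: U_def[symmetric] aff_bracket_U T.U_subspace)

lemma herm_eq: "herm \<sigma> \<sigma>o = H.E"
  by (simp add: herm_def U_def)

lemma bdry_adj_eq:
  assumes y: "y \<in> ext_alg U" "T.dstar y \<in> ext_pow p U"
  shows "bdry_adj \<sigma> \<sigma>o p y = T.dstar y"
proof -
  have "bdry_adj \<sigma> \<sigma>o p y = (THE z. z \<in> ext_pow p U \<and> (\<forall>x\<in>ext_pow p U. H.E (boundary lbracket x) y = H.E x z))"
    unfolding bdry_adj_def herm_eq U_def[symmetric]
    by (intro arg_cong[where f = The] ext conj_cong refl ball_cong) (simp add: bdry_eq ext_pow_subset_ext_alg)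
  then show ?thesis using H.adjoint_unique[OF y] by simp
qed

lemma act_d_eq: "q \<in> ext_alg U \<Longrightarrow> act \<sigma> d_el q = derivation (aff_bracket d_el) q"
  unfolding act_def
  by (rule ext_derivation_eq_derivation[OF clinear_aff_bracket_d])
    (simp_all add: U_def[symmetric] T.U_subspace)

lemma act_t_pow_0_eq: "q \<in> ext_alg U \<Longrightarrow> act \<sigma> (t_pow 0 c) q = derivation (lbracket (t_pow 0 c)) q"
  unfolding act_def
proof (rule ext_derivation_eq_derivation[OF T.br_right])
  fix x assume "x \<in> u_minus \<sigma>"
  then show "lbracket (t_pow 0 c) x = aff_bracket (t_pow 0 c) x"
    by (auto simp: aff_bracket_lbracket u_minus_loops loops_def t_pow_def prod_eq_iff intro!: sum.neutral)
qed (simp_all add: U_def[symmetric] T.U_subspace)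

text \<open>It remains to identify the operators of the statement with those of the abstract computation; both
  agree on decomposable elements of \<open>u_minus\<close>.\<close>

theorem laplacian_formula:
  assumes x: "x \<in> ext_pow p U"
  shows "laplacian \<sigma> \<sigma>o p x = (- 1/2) *\<^sub>C (act \<sigma> d_el x + casimir \<sigma> I b b' x)"
proof -
  have xa: "x \<in> ext_alg U" by (rule ext_pow_subset_ext_alg[OF x])
  have 1: "bdry_adj \<sigma> \<sigma>o (Suc p) x = T.dstar x"
    by (rule bdry_adj_eq[OF xa]) (simp add: T.dstar_in_ext_pow[OF x])
  have 2: "bdry_adj \<sigma> \<sigma>o p (boundary lbracket x) = T.dstar (boundary lbracket x)"
  proof (rule bdry_adj_eq[OF H.bdr_in_ext_alg[OF xa]])
    show "T.dstar (boundary lbracket x) \<in> ext_pow p U"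
    proof (cases p)
      case 0
      then obtain c where "x = c *\<^sub>C wedge []" using x ext_pow_0E by blast
      then show ?thesis by (simp add: T.op_linear T.bdr_one cvec.subspace_0[OF subspace_ext_pow])
    next
      case (Suc k)
      then show ?thesis
        using x boundary_in_ext_pow[OF T.br_left T.br_right T.br_self T.br_U, of x k]
        by (simp add: T.dstar_in_ext_pow)
    qed
  qed
  have "laplacian \<sigma> \<sigma>o p x = boundary lbracket (T.dstar x) + T.dstar (boundary lbracket x)"
    by (simp add: laplacian_def 1 bdry_eq xa 2 H.dstar_in_ext_alg)
  also have "\<dots> = (- 1/2) *\<^sub>C (derivation (aff_bracket d_el) x
      + (\<Sum>a\<in>I. derivation (lbracket (t_pow 0 (b a))) (derivation (lbracket (t_pow 0 (b' a))) x)))"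
    by (rule T.laplacian_eq_casimir[OF clinear_aff_bracket_d casimir_degree_one xa])
  also have "(\<Sum>a\<in>I. derivation (lbracket (t_pow 0 (b a))) (derivation (lbracket (t_pow 0 (b' a))) x)) = casimir \<sigma> I b b' x"
    unfolding casimir_def
    by (intro sum.cong refl) (simp add: act_t_pow_0_eq xa derivation_in_ext_alg[OF T.br_right T.b'_U])
  finally show ?thesis by (simp add: act_d_eq xa)
qed

end

text \<open>The element \<open>d\<close> lies in \<open>h_hat h0\<close> and in the real form, so it is fixed by the conjugation and
  hence by \<open>\<sigma>o\<close>.\<close>

theorem proposition3p1:
  fixes \<sigma> :: "'g::complex_lie_algebra \<Rightarrow> 'g"
    and b0 h0 :: "'g set"
    and X Y :: "('g affine \<Rightarrow> complex) \<Rightarrow> 'g"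
    and \<kappa> \<sigma>o :: "'g affine \<Rightarrow> 'g affine"
    and I :: "'i set" and b b' :: "'i \<Rightarrow> 'g"
    and p :: nat and x :: "'g affine ext"
  assumes "semisimple TYPE('g)"
    and "involutive_automorphism \<sigma>"
    and "borel_subalgebra (fix_part \<sigma>) b0"
    and "cartan_subalgebra (fix_part \<sigma>) h0" and "h0 \<subseteq> b0"
    and "chevalley_generators \<sigma> b0 h0 X Y"
    and "is_conjugation (affine_alg \<sigma>) (affine_real \<sigma> b0 h0 X Y) \<kappa>"
    and "antilinear_antiautomorphism \<sigma> \<sigma>o"
    and "\<And>h. h \<in> h_hat h0 \<Longrightarrow> \<sigma>o h = \<kappa> h"
    and "\<And>\<alpha>. \<alpha> \<in> simple_roots \<sigma> b0 h0 \<Longrightarrow> \<sigma>o (chev_e X \<alpha>) = chev_f Y \<alpha>"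
    and "\<And>\<alpha>. \<alpha> \<in> simple_roots \<sigma> b0 h0 \<Longrightarrow> \<sigma>o (chev_f Y \<alpha>) = chev_e X \<alpha>"
    and "dual_bases (fix_part \<sigma>) I b b'"
    and "x \<in> ext_pow p (u_minus \<sigma>)"
  shows "laplacian \<sigma> \<sigma>o p x = (- 1/2) *\<^sub>C (act \<sigma> d_el x + casimir \<sigma> I b b' x)"
proof -
  interpret involutive_lie_dual \<sigma> I b b'
    by unfold_locales (use assms in auto)
  obtain B and e e' :: "'g \<Rightarrow> 'g" where B: "finite B \<and> (\<forall>s. e s \<in> anti_part \<sigma> \<and> e' s \<in> anti_part \<sigma>) \<and>
      (\<forall>x\<in>anti_part \<sigma>. (\<Sum>s\<in>B. killing (e' s) x *\<^sub>C e s) = x) \<and>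
      (\<forall>x\<in>anti_part \<sigma>. (\<Sum>s\<in>B. killing (e s) x *\<^sub>C e' s) = x)"
    using p_part_system_exists by (elim exE)
  have "twisted_loop \<sigma> I b b' B e e'"
    by (intro twisted_loop.intro twisted_loop_axioms.intro involutive_lie_dual_axioms) (use B in auto)
  have "0 \<in> h0"
    using assms(4) by (auto simp: cartan_subalgebra_def lie_subalgebra_def cvec.subspace_0)
  then have "d_el \<in> h_hat h0"
    unfolding h_hat_def
    by (intro CollectI exI[of _ 0] exI[of _ 1]) (auto simp: t_pow_def cscale_one zero_prod_def[symmetric])
  moreover have "d_el \<in> affine_real \<sigma> b0 h0 X Y"
  proof -
    have "(0 :: 'g affine) \<in> h_real \<sigma> b0 h0"
      unfolding h_real_def by (intro CollectI exI[of _ "{}"]) auto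
    then have "\<exists>x r. (d_el :: 'g affine) = x + complex_of_real r *\<^sub>C d_el \<and> x \<in> h_real \<sigma> b0 h0"
      by (intro exI[of _ 0] exI[of _ 1]) (auto simp: cscale_one)
    then show ?thesis unfolding affine_real_def by (intro real_lie_gen.base) blast
  qed
  ultimately have "\<sigma>o d_el = d_el"
    using assms(7,9) by (auto simp: is_conjugation_def)
  then have "graded_antiautomorphism \<sigma> \<sigma>o"
    using assms(8) involutive_lie_axioms by (simp add: graded_antiautomorphism_def graded_antiautomorphism_axioms_def)
  then interpret twisted_loop_hermitian \<sigma> I b b' B e e' \<sigma>o
    using \<open>twisted_loop \<sigma> I b b' B e e'\<close> by (simp add: twisted_loop_hermitian_def)
  show ?thesis using laplacian_formula assms(13) by (simp add: U_def)
qed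

end
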